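(* Let $\lambda\in\Lambda^+$ be a dominant weight and let $a\in\mathcal{F}$. Then $$\mathcal{I}_a(\lambda)=\bigsqcup_{\mu\in\Lambda^+,\ \mu\le\lambda} PB_a(\mu),$$ where the union runs over all dominant weights $\mu$ with $\mu\le\lambda$ in the dominance order, and the union is disjoint.
   Context: Fix $n\ge1$. Let $E=\{x\in\mathbb{R}^{n+1}:\sum_i x_i=0\}$ with the standard inner product $\langle-,-\rangle$, and let $\varepsilon_1,\dots,\varepsilon_{n+1}$ be the standard basis of $\mathbb{R}^{n+1}$. The root system of type $A_n$ is $\Phi=\{\varepsilon_i-\varepsilon_j: i\ne j\}$, with simple roots $\alpha_i=\varepsilon_i-\varepsilon_{i+1}$ ($1\le i\le n$), positive roots $\Phi^+=\{\varepsilon_i-\varepsilon_j:i<j\}$ and highest root $\tilde\alpha=\varepsilon_1-\varepsilon_{n+1}$. The fundamental weights $\varpi_1,\dots,\varpi_n\in E$ satisfy $\langle\varpi_i,\alpha_j\rangle=\delta_{ij}$; set $\varpi_0=0$. Let $\Lambda=\bigoplus_i\mathbb{Z}\varpi_i$ (weights), $\mathbb{Z}\Phi$ the root lattice, $\Lambda^+=\{\lambda\in\Lambda:\langle\lambda,\alpha_i\rangle\ge0\ \forall i\}$ (dominant weights). Dominance order on $\Lambda$: $\mu\le\lambda$ iff $\lambda-\mu\in\sum_i\mathbb{Z}_{\ge0}\alpha_i$. For $\alpha\in\Phi,k\in\mathbb{Z}$ let $H_{\alpha,k}=\{x:\langle x,\alpha\rangle=k\}$ and $s_{\alpha,k}$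 the orthogonal reflection in it. The affine Weyl group $W_{\mathrm{aff}}$ is the group generated by all $s_{\alpha,k}$; $W_{\mathrm f}$ is the subgroup generated by $s_{\alpha_i,0}$, with longest element $w_0$. Alcoves are the connected components of $E\setminus\bigcup H_{\alpha,k}$; the fundamental alcove is $\mathcal{A}_{\mathrm{id}}=\{x:-1<\langle x,\alpha\rangle<0\ \forall\alpha\in\Phi^+\}$, and $w\mapsto\mathcal{A}_w=w(\mathcal{A}_{\mathrm{id}})$ is a bijection from $W_{\mathrm{aff}}$ to alcoves. $(W_{\mathrm{aff}},S)$ is a Coxeter system with $S=\{s_{\alpha_1,0},\dots,s_{\alpha_n,0},s_0=s_{\tilde\alpha,-1}\}$, and $\le$ on $W_{\mathrm{aff}}$ denotes the Bruhat order. Let $\Pi^+=\{x\in E:0\le\langle x,\alpha_i\rangle\le1\ \forall i\}$, $\Pi^-=w_0(\Pi^+)$, and $\mathcal{F}=\{a\in W_{\mathrm{aff}}:\mathcal{A}_a\subset\Pi^-\}$. For $\lambda\in\Lambda^+$ and $a\in\mathcal{F}$, $\theta_a(\lambda)$ is the unique element of $W_{\mathrm{aff}}$ with $\mathcal{A}_{\theta_a(\lambda)}=\mathcal{A}_{w_0a}+\lambda$. Set $\mathcal{I}_a(\lambda)=\{x\in W_{\mathrm{aff}}:x\le\theta_a(\lambda)\}$. For $\mu,\lambda\in\Lambda^+$, write $\mu\lessdot\lambda$ if $\lambda$ covers $\mu$ in the poset $(\Lambda^+,\le)$ (dominance order restricted to dominant weights). The Paper Boat is $PB_a(\lambda)=\mathcal{I}_a(\lambda)\setminus\bigcup_{\mu\in\Lambda^+,\,\mu\lessdot\lambda}\mathcal{I}_a(\mu)$.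 *)

theory Defs
  imports
    "HOL-Analysis.Analysis"
    "HOL-Algebra.Bij"
    "HOL-Algebra.Generated_Groups"
begin

section \<open>Length and Bruhat order of a group with a set of involutive generators\<close>

definition cox_length :: "('g, 'b) monoid_scheme \<Rightarrow> 'g set \<Rightarrow> 'g \<Rightarrow> nat" where
  "cox_length G S w =
     (LEAST k. \<exists>ws. set ws \<subseteq> S \<and> length ws = k \<and> foldr (\<otimes>\<^bsub>G\<^esub>) ws \<one>\<^bsub>G\<^esub> = w)"

definition cox_reflections :: "('g, 'b) monoid_scheme \<Rightarrow> 'g set \<Rightarrow> 'g set" where
  "cox_reflections G S = {w \<otimes>\<^bsub>G\<^esub> s \<otimes>\<^bsub>G\<^esub> inv\<^bsub>G\<^esub> w | w s. w \<in> carrier G \<and> s \<in> S}"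

definition bruhat_step :: "('g, 'b) monoid_scheme \<Rightarrow> 'g set \<Rightarrow> 'g \<Rightarrow> 'g \<Rightarrow> bool" where
  "bruhat_step G S u v \<longleftrightarrow> u \<in> carrier G \<and> v \<in> carrier G \<and>
     (\<exists>t \<in> cox_reflections G S. v = u \<otimes>\<^bsub>G\<^esub> t) \<and> cox_length G S u < cox_length G S v"

definition bruhat_le :: "('g, 'b) monoid_scheme \<Rightarrow> 'g set \<Rightarrow> 'g \<Rightarrow> 'g \<Rightarrow> bool" where
  "bruhat_le G S = (bruhat_step G S)\<^sup>*\<^sup>*"

definition longest_element :: "('g, 'b) monoid_scheme \<Rightarrow> 'g set \<Rightarrow> 'g" where
  "longest_element G S =
     (THE w. w \<in> carrier G \<and> (\<forall>v \<in> carrier G. cox_length G S v \<le> cox_length G S w))"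


section \<open>The root system of type \<open>A\<^sub>n\<close>\<close>

text \<open>
  The ambient space \<open>\<real>\<^sup>n\<^sup>+\<^sup>1\<close> is \<^typ>\<open>real ^ 'm\<close> with \<open>CARD('m) = n + 1\<close>; the linear order on the
  index type numbers the coordinates, so that \<open>std_basis 1, \<dots>, std_basis (n + 1)\<close> is the
  standard basis in increasing order. Indices \<open>1 \<le> i \<le> n\<close> appear as \<open>i \<in> {1..<CARD('m)}\<close>.
\<close>

type_synonym 'm rvec = "(real, 'm) vec"

definition std_basis :: "nat \<Rightarrow> 'm::{finite,linorder} rvec" where
  "std_basis i = axis (sorted_list_of_set (UNIV :: 'm set) ! (i - 1)) 1"

definition sum_zero_space :: "'m::{finite,linorder} rvec set" where
  "sum_zero_space = {x. (\<Sum>i\<in>UNIV. x $ i) = 0}"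

definition roots :: "'m::{finite,linorder} rvec set" where
  "roots = {std_basis i - std_basis j | i j.
              i \<in> {1..CARD('m)} \<and> j \<in> {1..CARD('m)} \<and> i \<noteq> j}"

definition pos_roots :: "'m::{finite,linorder} rvec set" where
  "pos_roots = {std_basis i - std_basis j | i j.
                  i \<in> {1..CARD('m)} \<and> j \<in> {1..CARD('m)} \<and> i < j}"

definition simple_root :: "nat \<Rightarrow> 'm::{finite,linorder} rvec" where
  "simple_root i = std_basis i - std_basis (i + 1)"

definition highest_root :: "'m::{finite,linorder} rvec" where
  "highest_root = std_basis 1 - std_basis CARD('m)"

definition fund_weight :: "nat \<Rightarrow> 'm::{finite,linorder} rvec" where
  "fund_weight i =
     (THE v. v \<in> sum_zero_space \<and>
        (\<forall>j \<in> {1..<CARD('m)}. v \<bullet> simple_root j = (if i = j then 1 else 0)))"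

definition weights :: "'m::{finite,linorder} rvec set" where
  "weights = {\<Sum>i = 1..<CARD('m). real_of_int (c i) *\<^sub>R fund_weight i | c. True}"

definition dominant_weights :: "'m::{finite,linorder} rvec set" where
  "dominant_weights = {l \<in> weights. \<forall>i \<in> {1..<CARD('m)}. 0 \<le> l \<bullet> simple_root i}"

definition dominance_le ::
  "'m::{finite,linorder} rvec \<Rightarrow> 'm::{finite,linorder} rvec \<Rightarrow> bool" where
  "dominance_le \<mu> l \<longleftrightarrow>
     (\<exists>c :: nat \<Rightarrow> nat. l - \<mu> = (\<Sum>i = 1..<CARD('m). real (c i) *\<^sub>R simple_root i))"

definition dominant_cover ::
  "'m::{finite,linorder} rvec \<Rightarrow> 'm::{finite,linorder} rvec \<Rightarrow> bool" where
  "dominant_cover \<mu> l \<longleftrightarrow>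
     \<mu> \<in> dominant_weights \<and> l \<in> dominant_weights \<and> dominance_le \<mu> l \<and> \<mu> \<noteq> l \<and>
     (\<forall>\<nu> \<in> dominant_weights. dominance_le \<mu> \<nu> \<and> dominance_le \<nu> l \<longrightarrow> \<nu> = \<mu> \<or> \<nu> = l)"


section \<open>The affine Weyl group and its alcoves\<close>

text \<open>
  Group elements are bijections of the sum-zero hyperplane, represented, as in
  \<^const>\<open>BijGroup\<close>, by functions that are \<^const>\<open>undefined\<close> outside of it.
  The reflection below is the orthogonal one in \<open>{x. x \<bullet> \<alpha> = k}\<close>.
\<close>

definition aff_reflection ::
  "'m::{finite,linorder} rvec \<Rightarrow> int \<Rightarrow> 'm rvec \<Rightarrow> 'm rvec" where
  "aff_reflection \<alpha> k =
     (\<lambda>x \<in> sum_zero_space. x - (2 * (x \<bullet> \<alpha> - real_of_int k) / (\<alpha> \<bullet> \<alpha>)) *\<^sub>R \<alpha>)"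

definition aff_weyl :: "('m::{finite,linorder} rvec \<Rightarrow> 'm rvec) monoid" where
  "aff_weyl = (BijGroup sum_zero_space)
     \<lparr>carrier := generate (BijGroup sum_zero_space) {aff_reflection \<alpha> k | \<alpha> k. \<alpha> \<in> roots}\<rparr>"

definition fin_simple_reflections :: "('m::{finite,linorder} rvec \<Rightarrow> 'm rvec) set" where
  "fin_simple_reflections = {aff_reflection (simple_root i) 0 | i. i \<in> {1..<CARD('m)}}"

definition aff_simple_reflections :: "('m::{finite,linorder} rvec \<Rightarrow> 'm rvec) set" where
  "aff_simple_reflections =
     insert (aff_reflection highest_root (-1)) fin_simple_reflections"

definition fin_weyl :: "('m::{finite,linorder} rvec \<Rightarrow> 'm rvec) monoid" where
  "fin_weyl = (BijGroup sum_zero_space)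
     \<lparr>carrier := generate (BijGroup sum_zero_space) fin_simple_reflections\<rparr>"

definition w0 :: "'m::{finite,linorder} rvec \<Rightarrow> 'm rvec" where
  "w0 = longest_element fin_weyl fin_simple_reflections"

definition fund_alcove :: "'m::{finite,linorder} rvec set" where
  "fund_alcove = {x \<in> sum_zero_space. \<forall>\<alpha> \<in> pos_roots. -1 < x \<bullet> \<alpha> \<and> x \<bullet> \<alpha> < 0}"

definition alcove ::
  "('m::{finite,linorder} rvec \<Rightarrow> 'm rvec) \<Rightarrow> 'm rvec set" where
  "alcove w = w ` fund_alcove"

definition pos_box :: "'m::{finite,linorder} rvec set" where
  "pos_box = {x \<in> sum_zero_space.
     \<forall>i \<in> {1..<CARD('m)}. 0 \<le> x \<bullet> simple_root i \<and> x \<bullet> simple_root i \<le> 1}"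

definition neg_box :: "'m::{finite,linorder} rvec set" where
  "neg_box = w0 ` pos_box"

definition box_elements :: "('m::{finite,linorder} rvec \<Rightarrow> 'm rvec) set" where
  "box_elements = {a \<in> carrier aff_weyl. alcove a \<subseteq> neg_box}"


section \<open>Lower intervals and Paper Boats\<close>

definition theta ::
  "('m::{finite,linorder} rvec \<Rightarrow> 'm rvec) \<Rightarrow> 'm rvec \<Rightarrow> ('m rvec \<Rightarrow> 'm rvec)" where
  "theta a l = (THE w. w \<in> carrier aff_weyl \<and>
     alcove w = (\<lambda>x. x + l) ` alcove (w0 \<otimes>\<^bsub>aff_weyl\<^esub> a))"

definition lower_interval ::
  "('m::{finite,linorder} rvec \<Rightarrow> 'm rvec) \<Rightarrow> 'm rvec \<Rightarrow> ('m rvec \<Rightarrow> 'm rvec) set" where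
  "lower_interval a l =
     {x \<in> carrier aff_weyl. bruhat_le aff_weyl aff_simple_reflections x (theta a l)}"

definition paper_boat ::
  "('m::{finite,linorder} rvec \<Rightarrow> 'm rvec) \<Rightarrow> 'm rvec \<Rightarrow> ('m rvec \<Rightarrow> 'm rvec) set" where
  "paper_boat a l =
     lower_interval a l - (\<Union>\<mu> \<in> {\<mu> \<in> dominant_weights. dominant_cover \<mu> l}. lower_interval a \<mu>)"

end

theory Submission
  imports Defs
begin

text \<open>
  An element of the affine Weyl group of type \<open>A\<close> is an affine permutation, recorded by an integer
  vector \<open>Y\<close> of length \<open>N = n + 1\<close> with distinct residues modulo \<open>N\<close>. An alcove in the dominant chamber
  is maximal in its coset of the finite Weyl group, so \<open>x\<close> lies below it in the Bruhat order iff
  \<open>bead_count X j \<le> bead_count Y j\<close> for all \<open>j\<close> (containment of \<open>N\<close>-cores).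
  For decreasing \<open>Y\<close> the number \<open>bead_count Y j\<close> is a maximum of prefix sums, and \<open>\<theta>\<^sub>a(\<lambda>)\<close> is
  obtained by adding \<open>N \<lambda>\<close> to a fixed decreasing vector. Shifting \<open>j\<close> by multiples of \<open>N\<close> makes any prescribed prefix
  the optimal one, so \<open>x \<le> \<theta>\<^sub>a(\<lambda>)\<close> amounts to separate lower bounds on the partial sums
  \<open>\<lambda>\<^sub>1 + \<dots> + \<lambda>\<^sub>p\<close>. Hence the lower intervals are monotone in the dominance order, and the
  intersection of two of them is the one of the meet, which has the minima of the partial sums and is
  again dominant. Minimality arguments in the dominance order then give the decomposition.
\<close>

section \<open>Windows of affine permutations\<close>

text \<open>The obstacle is a mismatch of languages. The Bruhat order is defined by word lengths and
  by right multiplication with conjugates of generators, while the geometry speaks of hyperplanes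
  separating alcoves. Moved to the left of an element, a reflection becomes a hyperplane reflection,
  and strong exchange turns a change of side into a change of length; after that the whole order can
  be read off windows. Bead counts see only cosets of the finite Weyl group, so they cannot decide
  the Bruhat order between arbitrary elements. They suffice below a decreasing window because it is
  the longest element of its coset. Translation by a weight outside the root lattice is not in the
  affine Weyl group, so \<open>theta a l\<close> is not a product with a translation. Its alcove is
  still a translate, and on windows this is harmless: the entries of \<open>N\<close> times a weight
  are integers, all congruent modulo \<open>N\<close>. The meet of two weights makes sense only
  within one coset of the root lattice. The common upper bound \<lambda> puts both weights into the
  same coset.\<close>

text \<open>The prescribed sum encodes that the translation parts add up to zero. The value 0
  outside the index range makes a window determined by its entries, so that windows can be compared
  as functions.\<close>

definition is_window :: "nat \<Rightarrow> (nat \<Rightarrow> int) \<Rightarrow> bool" where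
  "is_window N Y \<longleftrightarrow>
     (\<forall>i\<in>{1..N}. \<forall>j\<in>{1..N}. Y i mod int N = Y j mod int N \<longrightarrow> i = j) \<and>
     (\<Sum>i=1..N. Y i) = (\<Sum>i=1..N. int i) \<and> (\<forall>i. i \<notin> {1..N} \<longrightarrow> Y i = 0)"

definition id_window :: "nat \<Rightarrow> nat \<Rightarrow> int" where
  "id_window N i = (if i \<in> {1..N} then int i else 0)"

text \<open>The effect on windows of the reflection in \<open>{x. x\<^sub>i - x\<^sub>j = k}\<close>.\<close>

definition reflect_window :: "nat \<Rightarrow> nat \<Rightarrow> nat \<Rightarrow> int \<Rightarrow> (nat \<Rightarrow> int) \<Rightarrow> nat \<Rightarrow> int" where
  "reflect_window N i j k Y = Y(i := Y j + k * int N, j := Y i - k * int N)"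

text \<open>Whether \<open>Y\<close> and the identity window lie on the same side of that hyperplane.\<close>

definition same_side :: "nat \<Rightarrow> nat \<Rightarrow> nat \<Rightarrow> int \<Rightarrow> (nat \<Rightarrow> int) \<Rightarrow> bool" where
  "same_side N i j k Y \<longleftrightarrow> 0 < (Y i - Y j - k * int N) * (int i - int j - k * int N)"

text \<open>The hyperplane does not separate \<open>X\<close> from the identity but does separate
  \<open>Y\<close> from it, so this models a length-increasing reflection;
  \<open>bruhat_step_iff\<close> confirms it.\<close>

definition window_step :: "nat \<Rightarrow> (nat \<Rightarrow> int) \<Rightarrow> (nat \<Rightarrow> int) \<Rightarrow> bool" where
  "window_step N X Y \<longleftrightarrow> (\<exists>i\<in>{1..N}. \<exists>j\<in>{1..N}. \<exists>k. i \<noteq> j \<and>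
     Y = reflect_window N i j k X \<and> same_side N i j k X)"

text \<open>
  The number of beads in positions \<open>\<ge> j\<close> on the abacus with beads \<open>Y i - k * N\<close>, \<open>k \<ge> 0\<close>; it is
  invariant under permuting the entries of \<open>Y\<close>, that is, under the finite Weyl group.
\<close>

definition bead_count :: "nat \<Rightarrow> (nat \<Rightarrow> int) \<Rightarrow> int \<Rightarrow> int" where
  "bead_count N Y j = (\<Sum>i=1..N. max 0 ((Y i - j) div int N + 1))"

lemma sum_fun_upd2:
  fixes g :: "'a \<Rightarrow> 'b \<Rightarrow> int"
  assumes "finite A" "i \<in> A" "j \<in> A" "i \<noteq> j"
  shows "(\<Sum>l\<in>A. g l ((X(i := a, j := b)) l)) =
    (\<Sum>l\<in>A. g l (X l)) - g i (X i) - g j (X j) + g i a + g j b"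
proof -
  have A: "A = insert i (insert j (A - {i, j}))" using assms by auto
  have "(\<Sum>l\<in>A - {i, j}. g l ((X(i := a, j := b)) l)) = (\<Sum>l\<in>A - {i, j}. g l (X l))"
    by (rule sum.cong) auto
  then show ?thesis
    by (subst (1 2) A) (use assms in \<open>simp add: insert_Diff_if\<close>)
qed

text \<open>The difference is nonzero of absolute value below \<open>N\<close>. Hence the identity
  window lies on none of the hyperplanes, and the second factor in \<open>same_side\<close> never
  vanishes.\<close>

lemma index_diff_not_multiple:
  assumes "i \<in> {1..N}" "j \<in> {1..N}" "i \<noteq> j"
  shows "int i - int j \<noteq> k * int N"
proof
  assume eq: "int i - int j = k * int N"
  have "\<bar>int i - int j\<bar> < int N" "int i - int j \<noteq> 0" using assms by auto
  then have "\<bar>k\<bar> * int N < 1 * int N" "k \<noteq> 0" unfolding eq by (auto simp: abs_mult)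
  then show False by (simp only: mult_less_cancel_right) auto
qed

lemma window_diff_not_multiple:
  assumes "is_window N Y" "i \<in> {1..N}" "j \<in> {1..N}" "i \<noteq> j"
  shows "Y i - Y j \<noteq> k * int N"
proof
  assume "Y i - Y j = k * int N"
  then have "Y i = Y j + k * int N" by simp
  then have "Y i mod int N = Y j mod int N" by simp
  then show False using assms unfolding is_window_def by blast
qed

lemma window_inj:
  assumes "is_window N Y"
  shows "inj_on Y {1..N}"
  using assms unfolding is_window_def inj_on_def by metis

lemma is_window_reflect:
  assumes "is_window N Y" "i \<in> {1..N}" "j \<in> {1..N}" "i \<noteq> j"
  shows "is_window N (reflect_window N i j k Y)"
proof -
  let ?Y = "reflect_window N i j k Y"
  have sum: "(\<Sum>l=1..N. ?Y l) = (\<Sum>l=1..N. Y l)"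
    unfolding reflect_window_def
    by (subst sum_fun_upd2[where g = "\<lambda>_ y. y"]) (use assms in auto)
  have "(Y i - k * int N) mod int N = Y i mod int N"
    using mod_mult_self1[of "Y i" "- k" "int N"] by simp
  then have m: "?Y l mod int N = Y (if l = i then j else if l = j then i else l) mod int N" for l
    using assms by (auto simp: reflect_window_def)
  have inj: "a = b" if "a \<in> {1..N}" "b \<in> {1..N}" "?Y a mod int N = ?Y b mod int N" for a b
  proof -
    let ?s = "\<lambda>l. if l = i then j else if l = j then i else l"
    have "?s a \<in> {1..N}" "?s b \<in> {1..N}" "Y (?s a) mod int N = Y (?s b) mod int N"
      using that assms(2,3) unfolding m by simp_all
    then have "?s a = ?s b" using assms(1) unfolding is_window_def by blast
    then show ?thesis by (simp split: if_splits)
  qed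
  have "?Y l = 0" if "l \<notin> {1..N}" for l
  proof -
    have "Y l = 0" using that assms(1) unfolding is_window_def by blast
    then show ?thesis using that assms(2,3) by (auto simp: reflect_window_def)
  qed
  then show ?thesis
    using assms(1) sum inj unfolding is_window_def by (intro conjI) (blast, simp only:, blast)
qed

lemma reflect_window_involutive: "i \<noteq> j \<Longrightarrow> reflect_window N i j k (reflect_window N i j k Y) = Y"
  by (auto simp: reflect_window_def fun_eq_iff)

lemma image_reflect_window:
  assumes "i \<in> {1..N}" "j \<in> {1..N}"
  shows "reflect_window N i j 0 X ` {1..N} = X ` {1..N}"
proof -
  have "reflect_window N i j 0 X = X \<circ> Transposition.transpose i j"
    by (auto simp: reflect_window_def Transposition.transpose_def)
  moreover have "Transposition.transpose i j ` {1..N} = {1..N}"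
    by (rule permutes_image[OF permutes_swap_id[OF assms]])
  ultimately show ?thesis by (metis image_comp)
qed

lemma is_window_id: "is_window N (id_window N)"
  unfolding is_window_def
proof (intro conjI ballI impI allI)
  fix i j assume a: "i \<in> {1..N}" "j \<in> {1..N}" "id_window N i mod int N = id_window N j mod int N"
  then have "int N dvd int i - int j" by (simp add: id_window_def mod_eq_dvd_iff)
  then obtain k where "int i - int j = k * int N" by (auto simp: dvd_def mult.commute)
  then show "i = j" using index_diff_not_multiple a by blast
qed (auto simp: id_window_def)

text \<open>The first factor changes its sign under the reflection, and neither factor can be
  zero.\<close>

lemma same_side_reflect:
  assumes "is_window N Y" "i \<in> {1..N}" "j \<in> {1..N}" "i \<noteq> j"
  shows "same_side N i j k (reflect_window N i j k Y) \<longleftrightarrow> \<not> same_side N i j k Y"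
proof -
  let ?D = "Y i - Y j - k * int N" and ?c = "int i - int j - k * int N"
  have "?D \<noteq> 0" "?c \<noteq> 0"
    using window_diff_not_multiple[OF assms, of k] index_diff_not_multiple[OF assms(2-4), of k] by auto
  then have nz: "?D * ?c \<noteq> 0" by simp
  have "reflect_window N i j k Y i - reflect_window N i j k Y j - k * int N = - ?D"
    using assms by (simp add: reflect_window_def)
  then have "same_side N i j k (reflect_window N i j k Y) \<longleftrightarrow> 0 < - ?D * ?c"
    unfolding same_side_def by metis
  moreover have "- ?D * ?c = - (?D * ?c)" by (rule minus_mult_left[symmetric])
  ultimately show ?thesis using nz unfolding same_side_def by linarith
qed

lemma increasing_diff_ge:
  fixes Y :: "nat \<Rightarrow> int"
  assumes inc: "\<And>p. p \<in> {1..<N} \<Longrightarrow> Y p < Y (Suc p)"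
  shows "1 \<le> i \<Longrightarrow> i \<le> j \<Longrightarrow> j \<le> N \<Longrightarrow> int j - int i \<le> Y j - Y i"
proof (induction j)
  case (Suc j)
  show ?case
  proof (cases "i = Suc j")
    case False
    then show ?thesis using Suc inc[of j] by auto
  qed simp
qed simp

text \<open>The walls of the fundamental alcove suffice to recognise the identity:
  \<open>N - 1\<close> integer gaps of at least one with total at most \<open>N - 1\<close> are all
  equal to one, and the sum then fixes the first entry.\<close>

lemma window_eq_id:
  assumes w: "is_window N Y" and N: "1 \<le> N" and inc: "\<And>p. p \<in> {1..<N} \<Longrightarrow> Y p < Y (Suc p)"
    and wrap: "Y N < Y 1 + int N"
  shows "Y = id_window N"
proof -
  have Yi: "Y i = Y 1 + int i - 1" if "i \<in> {1..N}" for i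
    using increasing_diff_ge[of N Y 1 i] increasing_diff_ge[of N Y i N] inc wrap that N by auto
  have "(\<Sum>i=1..N. Y i) = (\<Sum>i=1..N. (Y 1 - 1) + int i)"
    by (rule sum.cong[OF refl], subst Yi) auto
  then have "int N * (Y 1 - 1) = 0" using w by (simp add: is_window_def sum.distrib)
  then have "Y 1 = 1" using N by simp
  then show ?thesis using Yi w by (auto simp: id_window_def is_window_def fun_eq_iff)
qed

text \<open>Discrete convexity of one summand of \<open>bead_count\<close>: subtracting
  \<open>k * N\<close> lowers the quotient by exactly \<open>k\<close>, and the truncation at zero
  is convex.\<close>

lemma convex_bead:
  fixes a b j :: int
  assumes "0 \<le> k" "a \<le> b" "0 < N"
  shows "max 0 ((a - j) div int N + 1) - max 0 ((a - k * int N - j) div int N + 1)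
    \<le> max 0 ((b - j) div int N + 1) - max 0 ((b - k * int N - j) div int N + 1)"
proof -
  have s: "(x - k * int N - j) div int N = (x - j) div int N - k" for x
  proof -
    have "(x - j + (- k) * int N) div int N = - k + (x - j) div int N"
      using assms by (intro div_mult_self1) auto
    then show ?thesis by (simp add: algebra_simps)
  qed
  have "(a - j) div int N \<le> (b - j) div int N" using assms by (intro zdiv_mono1) auto
  then show ?thesis unfolding s using assms(1) by (auto simp: max_def)
qed

text \<open>The reflection replaces two entries by two others with the same sum, and the side
  condition says that the new pair is spread further apart. Convexity then makes the sum of the two
  summands grow.\<close>

lemma bead_count_step:
  assumes "window_step N X Y"
  shows "bead_count N X m \<le> bead_count N Y m"
proof -
  obtain i j k where ij: "i \<in> {1..N}" "j \<in> {1..N}" "i \<noteq> j" and Y: "Y = reflect_window N i j k X"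
    and side: "same_side N i j k X" using assms unfolding window_step_def by blast
  define g where "g y = max 0 ((y - m) div int N + 1)" for y
  have N: "0 < N" using ij by auto
  have eq: "bead_count N Y m = bead_count N X m - g (X i) - g (X j) + g (X j + k * int N) + g (X i - k * int N)"
    unfolding bead_count_def Y reflect_window_def
    by (subst sum_fun_upd2[where g = "\<lambda>_. g", unfolded g_def]) (use ij in \<open>auto simp: g_def\<close>)
  have conv: "g a - g (a - c * int N) \<le> g b - g (b - c * int N)" if "0 \<le> c" "a \<le> b" for a b c
    unfolding g_def using convex_bead that N by blast
  consider "X i - X j - k * int N < 0" "int i - int j - k * int N < 0"
    | "X i - X j - k * int N > 0" "int i - int j - k * int N > 0"
    using side unfolding same_side_def by (auto simp: zero_less_mult_iff)
  then show ?thesis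
  proof cases
    case 1
    \<comment> \<open>The sign of \<open>k\<close> is forced: a negative \<open>k\<close> would need
      an index difference below \<open>- N\<close>.\<close>
    have "0 \<le> k"
    proof (rule ccontr)
      assume "\<not> 0 \<le> k"
      then have "k * int N \<le> (-1) * int N" by (intro mult_right_mono) auto
      then show False using 1 ij by auto
    qed
    then show ?thesis using conv[of k "X i" "X j + k * int N"] 1 eq by simp
  next
    case 2
    have "k \<le> 0"
    proof (rule ccontr)
      assume "\<not> k \<le> 0"
      then have "1 * int N \<le> k * int N" by (intro mult_right_mono) auto
      then show False using 2 ij by auto
    qed
    then show ?thesis using conv[of "- k" "X j" "X i - k * int N"] 2 eq by simp
  qed
qed

lemma bead_count_steps: "(window_step N)\<^sup>*\<^sup>* X Y \<Longrightarrow> bead_count N X m \<le> bead_count N Y m"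
  by (induction rule: rtranclp_induct) (auto intro: order_trans bead_count_step)

lemma is_window_step: "window_step N X Y \<Longrightarrow> is_window N X \<Longrightarrow> is_window N Y"
  unfolding window_step_def using is_window_reflect by blast

section \<open>Exchanging adjacent residues\<close>

text \<open>For \<open>2 \<le> N\<close> this is the affine transposition of all
  \<open>r + m * N\<close> with \<open>r + 1 + m * N\<close>. It acts on the values of a window,
  whereas \<open>reflect_window\<close> acts on positions, so the two operations commute.\<close>

definition adjacent_swap :: "nat \<Rightarrow> int \<Rightarrow> int \<Rightarrow> int" where
  "adjacent_swap N r y =
     (if int N dvd y - r then y + 1 else if int N dvd y - r - 1 then y - 1 else y)"

definition swap_values :: "nat \<Rightarrow> int \<Rightarrow> (nat \<Rightarrow> int) \<Rightarrow> nat \<Rightarrow> int" where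
  "swap_values N r Y = (\<lambda>i. if i \<in> {1..N} then adjacent_swap N r (Y i) else 0)"

lemma not_dvd_consecutive:
  assumes "2 \<le> N" "int N dvd y"
  shows "\<not> int N dvd y - 1" "\<not> int N dvd y + 1"
proof -
  have n1: "\<not> int N dvd 1" using assms(1) by simp
  show "\<not> int N dvd y - 1" using n1 dvd_diff[OF assms(2), of "y - 1"] by auto
  show "\<not> int N dvd y + 1" using n1 dvd_diff[OF _ assms(2), of "y + 1"] by auto
qed

lemma dvd_shift_multiple: "int N dvd y + k * int N - s \<longleftrightarrow> int N dvd y - s"
  using dvd_add_times_triv_right_iff[of "int N" "y - s" k] by (simp add: algebra_simps)

lemma adjacent_swap_shift: "adjacent_swap N r (y + k * int N) = adjacent_swap N r y + k * int N"
  using dvd_shift_multiple[of N y k r] dvd_shift_multiple[of N y k "r + 1"]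
  unfolding adjacent_swap_def diff_diff_eq by (simp add: add.commute)

lemma adjacent_swap_involutive:
  assumes "2 \<le> N"
  shows "adjacent_swap N r (adjacent_swap N r y) = y"
  using not_dvd_consecutive[OF assms, of "y - r"] not_dvd_consecutive[OF assms, of "y - r - 1"]
  by (auto simp: adjacent_swap_def algebra_simps)

text \<open>Each value moves by at most one, so only values at distance one or two could lose their
  order. At distance two both would have to move to the middle, which puts two consecutive integers
  into the multiples of \<open>N\<close>.\<close>

lemma adjacent_swap_less:
  assumes "2 \<le> N" "a < b"
  shows "adjacent_swap N r a < adjacent_swap N r b \<or> b = a + 1 \<and> int N dvd a - r"
proof (rule ccontr)
  assume n: "\<not> ?thesis"
  have le: "adjacent_swap N r b \<le> adjacent_swap N r a" using n by simp
  have *: "adjacent_swap N r a \<le> a + 1" "adjacent_swap N r b \<ge> b - 1"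
    by (auto simp: adjacent_swap_def)
  then have "b = a + 1 \<or> b = a + 2" using le assms(2) by auto
  then show False
  proof
    assume b: "b = a + 1"
    then have "\<not> int N dvd a - r" using n by simp
    moreover from this have "\<not> int N dvd b - r - 1" using b by simp
    ultimately show False using le b by (auto simp: adjacent_swap_def split: if_splits)
  next
    assume b: "b = a + 2"
    then have "adjacent_swap N r a = a + 1" "adjacent_swap N r b = b - 1" using le * by auto
    then have "int N dvd a - r" "int N dvd b - r - 1" by (auto simp: adjacent_swap_def split: if_splits)
    then show False using not_dvd_consecutive(2)[OF assms(1), of "a - r"] b by (simp add: algebra_simps)
  qed
qed

lemma window_residue_unique:
  assumes "is_window N Y" "i \<in> {1..N}" "j \<in> {1..N}" "int N dvd Y i - r" "int N dvd Y j - r"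
  shows "i = j"
proof -
  have "int N dvd Y i - Y j" using dvd_diff[OF assms(4,5)] by simp
  then have "Y i mod int N = Y j mod int N" by (simp add: mod_eq_dvd_iff)
  then show ?thesis using assms(1-3) unfolding is_window_def by blast
qed

lemma window_residue_exists:
  assumes "is_window N Y" "1 \<le> N"
  obtains i where "i \<in> {1..N}" "int N dvd Y i - r"
proof -
  let ?f = "\<lambda>i. Y i mod int N"
  have inj: "inj_on ?f {1..N}" using assms(1) unfolding is_window_def inj_on_def by blast
  have sub: "?f ` {1..N} \<subseteq> {0..<int N}" using assms(2) by auto
  have "?f ` {1..N} = {0..<int N}"
    by (rule card_subset_eq[OF _ sub]) (use card_image[OF inj] in simp_all)
  moreover have "r mod int N \<in> {0..<int N}" using assms(2) by simp
  ultimately have "r mod int N \<in> ?f ` {1..N}" by blast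
  then obtain i where "i \<in> {1..N}" "Y i mod int N = r mod int N" by (elim imageE) simp
  then show ?thesis using that by (simp add: mod_eq_dvd_iff)
qed

text \<open>Each residue occurs exactly once, so a value exchange touches two entries only. It is
  therefore also a position reflection, in a hyperplane next to the window:
  \<open>Y i - Y j - k * N\<close> equals \<open>- 1\<close>.\<close>

lemma swap_values_eq_reflect:
  assumes N: "2 \<le> N" and w: "is_window N Y"
    and i: "i \<in> {1..N}" "int N dvd Y i - r" and j: "j \<in> {1..N}" "int N dvd Y j - r - 1"
  obtains k where "i \<noteq> j" "Y j = Y i + 1 - k * int N" "swap_values N r Y = reflect_window N i j k Y"
    "swap_values N r Y = Y(i := Y i + 1, j := Y j - 1)"
proof -
  have ne: "i \<noteq> j" using not_dvd_consecutive(1)[OF N i(2)] j(2) by auto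
  have "int N dvd (Y i - r) - (Y j - r - 1)" by (rule dvd_diff[OF i(2) j(2)])
  then obtain k where k: "Y i + 1 - Y j = int N * k" by (auto simp: dvd_def algebra_simps)
  have "swap_values N r Y l = (Y(i := Y i + 1, j := Y j - 1)) l" for l
  proof (cases "l \<in> {1..N}")
    case l: True
    show ?thesis
    proof (cases "l = i \<or> l = j")
      case True
      then show ?thesis
        using i j l ne not_dvd_consecutive(2)[OF N j(2)] by (auto simp: swap_values_def adjacent_swap_def)
    next
      case False
      then have "\<not> int N dvd Y l - r" "\<not> int N dvd Y l - (r + 1)"
        using window_residue_unique[OF w l i(1), of r] i(2)
          window_residue_unique[OF w l j(1), of "r + 1"] j(2) by (auto simp: algebra_simps)
      then show ?thesis using l False by (auto simp: swap_values_def adjacent_swap_def algebra_simps)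
    qed
  next
    case False
    then have "Y l = 0" using w unfolding is_window_def by blast
    then show ?thesis using False i j by (auto simp: swap_values_def)
  qed
  then have sw: "swap_values N r Y = Y(i := Y i + 1, j := Y j - 1)" by blast
  have e: "Y j + k * int N = Y i + 1" "Y i - k * int N = Y j - 1" using k by (simp_all add: algebra_simps)
  have "swap_values N r Y = reflect_window N i j k Y" unfolding sw reflect_window_def e ..
  moreover have "Y j = Y i + 1 - k * int N" using e(1) by linarith
  ultimately show ?thesis using that[OF ne _ _ sw] by blast
qed

lemma swap_values_window:
  assumes "2 \<le> N" "is_window N Y"
  shows "is_window N (swap_values N r Y)"
proof -
  obtain i where i: "i \<in> {1..N}" "int N dvd Y i - r"
    using window_residue_exists[OF assms(2), of r] assms(1) by auto
  obtain j where j: "j \<in> {1..N}" "int N dvd Y j - r - 1"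
    using window_residue_exists[OF assms(2), of "r + 1"] assms(1) by (auto simp: algebra_simps)
  show ?thesis
    using swap_values_eq_reflect[OF assms i j] is_window_reflect[OF assms(2) i(1) j(1)] by metis
qed

lemma swap_values_involutive:
  assumes "2 \<le> N" "is_window N Y"
  shows "swap_values N r (swap_values N r Y) = Y"
proof
  fix l
  show "swap_values N r (swap_values N r Y) l = Y l"
  proof (cases "l \<in> {1..N}")
    case False
    then have "Y l = 0" using assms(2) unfolding is_window_def by blast
    then show ?thesis using False by (auto simp: swap_values_def)
  qed (use assms in \<open>simp add: swap_values_def adjacent_swap_involutive\<close>)
qed

lemma swap_values_reflect:
  assumes "i \<in> {1..N}" "j \<in> {1..N}"
  shows "swap_values N r (reflect_window N i j k Y) = reflect_window N i j k (swap_values N r Y)"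
  using assms adjacent_swap_shift[of N r _ "- k"]
  by (auto simp: swap_values_def reflect_window_def fun_eq_iff adjacent_swap_shift)

text \<open>One step of the lifting property. The value exchange commutes with the reflection, so
  the step survives unless the exchange changes the side of \<open>U\<close>. By
  \<open>adjacent_swap_less\<close> that happens only for a pair being exchanged, and then exchange
  and reflection coincide on \<open>U\<close>.\<close>

lemma window_step_swap_values:
  assumes N: "2 \<le> N" and w: "is_window N U" and st: "window_step N U V"
  shows "window_step N (swap_values N r U) (swap_values N r V) \<or> swap_values N r U = V"
proof -
  obtain i j k where ij: "i \<in> {1..N}" "j \<in> {1..N}" "i \<noteq> j" and V: "V = reflect_window N i j k U"
    and side: "same_side N i j k U" using st unfolding window_step_def by blast
  let ?a = "U i" and ?b = "U j + k * int N"
  let ?c = "int i - int j - k * int N"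
  have V_i: "V i = ?b" "V j = ?a - k * int N" using ij V by (auto simp: reflect_window_def)
  have sw: "swap_values N r V = reflect_window N i j k (swap_values N r U)"
    unfolding V using ij by (simp add: swap_values_reflect)
  have diff: "swap_values N r U i - swap_values N r U j - k * int N = adjacent_swap N r ?a - adjacent_swap N r ?b"
    using ij by (simp add: swap_values_def adjacent_swap_shift)
  show ?thesis
  proof (cases "same_side N i j k (swap_values N r U)")
    case True
    then show ?thesis using ij sw unfolding window_step_def by blast
  next
    case False
    have D: "0 < (?a - ?b) * ?c" using side unfolding same_side_def by (simp add: algebra_simps)
    have D': "\<not> 0 < (adjacent_swap N r ?a - adjacent_swap N r ?b) * ?c"
      using False unfolding same_side_def diff .
    have cross: "?b = ?a + 1 \<and> int N dvd ?a - r \<or> ?a = ?b + 1 \<and> int N dvd ?b - r"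
    proof (cases "?a < ?b")
      case True
      then have "?c < 0" using D by (auto simp: zero_less_mult_iff)
      then show ?thesis using D' adjacent_swap_less[OF N True, of r] by (auto simp: zero_less_mult_iff)
    next
      case False
      then have ab: "?b < ?a" "0 < ?c" using D by (auto simp: zero_less_mult_iff)
      then show ?thesis using D' adjacent_swap_less[OF N ab(1), of r] by (auto simp: zero_less_mult_iff)
    qed
    have shift: "int N dvd U j - s \<longleftrightarrow> int N dvd ?b - s" for s
      using dvd_shift_multiple[of N "U j" k s] by simp
    from cross have "swap_values N r U = V"
    proof
      assume *: "?b = ?a + 1 \<and> int N dvd ?a - r"
      then have "int N dvd U j - r - 1" using shift[of "r + 1"] by (simp add: algebra_simps)
      with * have sw: "swap_values N r U = U(i := U i + 1, j := U j - 1)"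
        using swap_values_eq_reflect[OF N w ij(1) _ ij(2), of r] by blast
      have e: "U j + k * int N = U i + 1" "U i - k * int N = U j - 1" using * by linarith+
      show ?thesis unfolding sw V reflect_window_def e ..
    next
      assume *: "?a = ?b + 1 \<and> int N dvd ?b - r"
      then have "int N dvd U j - r" "U i - r - 1 = ?b - r" using shift[of r] by linarith+
      with * have "int N dvd U j - r" "int N dvd U i - r - 1" by (blast, metis)
      then have sw: "swap_values N r U = U(j := U j + 1, i := U i - 1)"
        using swap_values_eq_reflect[OF N w ij(2) _ ij(1), of r] by blast
      have e: "U j + k * int N = U i - 1" "U i - k * int N = U j + 1" using * by linarith+
      show ?thesis unfolding sw V reflect_window_def e by (rule fun_upd_twist[OF ij(3)[symmetric]])
    qed
    then show ?thesis ..
  qed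
qed

text \<open>The exchanged chain is followed until, if ever, it meets the original one; from there on
  the original chain is used.\<close>

lemma window_steps_swap_values:
  assumes "2 \<le> N"
  shows "(window_step N)\<^sup>*\<^sup>* U V \<Longrightarrow> is_window N U \<Longrightarrow>
    (window_step N)\<^sup>*\<^sup>* (swap_values N r U) (swap_values N r V) \<or> (window_step N)\<^sup>*\<^sup>* (swap_values N r U) V"
proof (induction rule: converse_rtranclp_induct)
  case (step U U')
  then show ?case
    using window_step_swap_values[OF assms step.prems step.hyps(1), of r] is_window_step
    by (metis converse_rtranclp_into_rtranclp)
qed simp

section \<open>Bead positions and the effect of an exchange on bead counts\<close>

definition has_bead :: "nat \<Rightarrow> (nat \<Rightarrow> int) \<Rightarrow> int \<Rightarrow> bool" where
  "has_bead N Y j \<longleftrightarrow> (\<exists>i\<in>{1..N}. j \<le> Y i \<and> int N dvd Y i - j)"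

lemma div_pred:
  assumes "0 < N"
  shows "(z - 1) div int N = z div int N - (if int N dvd z then 1 else 0)"
proof (cases "int N dvd z")
  case True
  then obtain q where "z = int N * q" by blast
  moreover have "(int N * q - 1) div int N = q - 1"
    by (rule int_div_pos_eq[of _ _ _ "int N - 1"]) (use assms in \<open>auto simp: algebra_simps\<close>)
  ultimately show ?thesis using assms by simp
next
  case False
  have "z mod int N \<noteq> 0" using False by (simp add: dvd_eq_mod_eq_0)
  moreover have "0 \<le> z mod int N" "z mod int N < int N" using assms by auto
  ultimately have "(z - 1) div int N = z div int N"
    by (intro int_div_pos_eq[of _ _ _ "z mod int N - 1"]) auto
  then show ?thesis using False by simp
qed

text \<open>Distinct residues put the entries on distinct runners of the abacus, so a position holds
  at most one bead and \<open>bead_count\<close> is a tail count with increments zero or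
  one.\<close>

lemma bead_count_pred:
  assumes w: "is_window N Y" and N: "1 \<le> N"
  shows "bead_count N Y j = bead_count N Y (j + 1) + (if has_bead N Y j then 1 else 0)"
proof -
  let ?P = "\<lambda>i. j \<le> Y i \<and> int N dvd Y i - j"
  have pt: "max 0 ((y - j) div int N + 1) = max 0 ((y - (j + 1)) div int N + 1) +
      (if j \<le> y \<and> int N dvd y - j then 1 else 0)" for y
  proof -
    have e: "(y - (j + 1)) div int N = (y - j) div int N - (if int N dvd y - j then 1 else 0)"
      using div_pred[of N "y - j"] N by (simp add: algebra_simps)
    have "0 \<le> (y - j) div int N \<longleftrightarrow> j \<le> y" using N by (simp add: pos_imp_zdiv_nonneg_iff)
    then show ?thesis unfolding e by auto
  qed
  have "(\<Sum>i=1..N. if ?P i then 1 else 0) = (if has_bead N Y j then 1 else (0::int))"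
  proof (cases "has_bead N Y j")
    case True
    then obtain i where i: "i \<in> {1..N}" "?P i" unfolding has_bead_def by blast
    then have "?P l \<longleftrightarrow> l = i" if "l \<in> {1..N}" for l
      using window_residue_unique[OF w that i(1)] by blast
    then have "(\<Sum>l=1..N. if ?P l then 1 else 0) = (\<Sum>l=1..N. if l = i then 1 else (0::int))"
      by (intro sum.cong) auto
    then show ?thesis using i True by simp
  next
    case False
    then have "(\<Sum>i=1..N. if ?P i then 1 else 0) = (\<Sum>i=1..N. (0::int))"
      unfolding has_bead_def by (intro sum.cong) auto
    then show ?thesis using False by simp
  qed
  then show ?thesis unfolding bead_count_def by (subst pt) (simp add: sum.distrib)
qed

text \<open>The exchange swaps the contents of positions \<open>j - 1\<close> and \<open>j\<close>
  when \<open>j\<close> is congruent to \<open>r + 1\<close>. Only the tail starting between them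
  notices: it loses the bead at \<open>j\<close> and gains the one at \<open>j - 1\<close>.\<close>

lemma bead_count_swap_values:
  assumes N: "2 \<le> N"
  shows "bead_count N (swap_values N r Y) j =
    (if int N dvd j - r - 1 then bead_count N Y (j - 1) + bead_count N Y (j + 1) - bead_count N Y j
     else bead_count N Y j)"
proof -
  define g where "g y j = max 0 ((y - j) div int N + 1)" for y j
  have gs: "g y j = g y (j + 1)" if "\<not> int N dvd y - j" for y j
    using div_pred[of N "y - j"] N that unfolding g_def by (simp add: algebra_simps)
  have gp: "g (y + 1) j = g y (j - 1)" "g (y - 1) j = g y (j + 1)" for y j
    unfolding g_def by (simp_all add: algebra_simps)
  have dv: "int N dvd j - r - 1 \<Longrightarrow> int N dvd y - (j - 1) \<longleftrightarrow> int N dvd y - r"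
       "int N dvd j - r - 1 \<Longrightarrow> int N dvd y - j \<longleftrightarrow> int N dvd y - r - 1"
       "int N dvd y - r \<Longrightarrow> int N dvd y - (j - 1) \<longleftrightarrow> int N dvd j - r - 1"
       "int N dvd y - r - 1 \<Longrightarrow> int N dvd y - j \<longleftrightarrow> int N dvd j - r - 1" for y
    by (simp_all add: mod_eq_dvd_iff[symmetric] diff_diff_eq) (smt (verit) mod_eq_dvd_iff dvd_diff)+
  have pt: "g (adjacent_swap N r y) j =
      (if int N dvd j - r - 1 then g y (j - 1) + g y (j + 1) - g y j else g y j)" for y
  proof (cases "int N dvd y - r")
    case 1: True
    have n: "\<not> int N dvd y - r - 1" using not_dvd_consecutive(1)[OF N 1] .
    have "g (adjacent_swap N r y) j = g y (j - 1)" using 1 gp by (simp add: adjacent_swap_def)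
    then show ?thesis using gs[of y j] gs[of y "j - 1"] dv[of y] 1 n by auto
  next
    case 2: False
    show ?thesis
    proof (cases "int N dvd y - r - 1")
      case True
      have "g (adjacent_swap N r y) j = g y (j + 1)" using 2 True gp by (simp add: adjacent_swap_def)
      then show ?thesis using gs[of y j] gs[of y "j - 1"] dv[of y] 2 True by auto
    next
      case False
      have "g (adjacent_swap N r y) j = g y j" using 2 False by (simp add: adjacent_swap_def)
      then show ?thesis using gs[of y j] gs[of y "j - 1"] dv[of y] 2 False by auto
    qed
  qed
  have "bead_count N (swap_values N r Y) j = (\<Sum>i=1..N. g (adjacent_swap N r (Y i)) j)"
    unfolding bead_count_def g_def by (rule sum.cong) (auto simp: swap_values_def)
  also have "\<dots> = (if int N dvd j - r - 1 then bead_count N Y (j - 1) + bead_count N Y (j + 1) - bead_count N Y j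
     else bead_count N Y j)"
    unfolding bead_count_def g_def[symmetric] by (simp add: pt sum.distrib sum_subtractf)
  finally show ?thesis .
qed

section \<open>The bead count criterion for the Bruhat order\<close>

text \<open>Entries are, up to an additive constant, \<open>N\<close> times the coordinates of the
  image of \<open>base_point\<close>, so this says that the alcove lies in the dominant chamber. As
  the fundamental alcove is antidominant, such elements are the longest in their cosets.\<close>

definition decreasing_window :: "nat \<Rightarrow> (nat \<Rightarrow> int) \<Rightarrow> bool" where
  "decreasing_window N Y \<longleftrightarrow> (\<forall>i\<in>{1..N}. \<forall>j\<in>{1..N}. i < j \<longrightarrow> Y j < Y i)"

text \<open>This will be the window of \<open>w0\<close>.\<close>

definition rev_window :: "nat \<Rightarrow> nat \<Rightarrow> int" where
  "rev_window N i = (if i \<in> {1..N} then int N + 1 - int i else 0)"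

text \<open>A length-increasing left multiplication by a finite simple reflection. Such steps settle
  the base case of the criterion and also identify \<open>w0\<close>.\<close>

definition ascent_step :: "nat \<Rightarrow> (nat \<Rightarrow> int) \<Rightarrow> (nat \<Rightarrow> int) \<Rightarrow> bool" where
  "ascent_step N X Y \<longleftrightarrow> (\<exists>i\<in>{1..<N}. X i < X (Suc i) \<and> Y = reflect_window N i (Suc i) 0 X)"

lemma has_bead_down:
  assumes "has_bead N Y j" "j' \<le> j" "int N dvd j - j'"
  shows "has_bead N Y j'"
proof -
  obtain i where i: "i \<in> {1..N}" "j \<le> Y i" "int N dvd Y i - j" using assms(1) unfolding has_bead_def by blast
  have "int N dvd Y i - j'" using dvd_add[OF i(3) assms(3)] by simp
  then show ?thesis using i assms(2) unfolding has_bead_def by force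
qed

text \<open>Each runner is filled downwards without gaps, so of the neighbouring runners
  \<open>r\<close> and \<open>r + 1\<close>, one is contained in the other up to the shift by
  one.\<close>

lemma has_bead_dichotomy:
  shows "(\<forall>j. int N dvd j - r - 1 \<longrightarrow> has_bead N X j \<longrightarrow> has_bead N X (j - 1)) \<or>
    (\<forall>j. int N dvd j - r - 1 \<longrightarrow> has_bead N X (j - 1) \<longrightarrow> has_bead N X j)"
proof (rule ccontr)
  assume "\<not> ?thesis"
  then obtain j j' where j: "int N dvd j - r - 1" "has_bead N X j" "\<not> has_bead N X (j - 1)"
    and j': "int N dvd j' - r - 1" "has_bead N X (j' - 1)" "\<not> has_bead N X j'" by blast
  have d: "int N dvd j - j'" "int N dvd (j' - 1) - (j - 1)"
    using dvd_diff[OF j(1) j'(1)] dvd_diff[OF j'(1) j(1)] by simp_all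
  show False
    using has_bead_down[OF j(2) _ d(1)] has_bead_down[OF j'(2) _ d(2)] j(3) j'(3) by linarith
qed

text \<open>The lifting property for bead counts. Only tails at \<open>j\<close> congruent to
  \<open>r + 1\<close> change. If the position of \<open>X\<close> that counts for the claim is
  empty, the hypothesis at \<open>j + 1\<close> suffices; if \<open>j - 1\<close> and
  \<open>j\<close> are both occupied, the one at \<open>j - 1\<close> does. The dichotomy excludes
  the remaining pattern.\<close>

lemma bead_count_le_swap_values:
  assumes N: "2 \<le> N" and X: "is_window N X" and Y: "is_window N Y"
    and le: "\<And>j. bead_count N X j \<le> bead_count N Y j"
  shows "(\<forall>j. bead_count N X j \<le> bead_count N (swap_values N r Y) j) \<or>
    (\<forall>j. bead_count N (swap_values N r X) j \<le> bead_count N (swap_values N r Y) j)"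
proof -
  have cX: "bead_count N X j = bead_count N X (j + 1) + (if has_bead N X j then 1 else 0)" for j
    by (rule bead_count_pred[OF X]) (use N in simp)
  have cY: "bead_count N Y j = bead_count N Y (j + 1) + (if has_bead N Y j then 1 else 0)" for j
    by (rule bead_count_pred[OF Y]) (use N in simp)
  have b: "bead_count N X j = bead_count N X (j + 1) + (if has_bead N X j then 1 else 0)"
    "bead_count N X (j - 1) = bead_count N X j + (if has_bead N X (j - 1) then 1 else 0)"
    "bead_count N Y j = bead_count N Y (j + 1) + (if has_bead N Y j then 1 else 0)"
    "bead_count N Y (j - 1) = bead_count N Y j + (if has_bead N Y (j - 1) then 1 else 0)" for j
    by (fact cX, use cX[of "j - 1"] in \<open>simp only: diff_add_cancel\<close>,
        fact cY, use cY[of "j - 1"] in \<open>simp only: diff_add_cancel\<close>)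
  from has_bead_dichotomy[of N r X] show ?thesis
  proof
    assume a: "\<forall>j. int N dvd j - r - 1 \<longrightarrow> has_bead N X j \<longrightarrow> has_bead N X (j - 1)"
    have "bead_count N X j \<le> bead_count N (swap_values N r Y) j" for j
      using le[of j] le[of "j + 1"] le[of "j - 1"] b[of j] a[rule_format, of j]
      by (auto simp: bead_count_swap_values[OF N] split: if_splits)
    then show ?thesis by blast
  next
    assume a: "\<forall>j. int N dvd j - r - 1 \<longrightarrow> has_bead N X (j - 1) \<longrightarrow> has_bead N X j"
    have "bead_count N (swap_values N r X) j \<le> bead_count N (swap_values N r Y) j" for j
      using le[of j] le[of "j + 1"] le[of "j - 1"] b[of j] a[rule_format, of j]
      by (auto simp: bead_count_swap_values[OF N] split: if_splits)
    then show ?thesis by blast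
  qed
qed

lemma decreasing_windowI:
  assumes "\<And>i. i \<in> {1..<N} \<Longrightarrow> Y (Suc i) < Y i"
  shows "decreasing_window N Y"
proof -
  have "Y j < Y i" if "i < j" "1 \<le> i" "j \<le> N" for i j
    using that
  proof (induction j)
    case (Suc j)
    then show ?case using assms[of j] by (cases "i = j") auto
  qed simp
  then show ?thesis unfolding decreasing_window_def by auto
qed

lemma decreasing_eq_rev:
  assumes dec: "decreasing_window N X" and im: "X ` {1..N} = {1..int N}" and out: "\<And>i. i \<notin> {1..N} \<Longrightarrow> X i = 0"
  shows "X = rev_window N"
proof
  fix i
  show "X i = rev_window N i"
  proof (cases "i \<in> {1..N}")
    case i: True
    have inc: "- X p < - X (Suc p)" if "p \<in> {1..<N}" for p
      using dec that unfolding decreasing_window_def by auto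
    have "1 \<in> {1..N}" "N \<in> {1..N}" using i by auto
    then have "X 1 \<in> {1..int N}" "X N \<in> {1..int N}" using im by blast+
    moreover have "int i - 1 \<le> X 1 - X i" "int N - int i \<le> X i - X N"
      using increasing_diff_ge[of N "\<lambda>i. - X i" 1 i] increasing_diff_ge[of N "\<lambda>i. - X i" i N] inc i by auto
    ultimately show ?thesis using i by (auto simp: rev_window_def)
  qed (use out in \<open>auto simp: rev_window_def\<close>)
qed

text \<open>Sorting by adjacent exchanges. Resolving an ascent at \<open>i\<close> lowers the
  weighted sum of the entries by \<open>X (Suc i) - X i\<close>.\<close>

lemma ascent_steps_to_rev:
  assumes "X ` {1..N} = {1..int N}" "\<And>i. i \<notin> {1..N} \<Longrightarrow> X i = 0"
  shows "(ascent_step N)\<^sup>*\<^sup>* X (rev_window N)"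
  using assms
proof (induction "nat (\<Sum>i=1..N. int i * X i)" arbitrary: X rule: less_induct)
  case less
  show ?case
  proof (cases "\<exists>i\<in>{1..<N}. X i < X (Suc i)")
    case False
    have "inj_on X {1..N}" by (rule eq_card_imp_inj_on) (use less.prems(1) in simp_all)
    then have "X (Suc i) < X i" if "i \<in> {1..<N}" for i
      using False that inj_onD[of X "{1..N}" i "Suc i"] by force
    then have "X = rev_window N"
      using decreasing_eq_rev[OF decreasing_windowI] less.prems by blast
    then show ?thesis by simp
  next
    case True
    then obtain i where i: "i \<in> {1..<N}" "X i < X (Suc i)" by blast
    let ?Z = "reflect_window N i (Suc i) 0 X"
    have Z: "?Z = X(i := X (Suc i), Suc i := X i)" by (simp add: reflect_window_def)
    have ij: "i \<in> {1..N}" "Suc i \<in> {1..N}" "i \<noteq> Suc i" using i by auto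
    have Zim: "?Z ` {1..N} = {1..int N}"
      using image_reflect_window[OF ij(1,2)] less.prems(1) by blast
    have sum: "(\<Sum>l=1..N. int l * ?Z l) = (\<Sum>l=1..N. int l * X l) - int i * X i - int (Suc i) * X (Suc i)
        + int i * X (Suc i) + int (Suc i) * X i"
      unfolding Z by (rule sum_fun_upd2[where g = "\<lambda>l y. int l * y"]) (use ij in auto)
    have "0 \<le> (\<Sum>l=1..N. int l * ?Z l)"
      by (intro sum_nonneg) (metis Zim imageI atLeastAtMost_iff mult_nonneg_nonneg of_nat_0_le_iff order_trans zero_le_one)
    then have "nat (\<Sum>l=1..N. int l * ?Z l) < nat (\<Sum>l=1..N. int l * X l)"
      using sum i(2) by (simp add: algebra_simps)
    moreover have "?Z l = 0" if "l \<notin> {1..N}" for l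
      unfolding Z using that ij less.prems(2)[OF that] by auto
    ultimately have "(ascent_step N)\<^sup>*\<^sup>* ?Z (rev_window N)"
      using less.hyps[of ?Z] Zim by blast
    moreover have "ascent_step N X ?Z" unfolding ascent_step_def using i by blast
    ultimately show ?thesis by (metis converse_rtranclp_into_rtranclp)
  qed
qed

lemma ascent_step_window_step: "ascent_step N X Y \<Longrightarrow> window_step N X Y"
  unfolding ascent_step_def window_step_def
proof (elim bexE conjE)
  fix i assume i: "i \<in> {1..<N}" "X i < X (Suc i)" "Y = reflect_window N i (Suc i) 0 X"
  have "i \<in> {1..N}" "Suc i \<in> {1..N}" "i \<noteq> Suc i" "same_side N i (Suc i) 0 X"
    using i by (auto simp: same_side_def)
  then show "\<exists>i\<in>{1..N}. \<exists>j\<in>{1..N}. \<exists>k. i \<noteq> j \<and> Y = reflect_window N i j k X \<and> same_side N i j k X"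
    using i(3) by blast
qed

text \<open>Members outside the interval are at most zero, while omitted interval points are at
  least one. Equal totals force these two sums to agree, so nothing is omitted.\<close>

lemma bounded_sum_eq_interval:
  assumes "finite A" "card A = N" "\<Sum>A = \<Sum>{1..int N}" "\<And>x. x \<in> A \<Longrightarrow> x \<le> int N"
  shows "A = {1..int N}"
proof -
  let ?B = "{1..int N}"
  have cB: "card ?B = N" "finite ?B" by simp_all
  have "\<Sum>A = \<Sum>(A \<inter> ?B) + \<Sum>(A - ?B)" by (rule sum.Int_Diff[OF assms(1)])
  moreover have "\<Sum>?B = \<Sum>(?B \<inter> A) + \<Sum>(?B - A)" by (rule sum.Int_Diff[OF cB(2)])
  ultimately have eq: "\<Sum>(A - ?B) = \<Sum>(?B - A)" using assms(3) by (simp add: Int_commute)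
  have "\<Sum>(A - ?B) \<le> 0" using assms(4) by (intro sum_nonpos) force
  moreover have "(\<Sum>x\<in>?B - A. 1) \<le> \<Sum>(?B - A)" by (intro sum_mono) auto
  ultimately have "(\<Sum>x\<in>?B - A. 1::int) \<le> 0" unfolding eq by (rule order_trans[rotated])
  then have "?B - A = {}" using cB by simp
  then have "?B \<subseteq> A" by blast
  then have "?B = A" using assms(1,2) cB by (intro card_subset_eq) auto
  then show ?thesis by simp
qed

lemma window_image_sum:
  assumes "is_window N Y"
  shows "card (Y ` {1..N}) = N" "\<Sum>(Y ` {1..N}) = \<Sum>{1..int N}"
proof -
  show "card (Y ` {1..N}) = N" using card_image[OF window_inj[OF assms]] by simp
  have "\<Sum>(Y ` {1..N}) = (\<Sum>i=1..N. Y i)" using sum.reindex[OF window_inj[OF assms], of "\<lambda>x. x"] by simp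
  also have "\<dots> = (\<Sum>i=1..N. int i)" using assms unfolding is_window_def by blast
  also have "\<dots> = \<Sum>(int ` {1..N})" by (simp add: sum.reindex)
  also have "int ` {1..N} = {1..int N}" using image_int_atLeastAtMost[of 1 N] by simp
  finally show "\<Sum>(Y ` {1..N}) = \<Sum>{1..int N}" .
qed

lemma bead_count_eq_0: 
  assumes "\<And>i. i \<in> {1..N} \<Longrightarrow> Y i < j"
  shows "bead_count N Y j = 0"
  unfolding bead_count_def
proof (rule sum.neutral, rule ballI)
  fix i assume "i \<in> {1..N}"
  then have "(Y i - j) div int N < 0" using assms[of i] by (intro div_neg_pos_less0) auto
  then show "max 0 ((Y i - j) div int N + 1) = 0" by simp
qed

lemma bead_count_pos: 
  assumes "i \<in> {1..N}" "j \<le> Y i"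
  shows "0 < bead_count N Y j"
proof -
  have "0 \<le> (Y i - j) div int N" using assms by (simp add: pos_imp_zdiv_nonneg_iff)
  then have "0 < max 0 ((Y i - j) div int N + 1)" by simp
  then show ?thesis unfolding bead_count_def by (intro sum_pos2[OF _ assms(1)]) auto
qed

text \<open>The bead set is then a half-line \<open>{..M}\<close>, and the normalised sum forces \<open>M = N\<close>.\<close>

lemma flush_window_image:
  assumes w: "is_window N Y" and N: "1 \<le> N" and fl: "\<And>j. has_bead N Y j \<Longrightarrow> has_bead N Y (j - 1)"
  shows "Y ` {1..N} = {1..int N}"
proof -
  define M where "M = Max (Y ` {1..N})"
  have ne: "Y ` {1..N} \<noteq> {}" using N by auto
  have M: "M \<in> Y ` {1..N}" "\<And>i. i \<in> {1..N} \<Longrightarrow> Y i \<le> M" unfolding M_def using ne by auto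
  have bd: "has_bead N Y (M - int q)" for q
  proof (induction q)
    case 0
    show ?case using M(1) unfolding has_bead_def by force
  next
    case (Suc q)
    then show ?case using fl[of "M - int q"] by (simp add: algebra_simps)
  qed
  have "{M - int N + 1..M} \<subseteq> Y ` {1..N}"
  proof
    fix x assume x: "x \<in> {M - int N + 1..M}"
    obtain i where i: "i \<in> {1..N}" "x \<le> Y i" "int N dvd Y i - x"
      using bd[of "nat (M - x)"] x unfolding has_bead_def by auto
    \<comment> \<open>Among the top \<open>N\<close> positions a bead must be an entry itself, since
      \<open>Y i - x\<close> is a nonnegative multiple of \<open>N\<close> below
      \<open>N\<close>.\<close>
    have "Y i - x < int N" using M(2)[OF i(1)] x by auto
    then have "Y i = x" using i zdvd_imp_le[OF i(3)] by force
    then show "x \<in> Y ` {1..N}" using i by blast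
  qed
  then have eq: "{M - int N + 1..M} = Y ` {1..N}"
    by (intro card_subset_eq) (use window_image_sum(1)[OF w] in auto)
  have img: "{M - int N + 1..M} = (\<lambda>x. x + (M - int N)) ` {1..int N}"
    unfolding image_add_atLeastAtMost' by (simp add: algebra_simps)
  have "\<Sum>(Y ` {1..N}) = (\<Sum>x\<in>{1..int N}. x + (M - int N))"
    unfolding eq[symmetric] img by (subst sum.reindex) auto
  then have "int N * (M - int N) = 0" using window_image_sum(2)[OF w] by (simp add: sum.distrib)
  then have "M = int N" using N by simp
  then show ?thesis using eq by simp
qed

text \<open>
  Induction on \<open>\<Sum>i. (Y i)\<^sup>2\<close>: exchanging the values \<open>r\<close>, \<open>r + 1\<close> modulo \<open>N\<close> is multiplication by a
  simple reflection on the other side, so the lifting property of the Bruhat order reduces \<open>(X, Y)\<close>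
  to a pair with a smaller second entry.
\<close>

theorem window_steps_if_bead_count_le:
  assumes N: "2 \<le> N" and "is_window N X" "is_window N Y" "decreasing_window N Y"
    and "\<And>j. bead_count N X j \<le> bead_count N Y j"
  shows "(window_step N)\<^sup>*\<^sup>* X Y"
  using assms(2-)
proof (induction "nat (\<Sum>i=1..N. (Y i)\<^sup>2)" arbitrary: X Y rule: less_induct)
  case less
  note X = less.prems(1) and Y = less.prems(2) and dec = less.prems(3) and le = less.prems(4)
  show ?case
  proof (cases "\<exists>j. has_bead N Y j \<and> \<not> has_bead N Y (j - 1)")
    case True
    then obtain j where j: "has_bead N Y j" "\<not> has_bead N Y (j - 1)" by blast
    define r where "r = j - 1"
    obtain h where h: "h \<in> {1..N}" "j \<le> Y h" "int N dvd Y h - r - 1"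
      using j(1) unfolding has_bead_def r_def by (auto simp: algebra_simps)
    obtain i where i: "i \<in> {1..N}" "int N dvd Y i - r"
      using window_residue_exists[OF Y, of r] N by auto
    have "Y i < r" using j(2) i unfolding has_bead_def r_def by force
    then have "Y i + int N \<le> r" using i(2) zdvd_imp_le[of "int N" "r - Y i"] by (simp add: dvd_diff_commute)
    \<comment> \<open>Position \<open>r\<close> is empty, so its runner ends at least
      \<open>N\<close> below it. This gap larger than \<open>N\<close> keeps the exchanged window
      decreasing, makes the exchange a step down, and lowers the sum of squares.\<close>
    then have gap: "Y i + int N + 1 \<le> Y h" using h(2) unfolding r_def by simp
    obtain k where ih: "i \<noteq> h" and k: "Y h = Y i + 1 - k * int N"
      and Y'r: "swap_values N r Y = reflect_window N i h k Y"
      and Y'u: "swap_values N r Y = Y(i := Y i + 1, h := Y h - 1)"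
      using swap_values_eq_reflect[OF N Y i h(1,3)] .
    let ?Y = "swap_values N r Y"
    have Y': "is_window N ?Y" using swap_values_window[OF N Y] .
    have dec': "decreasing_window N ?Y"
      unfolding decreasing_window_def
    proof (intro ballI impI)
      fix a b assume ab: "a \<in> {1..N}" "b \<in> {1..N}" "a < b"
      then have "Y b < Y a" using dec unfolding decreasing_window_def by blast
      then have "adjacent_swap N r (Y b) < adjacent_swap N r (Y a) \<or> Y a = Y b + 1 \<and> int N dvd Y b - r"
        using adjacent_swap_less[OF N] by blast
      moreover have False if c: "Y a = Y b + 1" "int N dvd Y b - r"
      proof -
        have "b = i" using window_residue_unique[OF Y ab(2) i(1) c(2) i(2)] .
        moreover have "int N dvd Y a - (r + 1)" "int N dvd Y h - (r + 1)" using c h by (simp_all add: algebra_simps)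
        then have "a = h" using window_residue_unique[OF Y ab(1) h(1)] by blast
        ultimately show False using c gap N by simp
      qed
      ultimately show "?Y b < ?Y a" using ab by (auto simp: swap_values_def)
    qed
    \<comment> \<open>By the gap \<open>k\<close> is negative, so the index side is not negative,
      while the window side equals \<open>- 1\<close>.\<close>
    have "\<not> same_side N i h k Y"
    proof -
      have "Y i - Y h - k * int N = - 1" using k by simp
      moreover have "0 \<le> int i - int h - k * int N" using gap k i(1) h(1) by auto
      ultimately show ?thesis unfolding same_side_def by simp
    qed
    then have "same_side N i h k ?Y" using same_side_reflect[OF Y i(1) h(1) ih, of k] Y'r by simp
    then have step: "window_step N ?Y Y"
      using reflect_window_involutive[OF ih, of N k Y] i(1) h(1) ih Y'r unfolding window_step_def by metis
    have "(\<Sum>l=1..N. (?Y l)\<^sup>2) = (\<Sum>l=1..N. (Y l)\<^sup>2) - (Y i)\<^sup>2 - (Y h)\<^sup>2 + (Y i + 1)\<^sup>2 + (Y h - 1)\<^sup>2"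
      unfolding Y'u by (rule sum_fun_upd2[where g = "\<lambda>_ y. y\<^sup>2"]) (use i h ih in auto)
    then have "(\<Sum>l=1..N. (?Y l)\<^sup>2) = (\<Sum>l=1..N. (Y l)\<^sup>2) + (2 * (Y i - Y h) + 2)"
      by (simp add: power2_eq_square algebra_simps)
    moreover have "2 * (Y i - Y h) + 2 < 0" using gap N by simp
    ultimately have "(\<Sum>l=1..N. (?Y l)\<^sup>2) < (\<Sum>l=1..N. (Y l)\<^sup>2)" by linarith
    moreover have "0 \<le> (\<Sum>l=1..N. (?Y l)\<^sup>2)" by (intro sum_nonneg) simp
    ultimately have m: "nat (\<Sum>l=1..N. (?Y l)\<^sup>2) < nat (\<Sum>l=1..N. (Y l)\<^sup>2)" by linarith
    from bead_count_le_swap_values[OF N X Y le, of r] show ?thesis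
    proof
      assume "\<forall>j. bead_count N X j \<le> bead_count N ?Y j"
      then have "(window_step N)\<^sup>*\<^sup>* X ?Y" using less.hyps[OF m X Y' dec'] by blast
      then show ?thesis by (rule rtranclp_trans[OF _ r_into_rtranclp[of "window_step N", OF step]])
    next
      \<comment> \<open>Exchanging once more restores \<open>X\<close>; lifting the chain leads from
        \<open>X\<close> either to \<open>Y\<close> or to the exchanged \<open>Y\<close>, which is
        one step below \<open>Y\<close>.\<close>
      assume "\<forall>j. bead_count N (swap_values N r X) j \<le> bead_count N ?Y j"
      then have st: "(window_step N)\<^sup>*\<^sup>* (swap_values N r X) ?Y"
        using less.hyps[OF m swap_values_window[OF N X] Y' dec'] by blast
      have "(window_step N)\<^sup>*\<^sup>* X Y \<or> (window_step N)\<^sup>*\<^sup>* X ?Y"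
        using window_steps_swap_values[OF N st swap_values_window[OF N X], where r = r]
        unfolding swap_values_involutive[OF N X] swap_values_involutive[OF N Y] .
      then show ?thesis using rtranclp_trans[OF _ r_into_rtranclp[of "window_step N", OF step]] by blast
    qed
  next
    case False
    then have imY: "Y ` {1..N} = {1..int N}" using flush_window_image[OF Y] N by auto
    have outY: "Y i = 0" if "i \<notin> {1..N}" for i using Y that unfolding is_window_def by blast
    have outX: "X i = 0" if "i \<notin> {1..N}" for i using X that unfolding is_window_def by blast
    \<comment> \<open>Now \<open>Y\<close> has no bead beyond \<open>N\<close>, hence neither has
      \<open>X\<close>. The normalised sum then makes \<open>X\<close> a permutation of
      \<open>1, ..., N\<close> as well, and sorting connects it to \<open>Y\<close>.\<close>
    have "X i \<le> int N" if "i \<in> {1..N}" for i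
    proof (rule ccontr)
      assume "\<not> X i \<le> int N"
      then have "0 < bead_count N X (int N + 1)" by (intro bead_count_pos[OF that]) simp
      moreover have "Y l < int N + 1" if "l \<in> {1..N}" for l using imY that by force
      then have "bead_count N Y (int N + 1) = 0" by (rule bead_count_eq_0)
      ultimately show False using le[of "int N + 1"] by simp
    qed
    then have "X ` {1..N} = {1..int N}"
      using window_image_sum[OF X] by (intro bounded_sum_eq_interval) auto
    then have "(ascent_step N)\<^sup>*\<^sup>* X Y"
      using ascent_steps_to_rev outX decreasing_eq_rev[OF dec imY outY] by metis
    then show ?thesis using mono_rtranclp[of "ascent_step N" "window_step N"] ascent_step_window_step by blast
  qed
qed

section \<open>Prefix sums\<close>

lemma bead_count_ge_sum:
  assumes "A \<subseteq> {1..N}"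
  shows "(\<Sum>i\<in>A. (Y i - j) div int N + 1) \<le> bead_count N Y j"
proof -
  have "(\<Sum>i\<in>A. (Y i - j) div int N + 1) \<le> (\<Sum>i\<in>A. max 0 ((Y i - j) div int N + 1))"
    by (intro sum_mono) auto
  also have "\<dots> \<le> bead_count N Y j"
    unfolding bead_count_def using assms by (intro sum_mono2) auto
  finally show ?thesis .
qed

lemma bead_count_eq_sum:
  assumes "A \<subseteq> {1..N}" "\<And>i. i \<in> A \<Longrightarrow> 0 \<le> (Y i - j) div int N + 1"
    "\<And>i. i \<in> {1..N} - A \<Longrightarrow> (Y i - j) div int N + 1 \<le> 0"
  shows "bead_count N Y j = (\<Sum>i\<in>A. (Y i - j) div int N + 1)"
proof -
  have "bead_count N Y j = (\<Sum>i\<in>A. max 0 ((Y i - j) div int N + 1))"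
    unfolding bead_count_def using assms(1,3) by (intro sum.mono_neutral_right) auto
  also have "\<dots> = (\<Sum>i\<in>A. (Y i - j) div int N + 1)"
    using assms(2) by (intro sum.cong) auto
  finally show ?thesis .
qed

lemma decreasing_window_div_mono:
  assumes "decreasing_window N Y" "i \<in> {1..N}" "j \<in> {1..N}" "i \<le> j"
  shows "(Y j - m) div int N \<le> (Y i - m) div int N"
proof -
  have "Y j \<le> Y i"
    using assms unfolding decreasing_window_def by (cases "i = j") (auto simp: less_imp_le)
  then show ?thesis using assms(2) by (intro zdiv_mono1) auto
qed

lemma bead_count_eq_prefix_sum:
  assumes dec: "decreasing_window N Y"
  obtains p where "p \<le> N" "bead_count N Y j = (\<Sum>i=1..p. (Y i - j) div int N + 1)"
proof -
  let ?q = "\<lambda>i. (Y i - j) div int N + 1"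
  \<comment> \<open>The summands decrease along \<open>Y\<close>, so the positive ones form a
    prefix; the inserted 0 covers the empty prefix.\<close>
  define p where "p = Max (insert 0 {i \<in> {1..N}. 0 < ?q i})"
  have fin: "finite (insert 0 {i \<in> {1..N}. 0 < ?q i})" by simp
  have p: "p \<in> insert 0 {i \<in> {1..N}. 0 < ?q i}" unfolding p_def by (rule Max_in[OF fin]) simp
  have "bead_count N Y j = (\<Sum>i\<in>{1..p}. ?q i)"
  proof (rule bead_count_eq_sum)
    show "{1..p} \<subseteq> {1..N}" using p by auto
    fix i assume "i \<in> {1..p}"
    then show "0 \<le> ?q i" using p decreasing_window_div_mono[OF dec, of i p j] by auto
  next
    fix i assume i: "i \<in> {1..N} - {1..p}"
    show "?q i \<le> 0"
    proof (rule ccontr)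
      assume "\<not> ?q i \<le> 0"
      then have "i \<le> p" unfolding p_def using i by (intro Max_ge[OF fin]) auto
      then show False using i by auto
    qed
  qed
  moreover have "p \<le> N" using p by auto
  ultimately show ?thesis using that by blast
qed

lemma div_add_multiple: "0 < N \<Longrightarrow> (y + int N * d - j) div int N = (y - j) div int N + d"
  using div_mult_self2[of "int N" "y - j" d] by (simp add: algebra_simps)

text \<open>The prefix that is optimal for \<open>Y\<close> is also available to \<open>Z\<close>,
  where its sum has grown by the partial sum of \<open>d\<close>.\<close>

lemma bead_count_mono_translate:
  assumes N: "0 < N" and dec: "decreasing_window N Y" and Z: "\<And>i. i \<in> {1..N} \<Longrightarrow> Z i = Y i + int N * d i"
    and d: "\<And>p. p \<le> N \<Longrightarrow> 0 \<le> (\<Sum>i=1..p. d i)"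
  shows "bead_count N Y j \<le> bead_count N Z j"
proof -
  obtain p where p: "p \<le> N" "bead_count N Y j = (\<Sum>i=1..p. (Y i - j) div int N + 1)"
    using bead_count_eq_prefix_sum[OF dec] .
  have "(\<Sum>i=1..p. (Y i - j) div int N + 1) \<le> (\<Sum>i=1..p. (Y i - j) div int N + 1) + (\<Sum>i=1..p. d i)"
    using d[OF p(1)] by simp
  also have "\<dots> = (\<Sum>i=1..p. (Z i - j) div int N + 1)"
    unfolding sum.distrib[symmetric]
    by (rule sum.cong) (use Z p(1) N in \<open>auto simp: div_add_multiple\<close>)
  also have "\<dots> \<le> bead_count N Z j" using p(1) by (intro bead_count_ge_sum) auto
  finally show ?thesis unfolding p(2) .
qed

text \<open>
  Shifting \<open>j\<close> by \<open>m * N\<close> lowers both sides by \<open>m * card A\<close>, so it suffices to find one shift for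
  which the prefix of length \<open>card A\<close> carries all the beads of \<open>Y\<close>.
\<close>

lemma subset_sum_le_prefix_sum:
  assumes N: "0 < N" and dec: "decreasing_window N Y" and le: "\<And>j. bead_count N X j \<le> bead_count N Y j"
    and A: "A \<subseteq> {1..N}"
  shows "(\<Sum>i\<in>A. (X i - j) div int N + 1) \<le> (\<Sum>i=1..card A. (Y i - j) div int N + 1)"
proof (cases "card A = 0")
  case True
  then have "A = {}" using A finite_subset[OF A] by simp
  then show ?thesis by simp
next
  case False
  define p where "p = card A"
  have p: "1 \<le> p" "p \<le> N" using False card_mono[OF _ A] unfolding p_def by auto
  \<comment> \<open>This shift makes the summand of \<open>Y p\<close> exactly zero, so by
    monotonicity the earlier summands are nonnegative and the later ones are nonpositive.\<close>
  define m where "m = (Y p - j) div int N + 1"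
  have s: "(y - (j + int N * m)) div int N = (y - j) div int N - m" for y
    using div_add_multiple[OF N, of y "- m" j] by (simp add: algebra_simps)
  have "(\<Sum>i\<in>A. (X i - (j + int N * m)) div int N + 1) \<le> bead_count N X (j + int N * m)"
    by (rule bead_count_ge_sum[OF A])
  also have "\<dots> \<le> bead_count N Y (j + int N * m)" by (rule le)
  also have "\<dots> = (\<Sum>i=1..p. (Y i - (j + int N * m)) div int N + 1)"
  proof (rule bead_count_eq_sum)
    show "{1..p} \<subseteq> {1..N}" using p by auto
    fix i assume "i \<in> {1..p}"
    then show "0 \<le> (Y i - (j + int N * m)) div int N + 1"
      unfolding s unfolding m_def using p decreasing_window_div_mono[OF dec, of i p j] by auto
  next
    fix i assume "i \<in> {1..N} - {1..p}"
    then show "(Y i - (j + int N * m)) div int N + 1 \<le> 0"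
      unfolding s unfolding m_def using p decreasing_window_div_mono[OF dec, of p i j] by auto
  qed
  finally have "(\<Sum>i\<in>A. (X i - j) div int N + 1 - m) \<le> (\<Sum>i=1..p. (Y i - j) div int N + 1 - m)"
    unfolding s by (simp add: algebra_simps)
  then show ?thesis unfolding sum_subtractf p_def by simp
qed

text \<open>The positions of \<open>X\<close> with positive summands form an arbitrary set
  \<open>A\<close>, but only its size \<open>p\<close> matters: both \<open>Y\<close> and
  \<open>Y'\<close> bound the sum by their prefix of length \<open>p\<close>, and \<open>Z\<close>
  has the same prefix sum as one of them.\<close>

lemma bead_count_le_meet:
  assumes N: "0 < N" and dec: "decreasing_window N Y" "decreasing_window N Y'"
    and le: "\<And>j. bead_count N X j \<le> bead_count N Y j" "\<And>j. bead_count N X j \<le> bead_count N Y' j"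
    and Z: "\<And>i. i \<in> {1..N} \<Longrightarrow> Z i = Y i + int N * d i" "\<And>i. i \<in> {1..N} \<Longrightarrow> Z i = Y' i + int N * d' i"
    and meet: "\<And>p. p \<le> N \<Longrightarrow> (\<Sum>i=1..p. d i) = 0 \<or> (\<Sum>i=1..p. d' i) = 0"
  shows "bead_count N X j \<le> bead_count N Z j"
proof -
  define A where "A = {i \<in> {1..N}. 0 < (X i - j) div int N + 1}"
  have A: "A \<subseteq> {1..N}" unfolding A_def by auto
  define p where "p = card A"
  have p: "p \<le> N" using card_mono[OF _ A] unfolding p_def by simp
  have pre: "(\<Sum>i=1..p. (Z i - j) div int N + 1) = (\<Sum>i=1..p. (V i - j) div int N + 1)"
    if V: "\<And>i. i \<in> {1..N} \<Longrightarrow> Z i = V i + int N * e i" and e: "(\<Sum>i=1..p. e i) = 0" for V e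
  proof -
    have "(\<Sum>i=1..p. (Z i - j) div int N + 1) = (\<Sum>i=1..p. ((V i - j) div int N + 1) + e i)"
      by (rule sum.cong) (use V p N in \<open>auto simp: div_add_multiple\<close>)
    then show ?thesis using e by (simp add: sum.distrib)
  qed
  have "bead_count N X j = (\<Sum>i\<in>A. (X i - j) div int N + 1)"
    by (rule bead_count_eq_sum) (auto simp: A_def)
  also have "\<dots> \<le> (\<Sum>i=1..p. (Z i - j) div int N + 1)"
    using meet[OF p] pre[OF Z(1)] pre[OF Z(2)]
      subset_sum_le_prefix_sum[OF N dec(1) le(1) A, of j] subset_sum_le_prefix_sum[OF N dec(2) le(2) A, of j]
    unfolding p_def by auto
  also have "\<dots> \<le> bead_count N Z j" using p by (intro bead_count_ge_sum) auto
  finally show ?thesis .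
qed

section \<open>Coordinates and reflections\<close>

definition enum_index :: "nat \<Rightarrow> 'm::{finite,linorder}" where
  "enum_index i = sorted_list_of_set (UNIV :: 'm set) ! (i - 1)"

definition crd :: "'m::{finite,linorder} rvec \<Rightarrow> nat \<Rightarrow> real" where
  "crd x i = x $ enum_index i"

definition vec_of :: "(nat \<Rightarrow> real) \<Rightarrow> 'm::{finite,linorder} rvec" where
  "vec_of f = (\<chi> a. f (inv_into {1..CARD('m)} enum_index a))"

lemma bij_betw_enum_index: "bij_betw (enum_index :: nat \<Rightarrow> 'm::{finite,linorder}) {1..CARD('m)} UNIV"
proof -
  let ?l = "sorted_list_of_set (UNIV :: 'm set)"
  have "bij_betw ((!) ?l) {..<length ?l} (set ?l)" by (intro bij_betw_nth) auto
  then have b: "bij_betw ((!) ?l) {..<CARD('m)} UNIV" by simp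
  have "bij_betw (\<lambda>i. i - 1) {1..CARD('m)} {..<CARD('m)}"
    by (rule bij_betw_byWitness[where f' = Suc]) auto
  then have "bij_betw ((!) ?l \<circ> (\<lambda>i. i - 1)) {1..CARD('m)} UNIV" using b by (rule bij_betw_trans)
  moreover have "(!) ?l \<circ> (\<lambda>i. i - 1) = enum_index" by (auto simp: enum_index_def)
  ultimately show ?thesis by simp
qed

lemma enum_index_eq_iff:
  "i \<in> {1..CARD('m)} \<Longrightarrow> j \<in> {1..CARD('m)} \<Longrightarrow>
    (enum_index i :: 'm::{finite,linorder}) = enum_index j \<longleftrightarrow> i = j"
  using bij_betw_enum_index[where 'm = 'm] unfolding bij_betw_def by (metis inj_on_eq_iff)

lemma crd_vec_of: "i \<in> {1..CARD('m)} \<Longrightarrow> crd (vec_of f :: 'm::{finite,linorder} rvec) i = f i"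
  unfolding crd_def vec_of_def using bij_betw_enum_index[where 'm = 'm]
  by (simp add: bij_betw_inv_into_left del: atLeastAtMost_iff)

lemma crd_eqI:
  fixes x y :: "'m::{finite,linorder} rvec"
  assumes "\<And>i. i \<in> {1..CARD('m)} \<Longrightarrow> crd x i = crd y i"
  shows "x = y"
proof (rule vec_eq_iff[THEN iffD2], rule allI)
  fix a :: 'm
  have "a \<in> enum_index ` {1..CARD('m)}"
    using bij_betw_enum_index[where 'm = 'm] unfolding bij_betw_def by blast
  then obtain i where "i \<in> {1..CARD('m)}" "a = enum_index i" by blast
  then show "x $ a = y $ a" using assms unfolding crd_def by metis
qed

lemma crd_simps [simp]:
  "crd (x + y) i = crd x i + crd y i" "crd (x - y) i = crd x i - crd y i"
  "crd (c *\<^sub>R x) i = c * crd x i" "crd 0 i = 0" "crd (\<Sum>a\<in>A. g a) i = (\<Sum>a\<in>A. crd (g a) i)"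
  by (simp_all add: crd_def)

lemma inner_std_basis [simp]: "x \<bullet> std_basis i = crd x i"
  unfolding std_basis_def crd_def enum_index_def by (simp add: inner_axis)

lemma crd_std_basis:
  "i \<in> {1..CARD('m)} \<Longrightarrow> j \<in> {1..CARD('m)} \<Longrightarrow>
    crd (std_basis i :: 'm::{finite,linorder} rvec) j = (if i = j then 1 else 0)"
  unfolding crd_def std_basis_def enum_index_def[symmetric]
  by (auto simp: axis_def enum_index_eq_iff simp del: atLeastAtMost_iff)

lemma sum_zero_space_iff:
  fixes x :: "'m::{finite,linorder} rvec"
  shows "x \<in> sum_zero_space \<longleftrightarrow> (\<Sum>i=1..CARD('m). crd x i) = 0"
  unfolding sum_zero_space_def crd_def
  using sum.reindex_bij_betw[OF bij_betw_enum_index[where 'm = 'm], of "\<lambda>a. x $ a"] by simp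

definition coord_refl :: "nat \<Rightarrow> nat \<Rightarrow> int \<Rightarrow> 'm::{finite,linorder} rvec \<Rightarrow> 'm rvec" where
  "coord_refl i j k = aff_reflection (std_basis i - std_basis j) k"

lemma crd_coord_refl:
  fixes x :: "'m::{finite,linorder} rvec"
  assumes "x \<in> sum_zero_space" "i \<in> {1..CARD('m)}" "j \<in> {1..CARD('m)}" "i \<noteq> j" "l \<in> {1..CARD('m)}"
  shows "crd (coord_refl i j k x) l = (if l = i then crd x j + k else if l = j then crd x i - k else crd x l)"
proof -
  let ?a = "std_basis i - std_basis j :: 'm rvec"
  have "?a \<bullet> ?a = 2" using assms by (simp add: inner_diff_right crd_std_basis del: atLeastAtMost_iff)
  moreover have "x \<bullet> ?a = crd x i - crd x j" by (simp add: inner_diff_right)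
  ultimately have "coord_refl i j k x = x - (crd x i - crd x j - k) *\<^sub>R ?a"
    using assms(1) by (simp add: coord_refl_def aff_reflection_def)
  then show ?thesis using assms by (simp add: crd_std_basis del: atLeastAtMost_iff)
qed

lemma coord_refl_in_space:
  fixes x :: "'m::{finite,linorder} rvec"
  assumes "x \<in> sum_zero_space" "i \<in> {1..CARD('m)}" "j \<in> {1..CARD('m)}" "i \<noteq> j"
  shows "coord_refl i j k x \<in> sum_zero_space"
proof -
  let ?N = "CARD('m)"
  have "(\<Sum>l=1..?N. crd (coord_refl i j k x) l) =
      (\<Sum>l=1..?N. crd x l + ((if l = i then crd x j - crd x i + k else 0) + (if l = j then crd x i - crd x j - k else 0)))"
    by (rule sum.cong) (use assms in \<open>auto simp: crd_coord_refl simp del: atLeastAtMost_iff\<close>)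
  also have "\<dots> = (\<Sum>l=1..?N. crd x l)"
    using assms(2,3) by (simp add: sum.distrib)
  finally show ?thesis using assms(1) by (simp add: sum_zero_space_iff)
qed

lemma coord_refl_involutive:
  fixes x :: "'m::{finite,linorder} rvec"
  assumes "x \<in> sum_zero_space" "i \<in> {1..CARD('m)}" "j \<in> {1..CARD('m)}" "i \<noteq> j"
  shows "coord_refl i j k (coord_refl i j k x) = x"
proof (rule crd_eqI)
  fix l assume "l \<in> {1..CARD('m)}"
  then show "crd (coord_refl i j k (coord_refl i j k x)) l = crd x l"
    using assms coord_refl_in_space[OF assms, of k] by (simp add: crd_coord_refl del: atLeastAtMost_iff)
qed

lemma coord_refl_Bij:
  assumes "i \<in> {1..CARD('m::{finite,linorder})}" "j \<in> {1..CARD('m)}" "i \<noteq> j"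
  shows "(coord_refl i j k :: 'm rvec \<Rightarrow> 'm rvec) \<in> Bij sum_zero_space"
proof -
  have "bij_betw (coord_refl i j k :: 'm rvec \<Rightarrow> 'm rvec) sum_zero_space sum_zero_space"
    by (rule bij_betw_byWitness[where f' = "coord_refl i j k"])
      (use coord_refl_involutive[OF _ assms] coord_refl_in_space[OF _ assms] in auto)
  then show ?thesis unfolding Bij_def by (simp add: coord_refl_def aff_reflection_def)
qed

lemma coord_refl_commute:
  assumes "i \<in> {1..CARD('m::{finite,linorder})}" "j \<in> {1..CARD('m)}" "i \<noteq> j"
  shows "(coord_refl i j k :: 'm rvec \<Rightarrow> 'm rvec) = coord_refl j i (- k)"
proof (rule extensionalityI[of _ sum_zero_space])
  fix x :: "'m rvec" assume x: "x \<in> sum_zero_space"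
  show "coord_refl i j k x = coord_refl j i (- k) x"
    by (rule crd_eqI) (use assms x in \<open>auto simp: crd_coord_refl simp del: atLeastAtMost_iff\<close>)
qed (use assms coord_refl_Bij Bij_imp_extensional in \<open>metis\<close>)+

abbreviation space_group :: "('m::{finite,linorder} rvec \<Rightarrow> 'm rvec) monoid" where
  "space_group \<equiv> BijGroup sum_zero_space"

lemma aff_weyl_simps [simp]:
  "mult aff_weyl = mult space_group" "one aff_weyl = one space_group"
  by (simp_all add: aff_weyl_def)

lemma fin_weyl_simps [simp]:
  "mult fin_weyl = mult space_group" "one fin_weyl = one space_group"
  by (simp_all add: fin_weyl_def)

lemma carrier_space_group: "carrier space_group = Bij sum_zero_space"
  by (simp add: BijGroup_def)

lemma space_group_apply:
  assumes "x \<in> Bij sum_zero_space" "y \<in> Bij sum_zero_space" "v \<in> sum_zero_space"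
  shows "(x \<otimes>\<^bsub>space_group\<^esub> y) v = x (y v)"
  using assms by (simp add: BijGroup_def compose_def)

lemma space_group_mult_Bij:
  "x \<in> Bij sum_zero_space \<Longrightarrow> y \<in> Bij sum_zero_space \<Longrightarrow>
    x \<otimes>\<^bsub>space_group\<^esub> y \<in> Bij sum_zero_space"
  by (simp add: BijGroup_def compose_Bij)

lemma Bij_in_space: "w \<in> Bij S \<Longrightarrow> v \<in> S \<Longrightarrow> w v \<in> S"
  using Bij_imp_funcset by blast

lemma all_reflections_eq:
  "{aff_reflection \<alpha> k | \<alpha> k. \<alpha> \<in> (roots :: 'm::{finite,linorder} rvec set)} =
    {coord_refl i j k | i j k. i \<in> {1..CARD('m)} \<and> j \<in> {1..CARD('m)} \<and> i \<noteq> j}"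
  unfolding roots_def coord_refl_def by blast

lemma carrier_aff_weyl:
  "carrier (aff_weyl :: ('m::{finite,linorder} rvec \<Rightarrow> 'm rvec) monoid) = generate space_group
    {coord_refl i j k | i j k. i \<in> {1..CARD('m)} \<and> j \<in> {1..CARD('m)} \<and> i \<noteq> j}"
  unfolding aff_weyl_def all_reflections_eq by simp

lemma subgroup_aff_weyl: "subgroup (carrier aff_weyl) (space_group :: ('m::{finite,linorder} rvec \<Rightarrow> 'm rvec) monoid)"
  unfolding carrier_aff_weyl
  by (rule group.generate_is_subgroup[OF group_BijGroup])
    (use coord_refl_Bij[where 'm = 'm] in \<open>fastforce simp: BijGroup_def\<close>)

lemma aff_weyl_Bij: "w \<in> carrier aff_weyl \<Longrightarrow> w \<in> Bij (sum_zero_space :: 'm::{finite,linorder} rvec set)"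
  using subgroup.subset[OF subgroup_aff_weyl] by (auto simp: BijGroup_def)

lemma group_aff_weyl: "group (aff_weyl :: ('m::{finite,linorder} rvec \<Rightarrow> 'm rvec) monoid)"
proof -
  have "(aff_weyl :: ('m rvec \<Rightarrow> 'm rvec) monoid) = space_group\<lparr>carrier := carrier aff_weyl\<rparr>"
    by (simp add: aff_weyl_def)
  then show ?thesis
    using group.subgroup_imp_group[OF group_BijGroup subgroup_aff_weyl] by metis
qed

lemma coord_refl_in_aff_weyl:
  assumes "i \<in> {1..CARD('m::{finite,linorder})}" "j \<in> {1..CARD('m)}" "i \<noteq> j"
  shows "(coord_refl i j k :: 'm rvec \<Rightarrow> 'm rvec) \<in> carrier aff_weyl"
  unfolding carrier_aff_weyl by (rule generate.incl) (use assms in blast)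

lemma coord_refl_mult_self:
  assumes "i \<in> {1..CARD('m::{finite,linorder})}" "j \<in> {1..CARD('m)}" "i \<noteq> j"
  shows "(coord_refl i j k :: 'm rvec \<Rightarrow> 'm rvec) \<otimes>\<^bsub>space_group\<^esub> coord_refl i j k = \<one>\<^bsub>space_group\<^esub>"
  using coord_refl_Bij[OF assms, of k] coord_refl_involutive[OF _ assms]
  by (auto simp: BijGroup_def compose_def)

section \<open>Elements as coordinate permutations with integral translations\<close>

text \<open>The semidirect product of the symmetric group with the root lattice, in coordinates;
  translation parts of sum zero are the root lattice.\<close>

definition affine_form ::
  "('m::{finite,linorder} rvec \<Rightarrow> 'm rvec) \<Rightarrow> (nat \<Rightarrow> nat) \<Rightarrow> (nat \<Rightarrow> int) \<Rightarrow> bool" where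
  "affine_form w \<sigma> t \<longleftrightarrow> \<sigma> permutes {1..CARD('m)} \<and> (\<Sum>i=1..CARD('m). t i) = 0 \<and>
     (\<forall>x\<in>sum_zero_space. \<forall>i\<in>{1..CARD('m)}. crd (w x) i = crd x (\<sigma> i) + t i)"

lemma affine_form_coord_refl:
  assumes "i \<in> {1..CARD('m::{finite,linorder})}" "j \<in> {1..CARD('m)}" "i \<noteq> j"
  shows "affine_form (coord_refl i j k :: 'm rvec \<Rightarrow> 'm rvec) (Transposition.transpose i j)
    (\<lambda>l. if l = i then k else if l = j then - k else 0)"
proof -
  have "(\<Sum>l=1..CARD('m). if l = i then k else if l = j then - k else 0) =
      (\<Sum>l=1..CARD('m). (if l = i then k else 0) + (if l = j then - k else 0))"
    by (rule sum.cong) (use assms in auto)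
  then have "(\<Sum>l=1..CARD('m). if l = i then k else if l = j then - k else 0) = 0"
    using assms by (simp add: sum.distrib)
  then show ?thesis
    unfolding affine_form_def using assms
    by (auto simp: crd_coord_refl permutes_swap_id Transposition.transpose_def simp del: atLeastAtMost_iff)
qed

text \<open>Coordinates are pulled back along the permutation, hence the reversed order of
  composition.\<close>

lemma affine_form_mult:
  fixes u w :: "'m::{finite,linorder} rvec \<Rightarrow> 'm rvec"
  assumes "u \<in> Bij sum_zero_space" "w \<in> Bij sum_zero_space" "affine_form u \<sigma> t" "affine_form w \<tau> s"
  shows "affine_form (u \<otimes>\<^bsub>space_group\<^esub> w) (\<tau> \<circ> \<sigma>) (\<lambda>i. s (\<sigma> i) + t i)"
proof -
  let ?A = "{1..CARD('m)}"
  have \<sigma>: "\<sigma> permutes ?A" using assms(3) unfolding affine_form_def by blast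
  have "(\<Sum>i\<in>?A. s (\<sigma> i)) = (\<Sum>i\<in>?A. s i)" using sum.permute[OF \<sigma>, of s] by (simp add: o_def)
  then have "(\<Sum>i\<in>?A. s (\<sigma> i) + t i) = 0"
    using assms(3,4) unfolding affine_form_def by (simp add: sum.distrib)
  moreover have "crd ((u \<otimes>\<^bsub>space_group\<^esub> w) x) i = crd x ((\<tau> \<circ> \<sigma>) i) + (s (\<sigma> i) + t i)"
    if "x \<in> sum_zero_space" "i \<in> ?A" for x i
  proof -
    have "\<sigma> i \<in> ?A" using \<sigma> that by (simp only: permutes_in_image)
    moreover have "w x \<in> sum_zero_space" by (rule Bij_in_space[OF assms(2) that(1)])
    ultimately show ?thesis
      using assms(3,4) that unfolding affine_form_def space_group_apply[OF assms(1,2) that(1)]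
      by (simp del: atLeastAtMost_iff)
  qed
  moreover have "\<tau> \<circ> \<sigma> permutes ?A"
    using permutes_compose[OF \<sigma>] assms(4) unfolding affine_form_def by blast
  ultimately show ?thesis unfolding affine_form_def by blast
qed

lemma affine_form_exists:
  fixes w :: "'m::{finite,linorder} rvec \<Rightarrow> 'm rvec"
  assumes "w \<in> carrier aff_weyl"
  obtains \<sigma> t where "affine_form w \<sigma> t"
proof -
  have "w \<in> Bij sum_zero_space \<and> (\<exists>\<sigma> t. affine_form w \<sigma> t)"
    using assms unfolding carrier_aff_weyl
  proof (induction rule: generate.induct)
    case one
    have "affine_form (\<one>\<^bsub>space_group\<^esub> :: 'm rvec \<Rightarrow> 'm rvec) id (\<lambda>_. 0)"
      by (auto simp: affine_form_def BijGroup_def)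
    moreover have "(\<one>\<^bsub>space_group\<^esub> :: 'm rvec \<Rightarrow> 'm rvec) = (\<lambda>x\<in>sum_zero_space. x)"
      unfolding BijGroup_def by (rule monoid.select_convs)
    ultimately show ?case using id_Bij by metis
  next
    case (incl h)
    then show ?case using affine_form_coord_refl coord_refl_Bij by blast
  next
    case (inv h)
    then obtain i j k where h: "h = coord_refl i j k" "i \<in> {1..CARD('m)}" "j \<in> {1..CARD('m)}" "i \<noteq> j" by blast
    have inv: "inv\<^bsub>space_group\<^esub> h = h"
      by (rule group.inv_equality[OF group_BijGroup])
        (use h(1) coord_refl_mult_self[OF h(2-4)] coord_refl_Bij[OF h(2-4)] in \<open>simp_all add: carrier_space_group\<close>)
    show ?case unfolding inv unfolding h(1)
      using affine_form_coord_refl[OF h(2-4), of k] coord_refl_Bij[OF h(2-4), of k] by blast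
  next
    case (eng h1 h2)
    then obtain \<sigma> t \<tau> s where h: "affine_form h1 \<sigma> t" "affine_form h2 \<tau> s"
      "h1 \<in> Bij sum_zero_space" "h2 \<in> Bij sum_zero_space" by blast
    show ?case using space_group_mult_Bij[OF h(3,4)] affine_form_mult[OF h(3,4,1,2)] by blast
  qed
  then show ?thesis using that by blast
qed

section \<open>Windows of affine Weyl group elements\<close>

text \<open>Up to sign, half the sum of the positive roots divided by the Coxeter number
  \<open>N\<close>. Root values at this point are \<open>(i - j) / N\<close>, so it lies in the
  fundamental alcove, and the affine rescaling in \<open>window\<close> sends its coordinates to
  \<open>1, ..., N\<close>.\<close>

definition base_point :: "'m::{finite,linorder} rvec" where
  "base_point = vec_of (\<lambda>i. real i / CARD('m) - (CARD('m) + 1) / (2 * CARD('m)))"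

text \<open>
  As \<open>w\<close> acts by \<open>x\<^sub>i \<mapsto> x\<^bsub>\<sigma> i\<^esub> + t\<^sub>i\<close>, this is the integer vector \<open>\<sigma> i + N t\<^sub>i\<close>: the
  values on \<open>1, \<dots>, N\<close> of the inverse of \<open>w\<close> seen as an affine permutation.
\<close>

definition window :: "('m::{finite,linorder} rvec \<Rightarrow> 'm rvec) \<Rightarrow> nat \<Rightarrow> int" where
  "window w i = (if i \<in> {1..CARD('m)}
     then \<lfloor>CARD('m) * crd (w base_point) i + (CARD('m) + 1) / 2\<rfloor> else 0)"

lemma crd_base_point:
  "i \<in> {1..CARD('m)} \<Longrightarrow>
    crd (base_point :: 'm::{finite,linorder} rvec) i = real i / CARD('m) - (CARD('m) + 1) / (2 * CARD('m))"
  unfolding base_point_def by (rule crd_vec_of)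

lemma base_point_in_space: "(base_point :: 'm::{finite,linorder} rvec) \<in> sum_zero_space"
proof -
  let ?N = "CARD('m)"
  have N: "real ?N > 0" by simp
  have g: "(\<Sum>i=1..?N. real i) = real ?N * (real ?N + 1) / 2"
    using double_gauss_sum_from_Suc_0[of ?N, where 'a = real] by simp
  have "(\<Sum>i=1..?N. crd (base_point :: 'm rvec) i) = (\<Sum>i=1..?N. real i / ?N - (?N + 1) / (2 * ?N))"
    by (rule sum.cong) (auto simp: crd_base_point simp del: atLeastAtMost_iff)
  also have "\<dots> = (\<Sum>i=1..?N. real i) / ?N - ?N * ((?N + 1) / (2 * ?N))"
    by (simp add: sum_subtractf sum_divide_distrib)
  also have "\<dots> = 0" unfolding g using N by (simp add: field_simps)
  finally show ?thesis by (simp add: sum_zero_space_iff)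
qed

lemma affine_form_window_real:
  fixes w :: "'m::{finite,linorder} rvec \<Rightarrow> 'm rvec"
  assumes "affine_form w \<sigma> t" "i \<in> {1..CARD('m)}"
  shows "CARD('m) * crd (w base_point) i + (CARD('m) + 1) / 2 = of_int (int (\<sigma> i) + int CARD('m) * t i)"
proof -
  have N: "real CARD('m) > 0" by simp
  have "\<sigma> i \<in> {1..CARD('m)}" using assms unfolding affine_form_def by (metis permutes_in_image)
  moreover have "crd (w base_point) i = crd (base_point :: 'm rvec) (\<sigma> i) + t i"
    using assms base_point_in_space unfolding affine_form_def by blast
  ultimately have "crd (w base_point) i = real (\<sigma> i) / CARD('m) - (CARD('m) + 1) / (2 * CARD('m)) + t i"
    using crd_base_point by metis
  then show ?thesis using N by (simp add: field_simps)
qed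

lemma affine_form_window:
  fixes w :: "'m::{finite,linorder} rvec \<Rightarrow> 'm rvec"
  assumes "affine_form w \<sigma> t" "i \<in> {1..CARD('m)}"
  shows "window w i = int (\<sigma> i) + int CARD('m) * t i"
  unfolding window_def affine_form_window_real[OF assms] floor_of_int using assms(2) by simp

lemma window_real:
  fixes w :: "'m::{finite,linorder} rvec \<Rightarrow> 'm rvec"
  assumes "w \<in> carrier aff_weyl" "i \<in> {1..CARD('m)}"
  shows "real_of_int (window w i) = CARD('m) * crd (w base_point) i + (CARD('m) + 1) / 2"
  using affine_form_exists[OF assms(1)] affine_form_window affine_form_window_real assms(2) by metis

lemma is_window_window:
  fixes w :: "'m::{finite,linorder} rvec \<Rightarrow> 'm rvec"
  assumes "w \<in> carrier aff_weyl"
  shows "is_window CARD('m) (window w)"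
proof -
  let ?N = "CARD('m)"
  obtain \<sigma> t where f: "affine_form w \<sigma> t" using affine_form_exists[OF assms] .
  then have \<sigma>: "\<sigma> permutes {1..?N}" and t: "(\<Sum>i=1..?N. t i) = 0" unfolding affine_form_def by auto
  note W = affine_form_window[OF f]
  have "i = j" if ij: "i \<in> {1..?N}" "j \<in> {1..?N}" and eq: "window w i mod int ?N = window w j mod int ?N" for i j
  proof -
    have "int (\<sigma> i) mod int ?N = int (\<sigma> j) mod int ?N" using eq unfolding W[OF ij(1)] W[OF ij(2)] by simp
    then obtain k where "int (\<sigma> i) - int (\<sigma> j) = k * int ?N"
      by (metis mod_eq_dvd_iff dvd_def mult.commute)
    moreover have "\<sigma> i \<in> {1..?N}" "\<sigma> j \<in> {1..?N}" using ij \<sigma> by (metis permutes_in_image)+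
    ultimately have "\<sigma> i = \<sigma> j" using index_diff_not_multiple by blast
    then show ?thesis using permutes_inj[OF \<sigma>] by (simp add: inj_eq)
  qed
  moreover have "(\<Sum>i=1..?N. window w i) = (\<Sum>i=1..?N. int i)"
  proof -
    have "(\<Sum>i=1..?N. window w i) = (\<Sum>i=1..?N. int (\<sigma> i) + int ?N * t i)"
      by (rule sum.cong) (use W in auto)
    also have "\<dots> = (\<Sum>i=1..?N. int (\<sigma> i)) + int ?N * (\<Sum>i=1..?N. t i)"
      by (simp add: sum.distrib sum_distrib_left)
    also have "(\<Sum>i=1..?N. int (\<sigma> i)) = (\<Sum>i=1..?N. int i)" using sum.permute[OF \<sigma>, of int] by (simp add: o_def)
    finally show ?thesis using t by simp
  qed
  moreover have "window w i = 0" if "i \<notin> {1..?N}" for i using that unfolding window_def by auto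
  ultimately show ?thesis unfolding is_window_def by blast
qed

text \<open>An entry determines \<sigma> and the translation part as its representative in
  \<open>1, ..., N\<close> modulo \<open>N\<close> and the corresponding quotient.\<close>

lemma window_inject:
  fixes u w :: "'m::{finite,linorder} rvec \<Rightarrow> 'm rvec"
  assumes "u \<in> carrier aff_weyl" "w \<in> carrier aff_weyl" "window u = window w"
  shows "u = w"
proof (rule extensionalityI[of _ sum_zero_space])
  let ?N = "CARD('m)"
  obtain \<sigma> t where u: "affine_form u \<sigma> t" using affine_form_exists[OF assms(1)] .
  obtain \<tau> s where w: "affine_form w \<tau> s" using affine_form_exists[OF assms(2)] .
  have eq: "\<sigma> i = \<tau> i \<and> t i = s i" if i: "i \<in> {1..?N}" for i
  proof -
    have "\<sigma> i \<in> {1..?N}" "\<tau> i \<in> {1..?N}" using i u w unfolding affine_form_def by (metis permutes_in_image)+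
    moreover have e: "int (\<sigma> i) + int ?N * t i = int (\<tau> i) + int ?N * s i"
      using affine_form_window[OF u i] affine_form_window[OF w i] assms(3) by simp
    then have "int (\<sigma> i) - int (\<tau> i) = (s i - t i) * int ?N" by (simp add: algebra_simps)
    ultimately have "\<sigma> i = \<tau> i" using index_diff_not_multiple by blast
    then show ?thesis using e by simp
  qed
  fix x :: "'m rvec" assume x: "x \<in> sum_zero_space"
  show "u x = w x"
    by (rule crd_eqI) (use u w x eq in \<open>auto simp: affine_form_def simp del: atLeastAtMost_iff\<close>)
qed (use assms aff_weyl_Bij Bij_imp_extensional in metis)+

lemma one_in_aff_weyl: "\<one>\<^bsub>space_group\<^esub> \<in> carrier (aff_weyl :: ('m::{finite,linorder} rvec \<Rightarrow> 'm rvec) monoid)"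
  using subgroup.one_closed[OF subgroup_aff_weyl] .

lemma mult_in_aff_weyl:
  fixes u w :: "'m::{finite,linorder} rvec \<Rightarrow> 'm rvec"
  shows "u \<in> carrier aff_weyl \<Longrightarrow> w \<in> carrier aff_weyl \<Longrightarrow> u \<otimes>\<^bsub>space_group\<^esub> w \<in> carrier aff_weyl"
  using subgroup.m_closed[OF subgroup_aff_weyl] .

lemma window_one: "window (\<one>\<^bsub>space_group\<^esub> :: 'm::{finite,linorder} rvec \<Rightarrow> 'm rvec) = id_window CARD('m)"
proof
  fix i
  have "affine_form (\<one>\<^bsub>space_group\<^esub> :: 'm rvec \<Rightarrow> 'm rvec) id (\<lambda>_. 0)"
    by (auto simp: affine_form_def BijGroup_def)
  from affine_form_window[OF this, of i]
  show "window (\<one>\<^bsub>space_group\<^esub> :: 'm rvec \<Rightarrow> 'm rvec) i = id_window CARD('m) i"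
    by (cases "i \<in> {1..CARD('m)}") (auto simp: id_window_def window_def)
qed

lemma window_coord_refl_mult:
  fixes u :: "'m::{finite,linorder} rvec \<Rightarrow> 'm rvec"
  assumes u: "u \<in> carrier aff_weyl" and ij: "i \<in> {1..CARD('m)}" "j \<in> {1..CARD('m)}" "i \<noteq> j"
  shows "window (coord_refl i j k \<otimes>\<^bsub>space_group\<^esub> u) = reflect_window CARD('m) i j k (window u)"
proof
  let ?N = "CARD('m)"
  let ?r = "coord_refl i j k :: 'm rvec \<Rightarrow> 'm rvec"
  fix l
  show "window (?r \<otimes>\<^bsub>space_group\<^esub> u) l = reflect_window ?N i j k (window u) l"
  proof (cases "l \<in> {1..?N}")
    case False
    then show ?thesis using ij by (auto simp: window_def reflect_window_def)
  next
    case l: True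
    have "u base_point \<in> sum_zero_space" using Bij_in_space[OF aff_weyl_Bij[OF u] base_point_in_space] .
    moreover have "(?r \<otimes>\<^bsub>space_group\<^esub> u) base_point = ?r (u base_point)"
      using space_group_apply[OF coord_refl_Bij[OF ij] aff_weyl_Bij[OF u] base_point_in_space] .
    ultimately have "real_of_int (window (?r \<otimes>\<^bsub>space_group\<^esub> u) l) = real_of_int (reflect_window ?N i j k (window u) l)"
      using window_real[OF mult_in_aff_weyl[OF coord_refl_in_aff_weyl[OF ij] u] l, of k]
        window_real[OF u l] window_real[OF u ij(1)] window_real[OF u ij(2)] l ij
      by (simp add: crd_coord_refl reflect_window_def algebra_simps del: atLeastAtMost_iff)
    then show ?thesis by linarith
  qed
qed

text \<open>The new reflection belongs to the preimage of the hyperplane under \<open>w\<close>: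
  inserting the affine form of \<open>w\<close> into its equation yields these indices and this
  level.\<close>

lemma coord_refl_conjugate:
  fixes w :: "'m::{finite,linorder} rvec \<Rightarrow> 'm rvec"
  assumes w: "w \<in> Bij sum_zero_space" and f: "affine_form w \<sigma> t"
    and ij: "i \<in> {1..CARD('m)}" "j \<in> {1..CARD('m)}" "i \<noteq> j"
  shows "coord_refl i j k \<otimes>\<^bsub>space_group\<^esub> w = w \<otimes>\<^bsub>space_group\<^esub> coord_refl (\<sigma> i) (\<sigma> j) (k - t i + t j)"
proof (rule extensionalityI[of _ sum_zero_space])
  let ?N = "CARD('m)" and ?k = "k - t i + t j"
  have \<sigma>: "\<sigma> permutes {1..?N}" using f unfolding affine_form_def by blast
  have mem: "\<sigma> l \<in> {1..?N}" if "l \<in> {1..?N}" for l using that \<sigma> by (metis permutes_in_image)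
  have ne: "\<sigma> l = \<sigma> l' \<longleftrightarrow> l = l'" for l l' using permutes_inj[OF \<sigma>] by (simp add: inj_eq)
  have ij': "\<sigma> i \<in> {1..?N}" "\<sigma> j \<in> {1..?N}" "\<sigma> i \<noteq> \<sigma> j" using mem ij ne by auto
  have B: "(coord_refl i j k :: 'm rvec \<Rightarrow> 'm rvec) \<in> Bij sum_zero_space"
    "(coord_refl (\<sigma> i) (\<sigma> j) ?k :: 'm rvec \<Rightarrow> 'm rvec) \<in> Bij sum_zero_space"
    using coord_refl_Bij ij ij' by blast+
  have C: "coord_refl i j k \<otimes>\<^bsub>space_group\<^esub> w \<in> Bij sum_zero_space"
    "w \<otimes>\<^bsub>space_group\<^esub> coord_refl (\<sigma> i) (\<sigma> j) ?k \<in> Bij sum_zero_space"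
    using space_group_mult_Bij B w by blast+
  then show "coord_refl i j k \<otimes>\<^bsub>space_group\<^esub> w \<in> extensional sum_zero_space"
    "w \<otimes>\<^bsub>space_group\<^esub> coord_refl (\<sigma> i) (\<sigma> j) ?k \<in> extensional sum_zero_space"
    using Bij_imp_extensional by blast+
  fix x :: "'m rvec" assume x: "x \<in> sum_zero_space"
  have cw: "crd (w y) l = crd y (\<sigma> l) + t l" if "y \<in> sum_zero_space" "l \<in> {1..?N}" for y l
    using f that unfolding affine_form_def by blast
  show "(coord_refl i j k \<otimes>\<^bsub>space_group\<^esub> w) x = (w \<otimes>\<^bsub>space_group\<^esub> coord_refl (\<sigma> i) (\<sigma> j) ?k) x"
    unfolding space_group_apply[OF B(1) w x] space_group_apply[OF w B(2) x]
  proof (rule crd_eqI)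
    fix l assume l: "l \<in> {1..?N}"
    have "crd (coord_refl i j k (w x)) l =
        (if l = i then crd (w x) j + k else if l = j then crd (w x) i - k else crd (w x) l)"
      by (rule crd_coord_refl[OF Bij_in_space[OF w x] ij l])
    moreover have "crd (w (coord_refl (\<sigma> i) (\<sigma> j) ?k x)) l = crd (coord_refl (\<sigma> i) (\<sigma> j) ?k x) (\<sigma> l) + t l"
      by (rule cw[OF Bij_in_space[OF B(2) x] l])
    moreover have "crd (coord_refl (\<sigma> i) (\<sigma> j) ?k x) (\<sigma> l) =
        (if \<sigma> l = \<sigma> i then crd x (\<sigma> j) + ?k else if \<sigma> l = \<sigma> j then crd x (\<sigma> i) - ?k else crd x (\<sigma> l))"
      by (rule crd_coord_refl[OF x ij' mem[OF l]])
    ultimately show "crd (coord_refl i j k (w x)) l = crd (w (coord_refl (\<sigma> i) (\<sigma> j) ?k x)) l"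
      using cw[OF x ij(1)] cw[OF x ij(2)] cw[OF x l] by (auto simp: ne)
  qed
qed

text \<open>The walls of the antidominant fundamental alcove; the level \<open>- 1\<close> belongs
  to the affine wall.\<close>

definition simple_index :: "nat \<Rightarrow> nat \<Rightarrow> nat \<Rightarrow> int \<Rightarrow> bool" where
  "simple_index N a b m \<longleftrightarrow> a \<in> {1..<N} \<and> b = Suc a \<and> m = 0 \<or> a = 1 \<and> b = N \<and> m = - 1"

lemma simple_index_range:
  "2 \<le> N \<Longrightarrow> simple_index N a b m \<Longrightarrow> a \<in> {1..N} \<and> b \<in> {1..N} \<and> a \<noteq> b"
  unfolding simple_index_def by auto

text \<open>
  A simple reflection moves every entry of the identity window by at most one, so it can only
  change sides of a hyperplane at distance one from it, which is its own.
\<close>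

lemma same_side_simple:
  fixes t :: "nat \<Rightarrow> int"
  assumes N: "2 \<le> N" and s: "simple_index N a b m" and ij: "i \<in> {1..N}" "j \<in> {1..N}" "i \<noteq> j"
    and ne: "\<not> (i = a \<and> j = b \<and> k = m)" "\<not> (i = b \<and> j = a \<and> k = - m)"
    and t: "t = (\<lambda>l. if l = a then m else if l = b then - m else 0)"
    and \<sigma>: "\<sigma> = Transposition.transpose a b"
  shows "same_side N i j k (reflect_window N a b m U) \<longleftrightarrow> same_side N (\<sigma> i) (\<sigma> j) (k - t i + t j) U"
proof -
  note ab = simple_index_range[OF N s]
  let ?k = "k - t i + t j"
  let ?D = "int i - int j - k * int N" and ?D' = "int (\<sigma> i) - int (\<sigma> j) - ?k * int N"
  have U: "reflect_window N a b m U l = U (\<sigma> l) + t l * int N" for l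
    using ab unfolding t \<sigma> reflect_window_def by (auto simp: Transposition.transpose_def)
  have f1: "reflect_window N a b m U i - reflect_window N a b m U j - k * int N = U (\<sigma> i) - U (\<sigma> j) - ?k * int N"
    unfolding U by (simp add: algebra_simps)
  have "\<sigma> i \<in> {1..N}" "\<sigma> j \<in> {1..N}" "\<sigma> i \<noteq> \<sigma> j"
    using ij ab unfolding \<sigma> by (auto simp: Transposition.transpose_def)
  then have nz: "?D \<noteq> 0" "?D' \<noteq> 0"
    using index_diff_not_multiple[OF ij, of k] index_diff_not_multiple[of "\<sigma> i" N "\<sigma> j" ?k] by auto
  \<comment> \<open>The displacement of the identity window under the simple reflection. It is
    \<open>1\<close> or \<open>- 1\<close> at \<open>a\<close> and \<open>b\<close> and zero
    elsewhere.\<close>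
  define e where "e l = int (\<sigma> l) + t l * int N - int l" for l
  define q where "q = k * int N"
  define d where "d = ?D'"
  have d: "d = int i - int j - q + e i - e j" unfolding e_def q_def d_def by (simp add: algebra_simps)
  note nz' = nz[folded q_def d_def]
  have "0 < int i - int j - q \<longleftrightarrow> 0 < d"
    using s unfolding simple_index_def
  proof
    assume c: "a \<in> {1..<N} \<and> b = Suc a \<and> m = 0"
    then have e: "e l = (if l = a then 1 else if l = b then -1 else 0)" for l
      unfolding e_def t \<sigma> by (auto simp: Transposition.transpose_def)
    have "k \<noteq> 0" if "i = a \<and> j = b \<or> i = b \<and> j = a" using ne c that by auto
    then have "q \<noteq> 0" if "i = a \<and> j = b \<or> i = b \<and> j = a" using that N unfolding q_def by auto
    then show ?thesis using nz' d e[of i] e[of j] c ij(3) by (auto split: if_splits)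
  next
    assume c: "a = 1 \<and> b = N \<and> m = - 1"
    then have e: "e l = (if l = a then -1 else if l = b then 1 else 0)" for l
      using N unfolding e_def t \<sigma> by (auto simp: Transposition.transpose_def)
    have "q \<noteq> - int N" if "i = a \<and> j = b"
    proof
      assume "q = - int N"
      then have "(k + 1) * int N = 0" unfolding q_def by (simp add: algebra_simps)
      then show False using ne c that N by simp
    qed
    moreover have "q \<noteq> int N" if "i = b \<and> j = a" using ne c that N unfolding q_def by auto
    ultimately show ?thesis using nz' d e[of i] e[of j] c ij(3) by (auto split: if_splits)
  qed
  then have "0 < ?D \<longleftrightarrow> 0 < ?D'" unfolding q_def d_def .
  then have "0 < z * ?D \<longleftrightarrow> 0 < z * ?D'" for z using nz by (auto simp: zero_less_mult_iff)
  then show ?thesis unfolding same_side_def f1 .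
qed

section \<open>Strong exchange\<close>

text \<open>Formed in \<open>space_group\<close>, whose product and unit \<open>aff_weyl\<close> and
  \<open>fin_weyl\<close> share, so that the same words compute lengths in both groups.\<close>

definition word :: "('m::{finite,linorder} rvec \<Rightarrow> 'm rvec) list \<Rightarrow> 'm rvec \<Rightarrow> 'm rvec" where
  "word ws = foldr (\<otimes>\<^bsub>space_group\<^esub>) ws \<one>\<^bsub>space_group\<^esub>"

lemma word_simps [simp]: "word [] = \<one>\<^bsub>space_group\<^esub>" "word (s # ws) = s \<otimes>\<^bsub>space_group\<^esub> word ws"
  by (simp_all add: word_def)

lemma fin_simple_reflections_eq:
  "(fin_simple_reflections :: ('m::{finite,linorder} rvec \<Rightarrow> 'm rvec) set) =
    {coord_refl a (Suc a) 0 | a. a \<in> {1..<CARD('m)}}"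
  by (simp add: fin_simple_reflections_def simple_root_def coord_refl_def)

lemma aff_simple_reflections_eq:
  assumes "2 \<le> CARD('m::{finite,linorder})"
  shows "(aff_simple_reflections :: ('m rvec \<Rightarrow> 'm rvec) set) = {coord_refl a b m | a b m. simple_index CARD('m) a b m}"
proof -
  have h: "(aff_reflection highest_root (- 1) :: 'm rvec \<Rightarrow> 'm rvec) = coord_refl 1 CARD('m) (- 1)"
    by (simp add: highest_root_def coord_refl_def)
  show ?thesis unfolding aff_simple_reflections_def h fin_simple_reflections_eq simple_index_def by auto
qed

lemma simple_in_aff_weyl:
  assumes "2 \<le> CARD('m::{finite,linorder})" "(s :: 'm rvec \<Rightarrow> 'm rvec) \<in> aff_simple_reflections"
  shows "s \<in> carrier aff_weyl"
  using assms(2) unfolding aff_simple_reflections_eq[OF assms(1)]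
  using coord_refl_in_aff_weyl[where 'm = 'm] simple_index_range[OF assms(1)] by blast

lemma word_in_aff_weyl:
  assumes "2 \<le> CARD('m::{finite,linorder})"
  shows "set ws \<subseteq> aff_simple_reflections \<Longrightarrow> (word ws :: 'm rvec \<Rightarrow> 'm rvec) \<in> carrier aff_weyl"
  by (induction ws) (simp_all add: one_in_aff_weyl mult_in_aff_weyl simple_in_aff_weyl[OF assms])

lemma aff_weyl_assoc:
  fixes x y z :: "'m::{finite,linorder} rvec \<Rightarrow> 'm rvec"
  assumes "x \<in> carrier aff_weyl" "y \<in> carrier aff_weyl" "z \<in> carrier aff_weyl"
  shows "(x \<otimes>\<^bsub>space_group\<^esub> y) \<otimes>\<^bsub>space_group\<^esub> z = x \<otimes>\<^bsub>space_group\<^esub> (y \<otimes>\<^bsub>space_group\<^esub> z)"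
  using monoid.m_assoc[OF group.is_monoid[OF group_aff_weyl] assms] by simp

lemma aff_weyl_l_one:
  fixes x :: "'m::{finite,linorder} rvec \<Rightarrow> 'm rvec"
  assumes "x \<in> carrier aff_weyl"
  shows "\<one>\<^bsub>space_group\<^esub> \<otimes>\<^bsub>space_group\<^esub> x = x" "x \<otimes>\<^bsub>space_group\<^esub> \<one>\<^bsub>space_group\<^esub> = x"
  using monoid.l_one[OF group.is_monoid[OF group_aff_weyl] assms]
    monoid.r_one[OF group.is_monoid[OF group_aff_weyl] assms] by simp_all

lemma coord_refl_cancel:
  fixes u :: "'m::{finite,linorder} rvec \<Rightarrow> 'm rvec"
  assumes "u \<in> carrier aff_weyl" "i \<in> {1..CARD('m)}" "j \<in> {1..CARD('m)}" "i \<noteq> j"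
  shows "coord_refl i j k \<otimes>\<^bsub>space_group\<^esub> (coord_refl i j k \<otimes>\<^bsub>space_group\<^esub> u) = u"
proof -
  have r: "(coord_refl i j k :: 'm rvec \<Rightarrow> 'm rvec) \<in> carrier aff_weyl" by (rule coord_refl_in_aff_weyl[OF assms(2-4)])
  show ?thesis
    unfolding aff_weyl_assoc[OF r r assms(1), symmetric] coord_refl_mult_self[OF assms(2-4)]
    by (rule aff_weyl_l_one(1)[OF assms(1)])
qed

text \<open>
  The gallery of the word crosses the hyperplane of the reflection, and the letter at the crossing
  can be deleted.
\<close>

lemma strong_exchange:
  assumes N: "2 \<le> CARD('m::{finite,linorder})" and J: "J \<subseteq> aff_simple_reflections"
  shows "set ws \<subseteq> J \<Longrightarrow> i \<in> {1..CARD('m)} \<Longrightarrow> j \<in> {1..CARD('m)} \<Longrightarrow> i \<noteq> j \<Longrightarrow>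
    \<not> same_side CARD('m) i j k (window (word ws :: 'm rvec \<Rightarrow> 'm rvec)) \<Longrightarrow>
    (\<exists>vs. set vs \<subseteq> J \<and> length vs < length ws \<and> word vs = coord_refl i j k \<otimes>\<^bsub>space_group\<^esub> word ws) \<and>
    (\<exists>w\<in>carrier aff_weyl. \<exists>s\<in>J. coord_refl i j k \<otimes>\<^bsub>space_group\<^esub> w = w \<otimes>\<^bsub>space_group\<^esub> s)"
\<comment> \<open>Deletion stays within \<open>J\<close>, which makes the result available inside
  the finite Weyl group too. The second conjunct shows the reflection to be a conjugate of a letter,
  as \<open>cox_reflections\<close> requires. The empty word is impossible because the base point
  lies on its own side.\<close>
proof (induction ws arbitrary: i j k)
  case Nil
  have "int i - int j - k * int CARD('m) \<noteq> 0" using index_diff_not_multiple[OF Nil(2-4), of k] by simp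
  moreover have "id_window CARD('m) i = int i" "id_window CARD('m) j = int j" using Nil(2,3) by (auto simp: id_window_def)
  ultimately show ?case using Nil(5) unfolding word_simps window_one same_side_def
    by (simp add: zero_less_mult_iff)
next
  case (Cons s ws)
  let ?N = "CARD('m)" and ?r = "coord_refl i j k :: 'm rvec \<Rightarrow> 'm rvec" and ?u = "word ws :: 'm rvec \<Rightarrow> 'm rvec"
  note ij = Cons.prems(2-4)
  have sJ: "s \<in> J" "set ws \<subseteq> J" using Cons.prems(1) by auto
  then obtain a b m where s: "s = coord_refl a b m" and si: "simple_index ?N a b m"
    using J unfolding aff_simple_reflections_eq[OF N] by blast
  have ab: "a \<in> {1..?N}" "b \<in> {1..?N}" "a \<noteq> b" using simple_index_range[OF N si] by auto
  have u: "?u \<in> carrier aff_weyl" using word_in_aff_weyl[OF N] sJ(2) J by blast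
  have sc: "s \<in> carrier aff_weyl" unfolding s by (rule coord_refl_in_aff_weyl[OF ab])
  have rc: "?r \<in> carrier aff_weyl" by (rule coord_refl_in_aff_weyl[OF ij])
  have W: "window (word (s # ws)) = reflect_window ?N a b m (window ?u)"
    unfolding word_simps s by (rule window_coord_refl_mult[OF u ab])
  show ?case
  proof (cases "(i = a \<and> j = b \<and> k = m) \<or> (i = b \<and> j = a \<and> k = - m)")
    \<comment> \<open>The hyperplane is crossed at this very letter: deleting it gives the shorter
      word, and the conjugating element is the identity.\<close>
    case True
    have r: "?r = s"
    proof (cases "i = a \<and> j = b \<and> k = m")
      case False
      then have "i = b" "j = a" "k = - m" using True by blast+
      then show ?thesis using coord_refl_commute[OF ab, of m] s by simp
    qed (use s in simp)
    have "word ws = ?r \<otimes>\<^bsub>space_group\<^esub> word (s # ws)"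
      unfolding r word_simps s by (rule coord_refl_cancel[OF u ab, symmetric])
    moreover have "?r \<otimes>\<^bsub>space_group\<^esub> \<one>\<^bsub>space_group\<^esub> = \<one>\<^bsub>space_group\<^esub> \<otimes>\<^bsub>space_group\<^esub> s"
      unfolding r aff_weyl_l_one[OF sc] ..
    ultimately show ?thesis using sJ one_in_aff_weyl by (metis length_Cons lessI)
  next
    case False
    define \<sigma> where "\<sigma> = Transposition.transpose a b"
    define t :: "nat \<Rightarrow> int" where "t = (\<lambda>l. if l = a then m else if l = b then - m else 0)"
    let ?k = "k - t i + t j" and ?r' = "coord_refl (\<sigma> i) (\<sigma> j) (k - t i + t j) :: 'm rvec \<Rightarrow> 'm rvec"
    have ij': "\<sigma> i \<in> {1..?N}" "\<sigma> j \<in> {1..?N}" "\<sigma> i \<noteq> \<sigma> j"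
      using ij ab unfolding \<sigma>_def by (auto simp: Transposition.transpose_def)
    have rc': "?r' \<in> carrier aff_weyl" by (rule coord_refl_in_aff_weyl[OF ij'])
    have "affine_form s \<sigma> t" unfolding s \<sigma>_def t_def by (rule affine_form_coord_refl[OF ab])
    then have conj: "?r \<otimes>\<^bsub>space_group\<^esub> s = s \<otimes>\<^bsub>space_group\<^esub> ?r'"
      using coord_refl_conjugate[OF aff_weyl_Bij[OF sc] _ ij] by blast
    have push: "?r \<otimes>\<^bsub>space_group\<^esub> (s \<otimes>\<^bsub>space_group\<^esub> x) = s \<otimes>\<^bsub>space_group\<^esub> (?r' \<otimes>\<^bsub>space_group\<^esub> x)"
      if x: "x \<in> carrier aff_weyl" for x
      unfolding aff_weyl_assoc[OF rc sc x, symmetric] conj by (rule aff_weyl_assoc[OF sc rc' x])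
    \<comment> \<open>Any other hyperplane is carried by the letter \<open>s\<close> to one that
      still separates, so the exchange happens further inside the word.\<close>
    have "\<not> same_side ?N (\<sigma> i) (\<sigma> j) ?k (window ?u)"
      using Cons.prems(5) False same_side_simple[OF N si ij _ _ t_def \<sigma>_def, of k "window ?u"]
      unfolding W by blast
    from Cons.IH[OF sJ(2) ij' this] obtain vs w s0 where
      vs: "set vs \<subseteq> J" "length vs < length ws" "word vs = ?r' \<otimes>\<^bsub>space_group\<^esub> ?u"
      and w: "w \<in> carrier aff_weyl" "s0 \<in> J" "?r' \<otimes>\<^bsub>space_group\<^esub> w = w \<otimes>\<^bsub>space_group\<^esub> s0" by blast
    have "word (s # vs) = ?r \<otimes>\<^bsub>space_group\<^esub> word (s # ws)"
      unfolding word_simps vs(3) by (rule push[OF u, symmetric])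
    then have 1: "\<exists>vs. set vs \<subseteq> J \<and> length vs < length (s # ws) \<and> word vs = ?r \<otimes>\<^bsub>space_group\<^esub> word (s # ws)"
      using vs(1,2) sJ(1) by (intro exI[of _ "s # vs"]) simp
    have s0: "s0 \<in> carrier aff_weyl" using simple_in_aff_weyl[OF N] w(2) J by blast
    have "?r \<otimes>\<^bsub>space_group\<^esub> (s \<otimes>\<^bsub>space_group\<^esub> w) = (s \<otimes>\<^bsub>space_group\<^esub> w) \<otimes>\<^bsub>space_group\<^esub> s0"
      unfolding push[OF w(1)] w(3) by (rule aff_weyl_assoc[OF sc w(1) s0, symmetric])
    then have "\<exists>w\<in>carrier aff_weyl. \<exists>s\<in>J. ?r \<otimes>\<^bsub>space_group\<^esub> w = w \<otimes>\<^bsub>space_group\<^esub> s"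
      using mult_in_aff_weyl[OF sc w(1)] w(2) by blast
    with 1 show ?thesis by blast
  qed
qed

text \<open>Reflecting in a separating hyperplane moves the point closer to the base point.\<close>

lemma window_word_exists:
  assumes N: "2 \<le> CARD('m::{finite,linorder})"
  shows "is_window CARD('m) Z \<Longrightarrow>
    \<exists>ws. set ws \<subseteq> aff_simple_reflections \<and> window (word ws :: 'm rvec \<Rightarrow> 'm rvec) = Z"
proof (induction "nat (\<Sum>l=1..CARD('m). (Z l - int l)\<^sup>2)" arbitrary: Z rule: less_induct)
  case less
  let ?N = "CARD('m)"
  show ?case
  proof (cases "\<exists>a b m. simple_index ?N a b m \<and> \<not> same_side ?N a b m Z")
    case True
    then obtain a b m where s: "simple_index ?N a b m" and side: "\<not> same_side ?N a b m Z" by blast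
    have ab: "a \<in> {1..?N}" "b \<in> {1..?N}" "a \<noteq> b" using simple_index_range[OF N s] by auto
    let ?Z = "reflect_window ?N a b m Z"
    let ?D = "Z a - Z b - m * int ?N" and ?c = "int a - int b - m * int ?N"
    have Z: "is_window ?N ?Z" by (rule is_window_reflect[OF less.prems ab])
    have "?D \<noteq> 0" "?c \<noteq> 0"
      using window_diff_not_multiple[OF less.prems ab, of m] index_diff_not_multiple[OF ab, of m] by auto
    then have neg: "?D * ?c < 0" using side unfolding same_side_def by (simp add: not_less order_le_less)
    have "(\<Sum>l=1..?N. (?Z l - int l)\<^sup>2) = (\<Sum>l=1..?N. (Z l - int l)\<^sup>2) - (Z a - int a)\<^sup>2 - (Z b - int b)\<^sup>2
        + (Z b + m * int ?N - int a)\<^sup>2 + (Z a - m * int ?N - int b)\<^sup>2"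
      unfolding reflect_window_def
      by (rule sum_fun_upd2[where g = "\<lambda>l y. (y - int l)\<^sup>2"]) (use ab in auto)
    \<comment> \<open>The squared distance changes by twice the product tested in
      \<open>same_side\<close>, which is negative when the hyperplane separates.\<close>
    moreover have "(Z b + q - x)\<^sup>2 + (Z a - q - y)\<^sup>2 =
        (Z a - x)\<^sup>2 + (Z b - y)\<^sup>2 + 2 * ((Z a - Z b - q) * (x - y - q))" for q x y
      by (simp add: power2_eq_square algebra_simps)
    note this[of "m * int ?N" "int a" "int b"]
    ultimately have "(\<Sum>l=1..?N. (?Z l - int l)\<^sup>2) < (\<Sum>l=1..?N. (Z l - int l)\<^sup>2)"
      using neg by linarith
    moreover have "0 \<le> (\<Sum>l=1..?N. (?Z l - int l)\<^sup>2)" by (intro sum_nonneg) simp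
    ultimately have "nat (\<Sum>l=1..?N. (?Z l - int l)\<^sup>2) < nat (\<Sum>l=1..?N. (Z l - int l)\<^sup>2)" by linarith
    from less.hyps[OF this Z] obtain ws where ws: "set ws \<subseteq> aff_simple_reflections"
      "window (word ws :: 'm rvec \<Rightarrow> 'm rvec) = ?Z" by blast
    have "window (word (coord_refl a b m # ws) :: 'm rvec \<Rightarrow> 'm rvec) = Z"
      unfolding word_simps window_coord_refl_mult[OF word_in_aff_weyl[OF N ws(1)] ab] ws(2)
      by (rule reflect_window_involutive[OF ab(3)])
    moreover have "set (coord_refl a b m # ws) \<subseteq> (aff_simple_reflections :: ('m rvec \<Rightarrow> 'm rvec) set)"
      using ws(1) s unfolding aff_simple_reflections_eq[OF N] by auto
    ultimately show ?thesis by blast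
  next
    case False
    have "Z = id_window ?N"
    proof (rule window_eq_id[OF less.prems])
      fix p assume "p \<in> {1..<?N}"
      then have "same_side ?N p (Suc p) 0 Z" using False unfolding simple_index_def by blast
      then show "Z p < Z (Suc p)" by (simp add: same_side_def)
    next
      have "same_side ?N 1 ?N (- 1) Z" using False unfolding simple_index_def by blast
      then show "Z ?N < Z 1 + int ?N" by (simp add: same_side_def)
    qed (use N in simp)
    then show ?thesis by (intro exI[of _ "[]"]) (simp add: window_one)
  qed
qed

lemma aff_weyl_word_exists:
  fixes w :: "'m::{finite,linorder} rvec \<Rightarrow> 'm rvec"
  assumes N: "2 \<le> CARD('m)" and w: "w \<in> carrier aff_weyl"
  obtains ws where "set ws \<subseteq> aff_simple_reflections" "word ws = w"
proof -
  obtain ws :: "('m rvec \<Rightarrow> 'm rvec) list" where ws: "set ws \<subseteq> aff_simple_reflections" "window (word ws) = window w"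
    using window_word_exists[OF N is_window_window[OF w]] by blast
  then have "word ws = w" using window_inject[OF word_in_aff_weyl[OF N ws(1)] w] by blast
  then show ?thesis using that ws(1) by blast
qed

text \<open>Strong exchange applied to a shortest word. The group \<open>H\<close> enters through
  its product and unit, so one statement covers the lengths of \<open>aff_weyl\<close> and
  \<open>fin_weyl\<close>.\<close>

lemma cox_length_reflect_less:
  fixes w :: "'m::{finite,linorder} rvec \<Rightarrow> 'm rvec"
  assumes N: "2 \<le> CARD('m)" and J: "J \<subseteq> aff_simple_reflections"
    and H: "mult H = mult space_group" "one H = one space_group"
    and us: "set us \<subseteq> J" "word us = w"
    and ij: "i \<in> {1..CARD('m)}" "j \<in> {1..CARD('m)}" "i \<noteq> j" and side: "\<not> same_side CARD('m) i j k (window w)"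
  shows "cox_length H J (coord_refl i j k \<otimes>\<^bsub>space_group\<^esub> w) < cox_length H J w"
proof -
  have len: "cox_length H J x = (LEAST n. \<exists>ws. set ws \<subseteq> J \<and> length ws = n \<and> word ws = x)" for x
    unfolding cox_length_def H word_def ..
  have "\<exists>n. \<exists>ws. set ws \<subseteq> J \<and> length ws = n \<and> word ws = w" using us by blast
  from LeastI_ex[OF this] obtain ws where ws: "set ws \<subseteq> J" "length ws = cox_length H J w" "word ws = w"
    unfolding len by blast
  from strong_exchange[OF N J ws(1) ij, of k] side ws(3) obtain vs where
    vs: "set vs \<subseteq> J" "length vs < length ws" "word vs = coord_refl i j k \<otimes>\<^bsub>space_group\<^esub> w" by blast
  have "cox_length H J (coord_refl i j k \<otimes>\<^bsub>space_group\<^esub> w) \<le> length vs"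
    unfolding len by (rule Least_le) (use vs in blast)
  then show ?thesis using vs(2) ws(2) by simp
qed

section \<open>The Bruhat order and the longest element\<close>

lemma aff_weyl_inv:
  fixes w :: "'m::{finite,linorder} rvec \<Rightarrow> 'm rvec"
  assumes "w \<in> carrier aff_weyl"
  shows "inv\<^bsub>aff_weyl\<^esub> w \<in> carrier aff_weyl"
    "w \<otimes>\<^bsub>space_group\<^esub> inv\<^bsub>aff_weyl\<^esub> w = \<one>\<^bsub>space_group\<^esub>"
    "inv\<^bsub>aff_weyl\<^esub> w \<otimes>\<^bsub>space_group\<^esub> w = \<one>\<^bsub>space_group\<^esub>"
  using group.inv_closed[OF group_aff_weyl assms] group.r_inv[OF group_aff_weyl assms]
    group.l_inv[OF group_aff_weyl assms] by simp_all

lemma conjugate_coord_refl_exists: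
  fixes x :: "'m::{finite,linorder} rvec \<Rightarrow> 'm rvec"
  assumes x: "x \<in> carrier aff_weyl" and ab: "a \<in> {1..CARD('m)}" "b \<in> {1..CARD('m)}" "a \<noteq> b"
  obtains i j k where "i \<in> {1..CARD('m)}" "j \<in> {1..CARD('m)}" "i \<noteq> j"
    "coord_refl i j k \<otimes>\<^bsub>space_group\<^esub> x = x \<otimes>\<^bsub>space_group\<^esub> coord_refl a b m"
proof -
  obtain \<sigma> t where f: "affine_form x \<sigma> t" using affine_form_exists[OF x] .
  then have \<sigma>: "\<sigma> permutes {1..CARD('m)}" unfolding affine_form_def by blast
  have im: "\<sigma> ` {1..CARD('m)} = {1..CARD('m)}" by (rule permutes_image[OF \<sigma>])
  obtain i where i: "i \<in> {1..CARD('m)}" "a = \<sigma> i" using ab(1) im by (metis imageE)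
  obtain j where j: "j \<in> {1..CARD('m)}" "b = \<sigma> j" using ab(2) im by (metis imageE)
  have ne: "i \<noteq> j" using i j ab(3) by blast
  have "m + t i - t j - t i + t j = m" by simp
  then show ?thesis
    using that[OF i(1) j(1) ne] coord_refl_conjugate[OF aff_weyl_Bij[OF x] f i(1) j(1) ne, of "m + t i - t j"] i j
    by metis
qed

text \<open>Conjugation by \<open>u\<close> turns the right factor into a left one, a reflection in
  some hyperplane. Reflecting towards the identity shortens, and of an element and its mirror image
  exactly one is on the far side, so the comparison of lengths and the side condition agree.\<close>

lemma bruhat_step_iff:
  fixes u v :: "'m::{finite,linorder} rvec \<Rightarrow> 'm rvec"
  assumes N: "2 \<le> CARD('m)" and u: "u \<in> carrier aff_weyl" and v: "v \<in> carrier aff_weyl"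
  shows "bruhat_step aff_weyl aff_simple_reflections u v \<longleftrightarrow> window_step CARD('m) (window u) (window v)"
proof
  note len = cox_length_reflect_less[OF N subset_refl aff_weyl_simps]
  assume st: "bruhat_step aff_weyl aff_simple_reflections u v"
  then obtain w s where w: "w \<in> carrier aff_weyl" and s: "s \<in> aff_simple_reflections"
    and v': "v = u \<otimes>\<^bsub>space_group\<^esub> ((w \<otimes>\<^bsub>space_group\<^esub> s) \<otimes>\<^bsub>space_group\<^esub> inv\<^bsub>aff_weyl\<^esub> w)"
    and less: "cox_length aff_weyl aff_simple_reflections u < cox_length aff_weyl aff_simple_reflections v"
    unfolding bruhat_step_def cox_reflections_def by auto
  \<comment> \<open>For \<open>t\<close> the conjugate of \<open>s\<close> by \<open>w\<close>, the
    product of \<open>u\<close> and \<open>t\<close> is \<open>?x\<close> times \<open>s\<close>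
    times the inverse of \<open>w\<close>; moving \<open>s\<close> to the left of \<open>?x\<close>
    makes it a hyperplane reflection of \<open>u\<close>.\<close>
  let ?x = "u \<otimes>\<^bsub>space_group\<^esub> w" and ?w = "inv\<^bsub>aff_weyl\<^esub> w"
  have x: "?x \<in> carrier aff_weyl" using mult_in_aff_weyl u w by blast
  obtain a b m where sab: "s = coord_refl a b m" "simple_index CARD('m) a b m"
    using s unfolding aff_simple_reflections_eq[OF N] by blast
  have ab: "a \<in> {1..CARD('m)}" "b \<in> {1..CARD('m)}" "a \<noteq> b" using simple_index_range[OF N sab(2)] by auto
  obtain i j k where ij: "i \<in> {1..CARD('m)}" "j \<in> {1..CARD('m)}" "i \<noteq> j"
    and conj: "coord_refl i j k \<otimes>\<^bsub>space_group\<^esub> ?x = ?x \<otimes>\<^bsub>space_group\<^esub> s"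
    using conjugate_coord_refl_exists[OF x ab, of m] sab(1) by metis
  let ?r = "coord_refl i j k :: 'm rvec \<Rightarrow> 'm rvec"
  have r: "?r \<in> carrier aff_weyl" by (rule coord_refl_in_aff_weyl[OF ij])
  have sc: "s \<in> carrier aff_weyl" by (rule simple_in_aff_weyl[OF N s])
  have "v = (?x \<otimes>\<^bsub>space_group\<^esub> s) \<otimes>\<^bsub>space_group\<^esub> ?w"
    unfolding v' using u w sc aff_weyl_inv(1)[OF w] by (simp add: aff_weyl_assoc mult_in_aff_weyl)
  also have "\<dots> = ?r \<otimes>\<^bsub>space_group\<^esub> (u \<otimes>\<^bsub>space_group\<^esub> (w \<otimes>\<^bsub>space_group\<^esub> ?w))"
    unfolding conj[symmetric] using u w r aff_weyl_inv(1)[OF w] by (simp add: aff_weyl_assoc mult_in_aff_weyl)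
  finally have vr: "v = ?r \<otimes>\<^bsub>space_group\<^esub> u" unfolding aff_weyl_inv(2)[OF w] aff_weyl_l_one(2)[OF u] .
  obtain us where us: "set us \<subseteq> aff_simple_reflections" "word us = u" using aff_weyl_word_exists[OF N u] .
  have "same_side CARD('m) i j k (window u)"
    using len[OF us ij, of k] less unfolding vr by (meson less_asym)
  then show "window_step CARD('m) (window u) (window v)"
    unfolding window_step_def vr window_coord_refl_mult[OF u ij] using ij by blast
next
  note len = cox_length_reflect_less[OF N subset_refl aff_weyl_simps]
  assume "window_step CARD('m) (window u) (window v)"
  then obtain i j k where ij: "i \<in> {1..CARD('m)}" "j \<in> {1..CARD('m)}" "i \<noteq> j"
    and wv: "window v = reflect_window CARD('m) i j k (window u)" and side: "same_side CARD('m) i j k (window u)"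
    unfolding window_step_def by blast
  let ?r = "coord_refl i j k :: 'm rvec \<Rightarrow> 'm rvec"
  have r: "?r \<in> carrier aff_weyl" by (rule coord_refl_in_aff_weyl[OF ij])
  have vr: "v = ?r \<otimes>\<^bsub>space_group\<^esub> u"
    by (rule window_inject[OF v mult_in_aff_weyl[OF r u]]) (simp only: wv window_coord_refl_mult[OF u ij])
  obtain vs where vs: "set vs \<subseteq> aff_simple_reflections" "word vs = v" using aff_weyl_word_exists[OF N v] .
  have "\<not> same_side CARD('m) i j k (window v)"
    unfolding wv using same_side_reflect[OF is_window_window[OF u] ij] side by blast
  from len[OF vs ij this]
  have less: "cox_length aff_weyl aff_simple_reflections u < cox_length aff_weyl aff_simple_reflections v"
    unfolding vr coord_refl_cancel[OF u ij] .
  \<comment> \<open>It remains to exhibit \<open>?r\<close> as a conjugate of a generator. Strong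
    exchange is applied to a word for \<open>?r\<close> itself, whose window lies beyond its own
    hyperplane.\<close>
  obtain rs where rs: "set rs \<subseteq> aff_simple_reflections" "word rs = ?r" using aff_weyl_word_exists[OF N r] .
  have "window ?r = reflect_window CARD('m) i j k (id_window CARD('m))"
    using window_coord_refl_mult[OF one_in_aff_weyl ij, of k] unfolding aff_weyl_l_one(2)[OF r] window_one .
  moreover have "same_side CARD('m) i j k (id_window CARD('m))"
    using index_diff_not_multiple[OF ij, of k] ij by (auto simp: same_side_def id_window_def zero_less_mult_iff)
  ultimately have "\<not> same_side CARD('m) i j k (window (word rs :: 'm rvec \<Rightarrow> 'm rvec))"
    unfolding rs(2) using same_side_reflect[OF is_window_id ij] by metis
  from strong_exchange[OF N subset_refl rs(1) ij this] obtain w s where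
    w: "w \<in> carrier aff_weyl" "s \<in> aff_simple_reflections" "?r \<otimes>\<^bsub>space_group\<^esub> w = w \<otimes>\<^bsub>space_group\<^esub> s" by blast
  have sc: "s \<in> carrier aff_weyl" by (rule simple_in_aff_weyl[OF N w(2)])
  note iu = aff_weyl_inv[OF u] and iw = aff_weyl_inv[OF w(1)]
  let ?u = "inv\<^bsub>aff_weyl\<^esub> u" and ?w = "inv\<^bsub>aff_weyl\<^esub> w"
  let ?y = "?u \<otimes>\<^bsub>space_group\<^esub> w"
  let ?t = "(?y \<otimes>\<^bsub>space_group\<^esub> s) \<otimes>\<^bsub>space_group\<^esub> inv\<^bsub>aff_weyl\<^esub> ?y"
  have y: "?y \<in> carrier aff_weyl" using mult_in_aff_weyl iu(1) w(1) by blast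
  have iy: "inv\<^bsub>aff_weyl\<^esub> ?y = ?w \<otimes>\<^bsub>space_group\<^esub> u"
    using group.inv_mult_group[OF group_aff_weyl iu(1) w(1)] group.inv_inv[OF group_aff_weyl u] by simp
  have "u \<otimes>\<^bsub>space_group\<^esub> ?t = (u \<otimes>\<^bsub>space_group\<^esub> ?u) \<otimes>\<^bsub>space_group\<^esub> ((w \<otimes>\<^bsub>space_group\<^esub> s) \<otimes>\<^bsub>space_group\<^esub> (?w \<otimes>\<^bsub>space_group\<^esub> u))"
    unfolding iy using u w(1) sc iu(1) iw(1) by (simp add: aff_weyl_assoc mult_in_aff_weyl)
  also have "\<dots> = (w \<otimes>\<^bsub>space_group\<^esub> s) \<otimes>\<^bsub>space_group\<^esub> (?w \<otimes>\<^bsub>space_group\<^esub> u)"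
    unfolding iu(2) using u w(1) sc iw(1) by (intro aff_weyl_l_one) (simp add: mult_in_aff_weyl)
  also have "\<dots> = ?r \<otimes>\<^bsub>space_group\<^esub> ((w \<otimes>\<^bsub>space_group\<^esub> ?w) \<otimes>\<^bsub>space_group\<^esub> u)"
    unfolding w(3)[symmetric] using u w(1) r iw(1) by (simp add: aff_weyl_assoc mult_in_aff_weyl)
  also have "\<dots> = v" unfolding iw(2) aff_weyl_l_one(1)[OF u] vr ..
  finally have "v = u \<otimes>\<^bsub>aff_weyl\<^esub> ?t" by simp
  moreover have "?t \<in> cox_reflections aff_weyl aff_simple_reflections"
    unfolding cox_reflections_def using y w(2) by auto
  ultimately show "bruhat_step aff_weyl aff_simple_reflections u v"
    unfolding bruhat_step_def using u v less by blast
qed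

text \<open>Chains of windows lift to chains of elements, since each window step is realised by a
  left multiplication with a reflection.\<close>

lemma bruhat_le_iff:
  fixes u v :: "'m::{finite,linorder} rvec \<Rightarrow> 'm rvec"
  assumes N: "2 \<le> CARD('m)" and u: "u \<in> carrier aff_weyl" and v: "v \<in> carrier aff_weyl"
  shows "bruhat_le aff_weyl aff_simple_reflections u v \<longleftrightarrow> (window_step CARD('m))\<^sup>*\<^sup>* (window u) (window v)"
proof
  assume "bruhat_le aff_weyl aff_simple_reflections u v"
  then have "(bruhat_step aff_weyl aff_simple_reflections)\<^sup>*\<^sup>* u v" unfolding bruhat_le_def .
  then show "(window_step CARD('m))\<^sup>*\<^sup>* (window u) (window v)"
  proof (induction rule: rtranclp_induct)
    case (step y z)
    then have "y \<in> carrier aff_weyl" "z \<in> carrier aff_weyl" unfolding bruhat_step_def by blast+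
    then have "window_step CARD('m) (window y) (window z)" using step.hyps(2) bruhat_step_iff[OF N] by blast
    from rtranclp_trans[OF step.IH r_into_rtranclp[of "window_step CARD('m)", OF this]] show ?case .
  qed simp
next
  have "\<exists>z. z \<in> carrier aff_weyl \<and> window z = Z \<and> bruhat_le aff_weyl aff_simple_reflections u z"
    if "(window_step CARD('m))\<^sup>*\<^sup>* (window u) Z" for Z
    using that
  proof (induction rule: rtranclp_induct)
    case base
    show ?case using u unfolding bruhat_le_def by blast
  next
    case (step Y Z)
    then obtain y where y: "y \<in> carrier aff_weyl" "window y = Y" "bruhat_le aff_weyl aff_simple_reflections u y" by blast
    obtain i j k where ij: "i \<in> {1..CARD('m)}" "j \<in> {1..CARD('m)}" "i \<noteq> j"
      and Z: "Z = reflect_window CARD('m) i j k Y" using step.hyps(2) unfolding window_step_def by blast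
    let ?z = "coord_refl i j k \<otimes>\<^bsub>space_group\<^esub> y"
    have z: "?z \<in> carrier aff_weyl" using mult_in_aff_weyl[OF coord_refl_in_aff_weyl[OF ij] y(1)] .
    have wz: "window ?z = Z" unfolding window_coord_refl_mult[OF y(1) ij] y(2) Z ..
    have "bruhat_step aff_weyl aff_simple_reflections y ?z"
      using bruhat_step_iff[OF N y(1) z] step.hyps(2) unfolding wz y(2) by blast
    then have "bruhat_le aff_weyl aff_simple_reflections u ?z"
      using rtranclp_trans[OF y(3)[unfolded bruhat_le_def] r_into_rtranclp[of "bruhat_step aff_weyl aff_simple_reflections"]]
      unfolding bruhat_le_def by blast
    then show ?case using z wz by blast
  qed
  moreover assume "(window_step CARD('m))\<^sup>*\<^sup>* (window u) (window v)"
  ultimately show "bruhat_le aff_weyl aff_simple_reflections u v" using window_inject[OF _ v] by blast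
qed

section \<open>The finite Weyl group and its longest element\<close>

lemma fin_simple_subset: "fin_simple_reflections \<subseteq> aff_simple_reflections"
  unfolding aff_simple_reflections_def by blast

lemma word_append:
  assumes "2 \<le> CARD('m::{finite,linorder})" "set ys \<subseteq> aff_simple_reflections"
  shows "set xs \<subseteq> aff_simple_reflections \<Longrightarrow>
    (word (xs @ ys) :: 'm rvec \<Rightarrow> 'm rvec) = word xs \<otimes>\<^bsub>space_group\<^esub> word ys"
proof (induction xs)
  case Nil
  show ?case using aff_weyl_l_one(1)[OF word_in_aff_weyl[OF assms]] by simp
next
  case (Cons s xs)
  then show ?case
    using aff_weyl_assoc[OF simple_in_aff_weyl[OF assms(1)] word_in_aff_weyl[OF assms(1)] word_in_aff_weyl[OF assms], of s xs]
    by simp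
qed

lemma carrier_fin_weyl:
  assumes N: "2 \<le> CARD('m::{finite,linorder})"
  shows "carrier (fin_weyl :: ('m rvec \<Rightarrow> 'm rvec) monoid) = {word ws | ws. set ws \<subseteq> fin_simple_reflections}"
    (is "_ = ?W")
proof
  have "w \<in> ?W" if "w \<in> generate space_group fin_simple_reflections" for w :: "'m rvec \<Rightarrow> 'm rvec"
    using that
  proof (induction rule: generate.induct)
    case one
    show ?case by (intro CollectI exI[of _ "[]"]) simp
  next
    case (incl h)
    then have "h = word [h]"
      using aff_weyl_l_one(2)[OF simple_in_aff_weyl[OF N]] fin_simple_subset by (metis subsetD word_simps)
    then show ?case using incl by (intro CollectI exI[of _ "[h]"]) simp
  next
    case (inv h)
    then obtain a where a: "h = coord_refl a (Suc a) 0" "a \<in> {1..<CARD('m)}" unfolding fin_simple_reflections_eq by blast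
    then have ab: "a \<in> {1..CARD('m)}" "Suc a \<in> {1..CARD('m)}" "a \<noteq> Suc a" by auto
    have "inv\<^bsub>space_group\<^esub> h = h"
      by (rule group.inv_equality[OF group_BijGroup])
        (use a(1) coord_refl_mult_self[OF ab] coord_refl_Bij[OF ab] in \<open>simp_all add: carrier_space_group\<close>)
    moreover have "h = word [h]"
      using aff_weyl_l_one(2)[OF simple_in_aff_weyl[OF N]] fin_simple_subset inv by (metis subsetD word_simps)
    ultimately show ?case using inv by (intro CollectI exI[of _ "[h]"]) simp
  next
    case (eng h1 h2)
    then obtain xs ys where w: "h1 = word xs" "h2 = word ys" "set xs \<subseteq> fin_simple_reflections" "set ys \<subseteq> fin_simple_reflections"
      by blast
    have "h1 \<otimes>\<^bsub>space_group\<^esub> h2 = word (xs @ ys)" unfolding w(1,2)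
      by (rule word_append[OF N, symmetric]) (use w(3,4) fin_simple_subset in \<open>blast+\<close>)
    then show ?case using w by (intro CollectI exI[of _ "xs @ ys"]) simp
  qed
  then show "carrier fin_weyl \<subseteq> ?W" unfolding fin_weyl_def by auto
  have "word ws \<in> generate space_group fin_simple_reflections" if "set ws \<subseteq> fin_simple_reflections" for ws :: "('m rvec \<Rightarrow> 'm rvec) list"
    using that by (induction ws) (auto intro: generate.intros)
  then show "?W \<subseteq> carrier fin_weyl" unfolding fin_weyl_def by auto
qed

lemma window_image_fin:
  assumes N: "2 \<le> CARD('m::{finite,linorder})"
  shows "set ws \<subseteq> fin_simple_reflections \<Longrightarrow>
    window (word ws :: 'm rvec \<Rightarrow> 'm rvec) ` {1..CARD('m)} = {1..int CARD('m)}"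
proof (induction ws)
  case Nil
  have "id_window CARD('m) ` {1..CARD('m)} = int ` {1..CARD('m)}"
    by (rule image_cong) (auto simp: id_window_def)
  then show ?case using image_int_atLeastAtMost[of 1 "CARD('m)"] by (simp add: window_one)
next
  case (Cons s ws)
  then obtain a where a: "s = coord_refl a (Suc a) 0" "a \<in> {1..<CARD('m)}" unfolding fin_simple_reflections_eq by auto
  then have ab: "a \<in> {1..CARD('m)}" "Suc a \<in> {1..CARD('m)}" "a \<noteq> Suc a" by auto
  have u: "(word ws :: 'm rvec \<Rightarrow> 'm rvec) \<in> carrier aff_weyl"
    using word_in_aff_weyl[OF N] Cons.prems fin_simple_subset by (metis insert_subset list.simps(15) order_trans)
  show ?case
    unfolding word_simps a(1) window_coord_refl_mult[OF u ab] image_reflect_window[OF ab(1,2)]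
    using Cons by simp
qed

text \<open>Keeping the strict inequality along the chain is what makes the top element the unique
  longest one.\<close>

lemma fin_ascent:
  fixes w :: "'m::{finite,linorder} rvec \<Rightarrow> 'm rvec"
  assumes N: "2 \<le> CARD('m)" and w: "w \<in> carrier fin_weyl"
  shows "(ascent_step CARD('m))\<^sup>*\<^sup>* (window w) Z \<Longrightarrow> \<exists>z\<in>carrier fin_weyl. window z = Z \<and>
    (z = w \<or> cox_length fin_weyl fin_simple_reflections w < cox_length fin_weyl fin_simple_reflections z)"
proof (induction rule: rtranclp_induct)
  case base
  show ?case using w by blast
next
  case (step Y Z)
  let ?l = "cox_length fin_weyl fin_simple_reflections"
  obtain y where y: "y \<in> carrier fin_weyl" "window y = Y" "y = w \<or> ?l w < ?l y" using step.IH by blast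
  obtain i where i: "i \<in> {1..<CARD('m)}" "Y i < Y (Suc i)" "Z = reflect_window CARD('m) i (Suc i) 0 Y"
    using step.hyps(2) unfolding ascent_step_def by blast
  have ij: "i \<in> {1..CARD('m)}" "Suc i \<in> {1..CARD('m)}" "i \<noteq> Suc i" using i(1) by auto
  obtain ys where ys: "set ys \<subseteq> fin_simple_reflections" "y = word ys" using y(1) unfolding carrier_fin_weyl[OF N] by blast
  have yc: "y \<in> carrier aff_weyl" unfolding ys(2) using word_in_aff_weyl[OF N] ys(1) fin_simple_subset by blast
  let ?r = "coord_refl i (Suc i) 0 :: 'm rvec \<Rightarrow> 'm rvec"
  let ?z = "?r \<otimes>\<^bsub>space_group\<^esub> y"
  have zw: "set (?r # ys) \<subseteq> fin_simple_reflections" "word (?r # ys) = ?z"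
    using ys i(1) unfolding fin_simple_reflections_eq by auto
  have z: "?z \<in> carrier fin_weyl" unfolding carrier_fin_weyl[OF N]
    by (intro CollectI exI[of _ "?r # ys"]) (use zw in simp)
  have wz: "window ?z = Z" unfolding window_coord_refl_mult[OF yc ij] y(2) i(3) ..
  have "same_side CARD('m) i (Suc i) 0 (window y)" unfolding y(2) same_side_def using i(2) by simp
  then have "\<not> same_side CARD('m) i (Suc i) 0 (window ?z)"
    unfolding window_coord_refl_mult[OF yc ij] using same_side_reflect[OF is_window_window[OF yc] ij] by blast
  from cox_length_reflect_less[OF N fin_simple_subset fin_weyl_simps zw ij this]
  have "?l y < ?l ?z" unfolding coord_refl_cancel[OF yc ij] .
  then have "?l w < ?l ?z" using y(3) by auto
  then show ?case using z wz by blast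
qed

text \<open>\<open>longest_element\<close> is a definite description, so uniqueness has to be shown:
  every finite element climbs by ascents to the reversed window, gaining length strictly unless it
  is already there.\<close>

lemma w0_window:
  assumes N: "2 \<le> CARD('m::{finite,linorder})"
  shows "(w0 :: 'm rvec \<Rightarrow> 'm rvec) \<in> carrier aff_weyl"
    "window (w0 :: 'm rvec \<Rightarrow> 'm rvec) = rev_window CARD('m)"
proof -
  let ?l = "cox_length (fin_weyl :: ('m rvec \<Rightarrow> 'm rvec) monoid) fin_simple_reflections"
  have sub: "v \<in> carrier aff_weyl" if "v \<in> carrier fin_weyl" for v :: "'m rvec \<Rightarrow> 'm rvec"
    using that word_in_aff_weyl[OF N] fin_simple_subset unfolding carrier_fin_weyl[OF N] by blast
  have asc: "\<exists>z\<in>carrier fin_weyl. window z = rev_window CARD('m) \<and> (z = v \<or> ?l v < ?l z)"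
    if v: "v \<in> carrier fin_weyl" for v
  proof (rule fin_ascent[OF N v], rule ascent_steps_to_rev)
    show "window v ` {1..CARD('m)} = {1..int CARD('m)}"
      using v window_image_fin[OF N] unfolding carrier_fin_weyl[OF N] by blast
    show "window v i = 0" if "i \<notin> {1..CARD('m)}" for i using that by (auto simp: window_def)
  qed
  have "word [] \<in> carrier (fin_weyl :: ('m rvec \<Rightarrow> 'm rvec) monoid)"
    unfolding carrier_fin_weyl[OF N] by (intro CollectI exI[of _ "[]"]) simp
  from asc[OF this] obtain z :: "'m rvec \<Rightarrow> 'm rvec" where z: "z \<in> carrier fin_weyl" "window z = rev_window CARD('m)" by blast
  have up: "z = v \<or> ?l v < ?l z" if v: "v \<in> carrier fin_weyl" for v
    using asc[OF v] z window_inject sub by metis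
  have "w0 = z" unfolding w0_def longest_element_def
  proof (rule the_equality)
    show "z \<in> carrier fin_weyl \<and> (\<forall>v\<in>carrier fin_weyl. ?l v \<le> ?l z)" using z(1) up by fastforce
    fix w assume "w \<in> carrier fin_weyl \<and> (\<forall>v\<in>carrier fin_weyl. ?l v \<le> ?l w)"
    then show "w = z" using up[of w] z(1) by (metis not_less)
  qed
  then show "(w0 :: 'm rvec \<Rightarrow> 'm rvec) \<in> carrier aff_weyl" "window (w0 :: 'm rvec \<Rightarrow> 'm rvec) = rev_window CARD('m)"
    using z sub by auto
qed

section \<open>Alcoves and weights\<close>

text \<open>The reversed window forces \<open>w0\<close> to be the reversal of coordinates with no
  translation part.\<close>

lemma w0_involutive:
  fixes x :: "'m::{finite,linorder} rvec"
  assumes N: "2 \<le> CARD('m)" and x: "x \<in> sum_zero_space"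
  shows "w0 (w0 x) = x"
proof -
  note w0 = w0_window[OF N]
  obtain \<sigma> t where f: "affine_form (w0 :: 'm rvec \<Rightarrow> 'm rvec) \<sigma> t" using affine_form_exists[OF w0(1)] .
  have st: "\<sigma> i = CARD('m) + 1 - i \<and> t i = 0" if i: "i \<in> {1..CARD('m)}" for i
  proof -
    have m: "\<sigma> i \<in> {1..CARD('m)}" using f i unfolding affine_form_def by (metis permutes_in_image)
    have r: "CARD('m) + 1 - i \<in> {1..CARD('m)}" using i by auto
    have "int (\<sigma> i) + int CARD('m) * t i = int (CARD('m) + 1 - i)"
      using affine_form_window[OF f i] i unfolding w0(2) rev_window_def by simp
    then have e: "int (\<sigma> i) - int (CARD('m) + 1 - i) = (- t i) * int CARD('m)" by (simp add: algebra_simps)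
    then have "\<sigma> i = CARD('m) + 1 - i" using index_diff_not_multiple[OF m r] by blast
    then show ?thesis using e by simp
  qed
  have c: "crd (w0 y) i = crd y (CARD('m) + 1 - i)" if "y \<in> sum_zero_space" "i \<in> {1..CARD('m)}" for y :: "'m rvec" and i
    using f that st[OF that(2)] unfolding affine_form_def by simp
  show ?thesis
  proof (rule crd_eqI)
    fix i assume i: "i \<in> {1..CARD('m)}"
    then have r: "CARD('m) + 1 - i \<in> {1..CARD('m)}" "CARD('m) + 1 - (CARD('m) + 1 - i) = i" by auto
    show "crd (w0 (w0 x)) i = crd x i"
      unfolding c[OF Bij_in_space[OF aff_weyl_Bij[OF w0(1)] x] i] c[OF x r(1)] r(2) ..
  qed
qed

lemma inner_simple_root: "x \<bullet> simple_root i = crd x i - crd x (Suc i)"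
  unfolding simple_root_def by (simp add: inner_diff_right)

text \<open>Floors behave well under integral translations, hence this form. Asking for both orders
  of a pair excludes the walls: the value \<open>- 1\<close> has floor \<open>- 1\<close>, but its
  negative has floor 1.\<close>

lemma fund_alcove_iff:
  fixes x :: "'m::{finite,linorder} rvec"
  shows "x \<in> fund_alcove \<longleftrightarrow> x \<in> sum_zero_space \<and>
    (\<forall>i\<in>{1..CARD('m)}. \<forall>j\<in>{1..CARD('m)}. \<lfloor>crd x i - crd x j\<rfloor> = (if i < j then - 1 else 0))"
proof -
  have "x \<in> fund_alcove \<longleftrightarrow> x \<in> sum_zero_space \<and>
    (\<forall>i\<in>{1..CARD('m)}. \<forall>j\<in>{1..CARD('m)}. i < j \<longrightarrow> - 1 < crd x i - crd x j \<and> crd x i - crd x j < 0)"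
  proof -
    have "(\<forall>\<alpha>\<in>pos_roots. Q \<alpha>) \<longleftrightarrow> (\<forall>i\<in>{1..CARD('m)}. \<forall>j\<in>{1..CARD('m)}. i < j \<longrightarrow> Q (std_basis i - std_basis j))"
      for Q :: "'m rvec \<Rightarrow> bool" unfolding pos_roots_def by blast
    then show ?thesis unfolding fund_alcove_def by (simp only: mem_Collect_eq inner_diff_right inner_std_basis)
  qed
  also have "\<dots> \<longleftrightarrow> x \<in> sum_zero_space \<and>
    (\<forall>i\<in>{1..CARD('m)}. \<forall>j\<in>{1..CARD('m)}. \<lfloor>crd x i - crd x j\<rfloor> = (if i < j then - 1 else 0))"
  proof (intro conj_cong refl iffI ballI impI)
    fix i j
    assume a: "\<forall>i\<in>{1..CARD('m)}. \<forall>j\<in>{1..CARD('m)}. i < j \<longrightarrow> - 1 < crd x i - crd x j \<and> crd x i - crd x j < 0"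
      and ij: "i \<in> {1..CARD('m)}" "j \<in> {1..CARD('m)}"
    consider "i < j" | "i = j" | "j < i" by linarith
    then show "\<lfloor>crd x i - crd x j\<rfloor> = (if i < j then - 1 else 0)"
    proof cases
      case 1
      then have "- 1 < crd x i - crd x j" "crd x i - crd x j < 0" using a ij by blast+
      then show ?thesis using 1 by (simp add: floor_eq_iff)
    next
      case 3
      then have "- 1 < crd x j - crd x i" "crd x j - crd x i < 0" using a ij by blast+
      then show ?thesis using 3 by (simp add: floor_eq_iff)
    qed simp
  next
    fix i j
    assume a: "\<forall>i\<in>{1..CARD('m)}. \<forall>j\<in>{1..CARD('m)}. \<lfloor>crd x i - crd x j\<rfloor> = (if i < j then - 1 else 0)"
      and ij: "i \<in> {1..CARD('m)}" "j \<in> {1..CARD('m)}" "i < j"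
    have "\<lfloor>crd x i - crd x j\<rfloor> = (if i < j then - 1 else 0)" "\<lfloor>crd x j - crd x i\<rfloor> = (if j < i then - 1 else 0)"
      using a ij by blast+
    then have "\<lfloor>crd x i - crd x j\<rfloor> = - 1" "\<lfloor>crd x j - crd x i\<rfloor> = 0" using ij(3) by simp_all
    then show "- 1 < crd x i - crd x j \<and> crd x i - crd x j < 0" by (simp add: floor_eq_iff)
  qed
  finally show ?thesis .
qed

lemma base_point_in_fund_alcove: "(base_point :: 'm::{finite,linorder} rvec) \<in> fund_alcove"
proof -
  have "\<lfloor>crd (base_point :: 'm rvec) i - crd (base_point :: 'm rvec) j\<rfloor> = (if i < j then - 1 else 0)"
    if ij: "i \<in> {1..CARD('m)}" "j \<in> {1..CARD('m)}" for i j
  proof -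
    have e: "crd (base_point :: 'm rvec) i - crd (base_point :: 'm rvec) j = (real i - real j) / CARD('m)"
      unfolding crd_base_point[OF ij(1)] crd_base_point[OF ij(2)] by (simp add: diff_divide_distrib)
    show ?thesis unfolding e using ij by (auto simp: floor_eq_iff field_simps)
  qed
  then show ?thesis unfolding fund_alcove_iff using base_point_in_space by blast
qed

text \<open>An element permutes the coordinate differences and shifts them by integers, so the whole
  alcove shares the floors of the image of its base point.\<close>

lemma alcove_eq:
  fixes w :: "'m::{finite,linorder} rvec \<Rightarrow> 'm rvec"
  assumes w: "w \<in> carrier aff_weyl"
  shows "alcove w = {y \<in> sum_zero_space. \<forall>i\<in>{1..CARD('m)}. \<forall>j\<in>{1..CARD('m)}.
    \<lfloor>crd y i - crd y j\<rfloor> = \<lfloor>crd (w base_point) i - crd (w base_point) j\<rfloor>}" (is "_ = ?R")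
proof -
  obtain \<sigma> t where f: "affine_form w \<sigma> t" using affine_form_exists[OF w] .
  have \<sigma>: "\<sigma> permutes {1..CARD('m)}" using f unfolding affine_form_def by blast
  have B: "w \<in> Bij sum_zero_space" by (rule aff_weyl_Bij[OF w])
  have im: "w ` sum_zero_space = sum_zero_space" using B unfolding Bij_def bij_betw_def by blast
  have fl: "\<lfloor>crd (w x) i - crd (w x) j\<rfloor> = \<lfloor>crd x (\<sigma> i) - crd x (\<sigma> j)\<rfloor> + (t i - t j)"
    if "x \<in> sum_zero_space" "i \<in> {1..CARD('m)}" "j \<in> {1..CARD('m)}" for x i j
  proof -
    have "crd (w x) i = crd x (\<sigma> i) + t i" "crd (w x) j = crd x (\<sigma> j) + t j"
      using f that unfolding affine_form_def by blast+
    then have "crd (w x) i - crd (w x) j = (crd x (\<sigma> i) - crd x (\<sigma> j)) + of_int (t i - t j)" by simp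
    then show ?thesis by (metis floor_add_int)
  qed
  have "w x \<in> ?R \<longleftrightarrow> x \<in> fund_alcove" if x: "x \<in> sum_zero_space" for x
  proof -
    have "w x \<in> ?R \<longleftrightarrow> (\<forall>i\<in>{1..CARD('m)}. \<forall>j\<in>{1..CARD('m)}. \<lfloor>crd x (\<sigma> i) - crd x (\<sigma> j)\<rfloor> =
        \<lfloor>crd (base_point :: 'm rvec) (\<sigma> i) - crd (base_point :: 'm rvec) (\<sigma> j)\<rfloor>)"
      using fl[OF x] fl[OF base_point_in_space] Bij_in_space[OF B x] by (simp del: atLeastAtMost_iff)
    also have "\<dots> \<longleftrightarrow> (\<forall>i\<in>\<sigma> ` {1..CARD('m)}. \<forall>j\<in>\<sigma> ` {1..CARD('m)}. \<lfloor>crd x i - crd x j\<rfloor> =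
        \<lfloor>crd (base_point :: 'm rvec) i - crd (base_point :: 'm rvec) j\<rfloor>)" by blast
    also have "\<dots> \<longleftrightarrow> x \<in> fund_alcove"
      unfolding permutes_image[OF \<sigma>] using base_point_in_fund_alcove[where 'm = 'm] x unfolding fund_alcove_iff
      by (simp del: atLeastAtMost_iff)
    finally show ?thesis .
  qed
  moreover have "fund_alcove \<subseteq> (sum_zero_space :: 'm rvec set)" unfolding fund_alcove_def by blast
  moreover have "?R \<subseteq> w ` sum_zero_space" unfolding im by blast
  ultimately show ?thesis unfolding alcove_def by blast
qed

text \<open>Needed for the uniqueness in \<open>theta\<close>. The quotient of the two elements
  moves the base point within the fundamental alcove, so its window satisfies the wall inequalities
  and is the identity.\<close>

lemma alcove_inject:
  fixes u w :: "'m::{finite,linorder} rvec \<Rightarrow> 'm rvec"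
  assumes u: "u \<in> carrier aff_weyl" and w: "w \<in> carrier aff_weyl" and eq: "alcove u = alcove w"
  shows "u = w"
proof -
  let ?v = "inv\<^bsub>aff_weyl\<^esub> w \<otimes>\<^bsub>space_group\<^esub> u"
  note iw = aff_weyl_inv[OF w]
  have v: "?v \<in> carrier aff_weyl" using mult_in_aff_weyl[OF iw(1) u] .
  have "u base_point \<in> alcove u" unfolding alcove_def by (rule imageI[OF base_point_in_fund_alcove])
  then have "u base_point \<in> alcove w" unfolding eq .
  then obtain x where x: "x \<in> fund_alcove" "u base_point = w x" unfolding alcove_def by blast
  have xs: "x \<in> sum_zero_space" using x(1) unfolding fund_alcove_def by blast
  have "?v base_point = (inv\<^bsub>aff_weyl\<^esub> w) (w x)"
    unfolding space_group_apply[OF aff_weyl_Bij[OF iw(1)] aff_weyl_Bij[OF u] base_point_in_space] x(2) ..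
  also have "\<dots> = x"
    unfolding space_group_apply[OF aff_weyl_Bij[OF iw(1)] aff_weyl_Bij[OF w] xs, symmetric] iw(3)
    using xs by (simp add: BijGroup_def)
  finally have vx: "?v base_point = x" .
  have N1: "1 \<le> CARD('m)" by (simp add: Suc_le_eq)
  have "window ?v = id_window CARD('m)"
  proof (rule window_eq_id[OF is_window_window[OF v] N1])
    have fl: "\<lfloor>crd x i - crd x j\<rfloor> = (if i < j then - 1 else 0)"
      if "i \<in> {1..CARD('m)}" "j \<in> {1..CARD('m)}" for i j
      using x(1) that unfolding fund_alcove_iff by blast
    have W: "real_of_int (window ?v i) = CARD('m) * crd x i + (CARD('m) + 1) / 2" if "i \<in> {1..CARD('m)}" for i
      using window_real[OF v that] unfolding vx .
    {
      fix p assume "p \<in> {1..<CARD('m)}"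
      then have p: "p \<in> {1..CARD('m)}" "Suc p \<in> {1..CARD('m)}" by auto
      have "crd x p - crd x (Suc p) < 0" using fl[OF p] by (simp add: floor_eq_iff)
      then have "CARD('m) * crd x p < CARD('m) * crd x (Suc p)" by simp
      then show "window ?v p < window ?v (Suc p)" using W[OF p(1)] W[OF p(2)] by linarith
    }
    have p: "1 \<in> {1..CARD('m)}" "CARD('m) \<in> {1..CARD('m)}" using N1 by auto
    have "crd x CARD('m) - crd x 1 < 1" using fl[OF p(2,1)] by (simp add: floor_eq_iff split: if_splits)
    then have "CARD('m) * crd x CARD('m) < CARD('m) * (crd x 1 + 1)" by (simp only: mult_less_cancel_left) simp
    then have "real_of_int (window ?v CARD('m)) < real_of_int (window ?v 1) + CARD('m)"
      unfolding W[OF p(1)] W[OF p(2)] by (simp add: algebra_simps)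
    then show "window ?v CARD('m) < window ?v 1 + int CARD('m)" by linarith
  qed
  then have "?v = \<one>\<^bsub>space_group\<^esub>" using window_inject[OF v one_in_aff_weyl] window_one by metis
  then have "w \<otimes>\<^bsub>space_group\<^esub> ?v = w" using aff_weyl_l_one(2)[OF w] by simp
  moreover have "w \<otimes>\<^bsub>space_group\<^esub> ?v = u"
    unfolding aff_weyl_assoc[OF w iw(1) u, symmetric] iw(2) by (rule aff_weyl_l_one(1)[OF u])
  ultimately show ?thesis by simp
qed

section \<open>Fundamental and dominant weights\<close>

lemma space_eqI:
  fixes x y :: "'m::{finite,linorder} rvec"
  assumes "x \<in> sum_zero_space" "y \<in> sum_zero_space"
    and eq: "\<And>j. j \<in> {1..<CARD('m)} \<Longrightarrow> x \<bullet> simple_root j = y \<bullet> simple_root j"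
  shows "x = y"
proof -
  have step: "crd x j - crd y j = crd x 1 - crd y 1" if "1 \<le> j" "j \<le> CARD('m)" for j
    using that
  proof (induction j rule: nat_induct_at_least)
    case (Suc n)
    then show ?case using eq[of n] by (simp add: inner_simple_root)
  qed simp
  have "(\<Sum>j=1..CARD('m). crd x j - crd y j) = (\<Sum>j=1..CARD('m). crd x 1 - crd y 1)"
    by (rule sum.cong[OF refl], rule step) auto
  moreover have "(\<Sum>j=1..CARD('m). crd x j - crd y j) = 0"
    using assms(1,2) by (simp add: sum_subtractf sum_zero_space_iff)
  ultimately have "crd x 1 - crd y 1 = 0" by simp
  then have "crd x j = crd y j" if "j \<in> {1..CARD('m)}" for j using step[of j] that by simp
  then show ?thesis by (rule crd_eqI)
qed

lemma fund_weight_spec: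
  assumes i: "i \<in> {1..<CARD('m::{finite,linorder})}"
  shows "(fund_weight i :: 'm rvec) \<in> sum_zero_space"
    "\<And>j. j \<in> {1..<CARD('m)} \<Longrightarrow> (fund_weight i :: 'm rvec) \<bullet> simple_root j = (if i = j then 1 else 0)"
proof -
  let ?P = "\<lambda>v :: 'm rvec. v \<in> sum_zero_space \<and> (\<forall>j\<in>{1..<CARD('m)}. v \<bullet> simple_root j = (if i = j then 1 else 0))"
  \<comment> \<open>The sum of the first \<open>i\<close> basis vectors, projected to the sum-zero
    hyperplane.\<close>
  let ?v = "vec_of (\<lambda>j. (if j \<le> i then 1 else 0) - real i / CARD('m)) :: 'm rvec"
  have "?P ?v"
  proof
    have "(\<Sum>j=1..CARD('m). crd ?v j) = (\<Sum>j=1..CARD('m). (if j \<le> i then 1 else 0) - real i / CARD('m))"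
      by (rule sum.cong) (auto simp: crd_vec_of simp del: atLeastAtMost_iff)
    also have "\<dots> = (\<Sum>j=1..CARD('m). if j \<le> i then 1 else 0) - real i" by (simp add: sum_subtractf)
    also have "(\<Sum>j=1..CARD('m). if j \<le> i then 1 else 0) = (\<Sum>j\<in>{1..i}. (1::real))"
      by (rule sum.mono_neutral_cong_right) (use i in auto)
    finally show "?v \<in> sum_zero_space" by (simp add: sum_zero_space_iff)
    show "\<forall>j\<in>{1..<CARD('m)}. ?v \<bullet> simple_root j = (if i = j then 1 else 0)"
    proof
      fix j assume "j \<in> {1..<CARD('m)}"
      then have "j \<in> {1..CARD('m)}" "Suc j \<in> {1..CARD('m)}" by auto
      then show "?v \<bullet> simple_root j = (if i = j then 1 else 0)"
        by (auto simp: inner_simple_root crd_vec_of simp del: atLeastAtMost_iff)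
    qed
  qed
  moreover have "v = ?v" if "?P v" for v using that \<open>?P ?v\<close> by (intro space_eqI) auto
  ultimately have "?P (fund_weight i)" unfolding fund_weight_def by (rule theI)
  then show "(fund_weight i :: 'm rvec) \<in> sum_zero_space"
    "\<And>j. j \<in> {1..<CARD('m)} \<Longrightarrow> (fund_weight i :: 'm rvec) \<bullet> simple_root j = (if i = j then 1 else 0)"
    by blast+
qed

lemma sum_zero_space_sum:
  assumes "\<And>i. i \<in> A \<Longrightarrow> g i \<in> sum_zero_space"
  shows "(\<Sum>i\<in>A. c i *\<^sub>R g i) \<in> sum_zero_space"
proof -
  have "(\<Sum>j\<in>UNIV. (\<Sum>i\<in>A. c i *\<^sub>R g i) $ j) = (\<Sum>i\<in>A. c i * (\<Sum>j\<in>UNIV. g i $ j))"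
    by (simp add: sum_distrib_left) (rule sum.swap)
  also have "\<dots> = 0" using assms unfolding sum_zero_space_def by (intro sum.neutral) auto
  finally show ?thesis unfolding sum_zero_space_def by blast
qed

text \<open>The fundamental weights are dual to the simple roots, so coefficients are inner products
  and the weight lattice is given by integrality of these.\<close>

lemma dominant_weights_iff:
  fixes l :: "'m::{finite,linorder} rvec"
  shows "l \<in> dominant_weights \<longleftrightarrow> l \<in> sum_zero_space \<and>
    (\<forall>i\<in>{1..<CARD('m)}. l \<bullet> simple_root i \<in> \<int> \<and> 0 \<le> l \<bullet> simple_root i)"
proof -
  let ?N = "CARD('m)"
  have ip: "(\<Sum>i=1..<?N. c i *\<^sub>R fund_weight i :: 'm rvec) \<bullet> simple_root j = c j" if "j \<in> {1..<?N}" for c j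
  proof -
    have "(\<Sum>i=1..<?N. c i *\<^sub>R fund_weight i :: 'm rvec) \<bullet> simple_root j = (\<Sum>i=1..<?N. if i = j then c i else 0)"
      unfolding inner_sum_left by (rule sum.cong) (use fund_weight_spec(2)[where 'm = 'm] that in \<open>auto simp del: atLeastLessThan_iff\<close>)
    then show ?thesis using that by simp
  qed
  have sp: "(\<Sum>i=1..<?N. c i *\<^sub>R fund_weight i :: 'm rvec) \<in> sum_zero_space" for c
    by (rule sum_zero_space_sum) (rule fund_weight_spec(1))
  have "l \<in> weights \<longleftrightarrow> l \<in> sum_zero_space \<and> (\<forall>i\<in>{1..<?N}. l \<bullet> simple_root i \<in> \<int>)"
  proof
    assume "l \<in> weights"
    then obtain c where "l = (\<Sum>i=1..<?N. real_of_int (c i) *\<^sub>R fund_weight i)" unfolding weights_def by blast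
    then show "l \<in> sum_zero_space \<and> (\<forall>i\<in>{1..<?N}. l \<bullet> simple_root i \<in> \<int>)"
      using ip[of _ "\<lambda>i. real_of_int (c i)"] sp[of "\<lambda>i. real_of_int (c i)"] by (simp del: atLeastLessThan_iff)
  next
    assume a: "l \<in> sum_zero_space \<and> (\<forall>i\<in>{1..<?N}. l \<bullet> simple_root i \<in> \<int>)"
    have "l = (\<Sum>i=1..<?N. real_of_int \<lfloor>l \<bullet> simple_root i\<rfloor> *\<^sub>R fund_weight i)"
    proof (rule space_eqI)
      fix j assume j: "j \<in> {1..<?N}"
      show "l \<bullet> simple_root j = (\<Sum>i=1..<?N. real_of_int \<lfloor>l \<bullet> simple_root i\<rfloor> *\<^sub>R fund_weight i :: 'm rvec) \<bullet> simple_root j"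
        unfolding ip[OF j] using a j of_int_floor[of "l \<bullet> simple_root j"] by auto
    qed (use a sp in auto)
    then show "l \<in> weights" unfolding weights_def
      by (intro CollectI exI[of _ "\<lambda>i. \<lfloor>l \<bullet> simple_root i\<rfloor>"] conjI TrueI)
  qed
  then show ?thesis unfolding dominant_weights_def by blast
qed

section \<open>The dominance order\<close>

text \<open>On \<open>sum_zero_space\<close> this is the pairing with the fundamental weight of
  index \<open>p\<close>, so it reads off the coefficient of the corresponding simple root.\<close>

definition psum :: "'m::{finite,linorder} rvec \<Rightarrow> nat \<Rightarrow> real" where
  "psum x p = (\<Sum>i=1..p. crd x i)"

lemma psum_simps [simp]:
  "psum (x - y) p = psum x p - psum y p" "psum (c *\<^sub>R x) p = c * psum x p" "psum x 0 = 0"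
  "psum x (Suc p) = psum x p + crd x (Suc p)"
  by (simp_all add: psum_def sum_subtractf sum_distrib_left)

lemma psum_sum: "psum (\<Sum>a\<in>A. g a) p = (\<Sum>a\<in>A. psum (g a) p)"
  unfolding psum_def by (simp add: sum.swap[of _ A])

lemma psum_card: "x \<in> sum_zero_space \<Longrightarrow> psum x CARD('m) = 0" for x :: "'m::{finite,linorder} rvec"
  by (simp add: psum_def sum_zero_space_iff)

lemma psum_eqI:
  fixes x y :: "'m::{finite,linorder} rvec"
  assumes "x \<in> sum_zero_space" "y \<in> sum_zero_space" "\<And>p. p \<in> {1..<CARD('m)} \<Longrightarrow> psum x p = psum y p"
  shows "x = y"
proof (rule crd_eqI)
  fix i assume i: "i \<in> {1..CARD('m)}"
  have eq: "psum x p = psum y p" if "p \<le> CARD('m)" for p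
  proof (cases "p = 0 \<or> p = CARD('m)")
    case True
    then show ?thesis using psum_card[OF assms(1)] psum_card[OF assms(2)] by auto
  next
    case False
    then show ?thesis using assms(3)[of p] that by simp
  qed
  obtain q where "i = Suc q" "Suc q \<le> CARD('m)" using i by (cases i) auto
  then show "crd x i = crd y i" using eq[of "Suc q"] eq[of q] by simp
qed

lemma psum_simple_root:
  assumes "i \<in> {1..<CARD('m)}" "p \<le> CARD('m)"
  shows "psum (simple_root i :: 'm::{finite,linorder} rvec) p = (if i = p then 1 else 0)"
proof -
  have b: "psum (std_basis j :: 'm rvec) p = (if j \<le> p then 1 else 0)" if j: "j \<in> {1..CARD('m)}" for j
  proof -
    have "psum (std_basis j :: 'm rvec) p = (\<Sum>l=1..p. if j = l then 1 else 0)"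
      unfolding psum_def
    proof (rule sum.cong[OF refl])
      fix l assume "l \<in> {1..p}"
      then have "l \<in> {1..CARD('m)}" using assms(2) by auto
      then show "crd (std_basis j :: 'm rvec) l = (if j = l then 1 else 0)" using crd_std_basis[OF j] by blast
    qed
    then show ?thesis using j by auto
  qed
  have "i \<in> {1..CARD('m)}" "i + 1 \<in> {1..CARD('m)}" using assms(1) by auto
  from b[OF this(1)] b[OF this(2)] show ?thesis unfolding simple_root_def psum_simps by auto
qed

lemma simple_root_in_space:
  assumes "i \<in> {1..<CARD('m)}"
  shows "(simple_root i :: 'm::{finite,linorder} rvec) \<in> sum_zero_space"
proof -
  have "psum (simple_root i :: 'm rvec) CARD('m) = 0" using psum_simple_root[OF assms order_refl] assms by auto
  then show ?thesis by (simp add: psum_def sum_zero_space_iff)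
qed

lemma sum_zero_space_diff:
  "x \<in> sum_zero_space \<Longrightarrow> y \<in> sum_zero_space \<Longrightarrow> x - y \<in> sum_zero_space"
  unfolding sum_zero_space_def by (simp add: sum_subtractf)

text \<open>The partial sums of \<open>l - \<mu>\<close> are its simple root coefficients. At
  \<open>p = 0\<close> and \<open>p = N\<close> they vanish, so including these bounds demands
  nothing extra.\<close>

lemma dominance_le_iff:
  fixes \<mu> l :: "'m::{finite,linorder} rvec"
  assumes \<mu>: "\<mu> \<in> sum_zero_space" and l: "l \<in> sum_zero_space"
  shows "dominance_le \<mu> l \<longleftrightarrow> (\<forall>p\<le>CARD('m). psum l p - psum \<mu> p \<in> \<nat>)"
proof -
  let ?N = "CARD('m)"
  have ps: "psum (\<Sum>i=1..<?N. c i *\<^sub>R simple_root i :: 'm rvec) p = (if p \<in> {1..<?N} then c p else 0)"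
    if "p \<le> ?N" for c p
  proof -
    have "psum (\<Sum>i=1..<?N. c i *\<^sub>R simple_root i :: 'm rvec) p = (\<Sum>i=1..<?N. if i = p then c i else 0)"
      unfolding psum_sum
    proof (rule sum.cong[OF refl])
      fix i assume "i \<in> {1..<?N}"
      from psum_simple_root[OF this that]
      show "psum (c i *\<^sub>R simple_root i :: 'm rvec) p = (if i = p then c i else 0)" by simp
    qed
    then show ?thesis by simp
  qed
  have sp: "(\<Sum>i=1..<?N. c i *\<^sub>R simple_root i :: 'm rvec) \<in> sum_zero_space" for c
    by (rule sum_zero_space_sum) (rule simple_root_in_space)
  show ?thesis
  proof
    assume "dominance_le \<mu> l"
    then obtain c :: "nat \<Rightarrow> nat" where c: "l - \<mu> = (\<Sum>i=1..<?N. real (c i) *\<^sub>R simple_root i)"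
      unfolding dominance_le_def by blast
    show "\<forall>p\<le>?N. psum l p - psum \<mu> p \<in> \<nat>"
    proof (intro allI impI)
      fix p assume p: "p \<le> ?N"
      have "psum l p - psum \<mu> p = psum (l - \<mu>) p" by simp
      also have "\<dots> = (if p \<in> {1..<?N} then real (c p) else 0)"
        unfolding c by (rule ps[OF p])
      finally show "psum l p - psum \<mu> p \<in> \<nat>" by (simp split: if_splits)
    qed
  next
    assume a: "\<forall>p\<le>?N. psum l p - psum \<mu> p \<in> \<nat>"
    define c where "c p = nat \<lfloor>psum l p - psum \<mu> p\<rfloor>" for p
    have c: "real (c p) = psum l p - psum \<mu> p" if "p \<le> ?N" for p
    proof -
      have "psum l p - psum \<mu> p \<in> \<nat>" using a that by blast
      then obtain n where "psum l p - psum \<mu> p = real n" by (rule Nats_cases)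
      then show ?thesis unfolding c_def by simp
    qed
    have "l - \<mu> = (\<Sum>i=1..<?N. real (c i) *\<^sub>R simple_root i)"
    proof (rule psum_eqI[OF sum_zero_space_diff[OF l \<mu>] sp])
      fix p assume p: "p \<in> {1..<?N}"
      then have "p \<le> ?N" by simp
      from ps[OF this, of "\<lambda>i. real (c i)"] c[OF this] p
      show "psum (l - \<mu>) p = psum (\<Sum>i=1..<?N. real (c i) *\<^sub>R simple_root i :: 'm rvec) p" by simp
    qed
    then show "dominance_le \<mu> l" unfolding dominance_le_def by blast
  qed
qed

lemma dominant_weights_in_space: "l \<in> dominant_weights \<Longrightarrow> l \<in> sum_zero_space"
  unfolding dominant_weights_iff by blast

lemma dominance_le_trans:
  fixes \<kappa> \<mu> l :: "'m::{finite,linorder} rvec"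
  assumes "\<kappa> \<in> sum_zero_space" "\<mu> \<in> sum_zero_space" "l \<in> sum_zero_space" "dominance_le \<kappa> \<mu>" "dominance_le \<mu> l"
  shows "dominance_le \<kappa> l"
  unfolding dominance_le_iff[OF assms(1,3)]
proof (intro allI impI)
  fix p assume "p \<le> CARD('m)"
  then have "psum l p - psum \<mu> p \<in> \<nat>" "psum \<mu> p - psum \<kappa> p \<in> \<nat>"
    using assms(4,5) unfolding dominance_le_iff[OF assms(1,2)] dominance_le_iff[OF assms(2,3)] by blast+
  from Nats_add[OF this] show "psum l p - psum \<kappa> p \<in> \<nat>" by simp
qed

section \<open>Heights, covers and meets in the dominance order\<close>

text \<open>On \<open>sum_zero_space\<close> this is the pairing with the sum of the fundamental
  weights, that is, with half the sum of the positive roots.\<close>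

definition height :: "'m::{finite,linorder} rvec \<Rightarrow> real" where
  "height x = (\<Sum>p=1..<CARD('m). psum x p)"

lemma height_less:
  fixes \<mu> l :: "'m::{finite,linorder} rvec"
  assumes "\<mu> \<in> sum_zero_space" "l \<in> sum_zero_space" "dominance_le \<mu> l" "\<mu> \<noteq> l"
  shows "height \<mu> + 1 \<le> height l"
proof -
  have nat: "psum l p - psum \<mu> p \<in> \<nat>" if "p \<in> {1..<CARD('m)}" for p
    using assms(3) that unfolding dominance_le_iff[OF assms(1,2)] by auto
  obtain q where q: "q \<in> {1..<CARD('m)}" "psum \<mu> q \<noteq> psum l q" using psum_eqI[OF assms(1,2)] assms(4) by blast
  obtain n where n: "psum l q - psum \<mu> q = real n" using nat[OF q(1)] by (rule Nats_cases)
  then have "n \<noteq> 0" using q(2) by auto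
  then have "1 \<le> psum l q - psum \<mu> q" unfolding n by simp
  also have "\<dots> \<le> (\<Sum>p=1..<CARD('m). psum l p - psum \<mu> p)"
  proof (rule member_le_sum[OF q(1)])
    fix p assume "p \<in> {1..<CARD('m)} - {q}"
    then have "psum l p - psum \<mu> p \<in> \<nat>" using nat by blast
    then show "0 \<le> psum l p - psum \<mu> p" by (auto elim: Nats_cases)
  qed simp
  finally show ?thesis unfolding height_def by (simp add: sum_subtractf)
qed

lemma dominant_crd_antimono:
  fixes l :: "'m::{finite,linorder} rvec"
  assumes "l \<in> dominant_weights" "1 \<le> i" "i \<le> j" "j \<le> CARD('m)"
  shows "crd l j \<le> crd l i"
  using assms(3,4)
proof (induction j rule: dec_induct)
  case (step n)
  then have "n \<in> {1..<CARD('m)}" using assms(2) by auto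
  then have "0 \<le> l \<bullet> simple_root n" using assms(1) unfolding dominant_weights_iff by blast
  then show ?case using step by (simp add: inner_simple_root)
qed simp

text \<open>The coordinates decrease and add up to zero: either the first \<open>p\<close> are all
  nonnegative, or all later ones are nonpositive.\<close>

lemma dominant_psum_nonneg:
  fixes l :: "'m::{finite,linorder} rvec"
  assumes l: "l \<in> dominant_weights" and p: "p \<in> {1..<CARD('m)}"
  shows "0 \<le> psum l p"
proof (cases "0 \<le> crd l p")
  case True
  have "0 \<le> crd l i" if "i \<in> {1..p}" for i
    using dominant_crd_antimono[OF l, of i p] that p True by auto
  then show ?thesis unfolding psum_def by (intro sum_nonneg) blast
next
  case False
  have "crd l i \<le> 0" if "i \<in> {Suc p..CARD('m)}" for i
    using dominant_crd_antimono[OF l, of p i] that p False by auto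
  then have "(\<Sum>i=Suc p..CARD('m). crd l i) \<le> 0" by (intro sum_nonpos) blast
  moreover have "psum l CARD('m) = psum l p + (\<Sum>i=Suc p..CARD('m). crd l i)"
  proof -
    have "{1..CARD('m)} = {1..p} \<union> {Suc p..CARD('m)}" using p by auto
    then show ?thesis unfolding psum_def by (simp only:) (rule sum.union_disjoint, auto)
  qed
  ultimately show ?thesis using psum_card[OF dominant_weights_in_space[OF l]] by simp
qed

lemma height_nonneg: "l \<in> dominant_weights \<Longrightarrow> 0 \<le> height l"
  unfolding height_def by (intro sum_nonneg) (rule dominant_psum_nonneg)

text \<open>Heights of weights need not be integers, but strict dominance changes them by at least
  one, so their floors serve as well-founded measures.\<close>

lemma nat_floor_less: "0 \<le> x \<Longrightarrow> x + 1 \<le> y \<Longrightarrow> nat \<lfloor>x\<rfloor> < nat \<lfloor>y\<rfloor>" for x y :: real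
  by linarith

text \<open>Among the dominant weights at or above \<kappa> and strictly below \<mu>, one with least
  floored height distance to \<mu> admits nothing strictly in between.\<close>

lemma dominant_cover_exists:
  fixes \<kappa> \<mu> :: "'m::{finite,linorder} rvec"
  assumes \<kappa>: "\<kappa> \<in> dominant_weights" and \<mu>: "\<mu> \<in> dominant_weights" and le: "dominance_le \<kappa> \<mu>" "\<kappa> \<noteq> \<mu>"
  obtains \<nu> where "dominant_cover \<nu> \<mu>" "dominance_le \<kappa> \<nu>"
proof -
  let ?P = "\<lambda>\<nu>. \<nu> \<in> dominant_weights \<and> dominance_le \<kappa> \<nu> \<and> dominance_le \<nu> \<mu> \<and> \<nu> \<noteq> \<mu>"
  note sp = dominant_weights_in_space
  have "dominance_le \<kappa> \<kappa>" unfolding dominance_le_iff[OF sp[OF \<kappa>] sp[OF \<kappa>]] by simp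
  then have "?P \<kappa>" using \<kappa> le by blast
  then obtain \<nu> where \<nu>: "?P \<nu>" and min: "\<And>\<rho>. ?P \<rho> \<Longrightarrow> nat \<lfloor>height \<mu> - height \<nu>\<rfloor> \<le> nat \<lfloor>height \<mu> - height \<rho>\<rfloor>"
    using ex_has_least_nat[of ?P \<kappa> "\<lambda>\<nu>. nat \<lfloor>height \<mu> - height \<nu>\<rfloor>"] by blast
  have "\<rho> = \<nu> \<or> \<rho> = \<mu>" if \<rho>: "\<rho> \<in> dominant_weights" "dominance_le \<nu> \<rho> \<and> dominance_le \<rho> \<mu>" for \<rho>
  proof (rule ccontr)
    assume n: "\<not> (\<rho> = \<nu> \<or> \<rho> = \<mu>)"
    have "dominance_le \<kappa> \<rho>" using dominance_le_trans[OF sp[OF \<kappa>] sp sp[OF \<rho>(1)]] \<nu> \<rho> by blast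
    then have "?P \<rho>" using \<rho> n by blast
    moreover have "height \<nu> + 1 \<le> height \<rho>" using height_less[OF sp sp[OF \<rho>(1)]] \<nu> \<rho> n by blast
    moreover have "height \<rho> + 1 \<le> height \<mu>" using height_less[OF sp[OF \<rho>(1)] sp[OF \<mu>]] \<rho> n by blast
    ultimately show False
      using min[of \<rho>] nat_floor_less[of "height \<mu> - height \<rho>" "height \<mu> - height \<nu>"] by linarith
  qed
  then have "dominant_cover \<nu> \<mu>" using \<nu> \<mu> unfolding dominant_cover_def by blast
  then show ?thesis using that \<nu> by blast
qed

text \<open>Dominance of a weight is concavity of its partial sums in \<open>p\<close>, and a
  minimum of concave functions is concave. The common upper bound \<open>l\<close> makes the partial
  sums of \<mu> and \<nu> differ by integers, so the minimum stays in the same coset of the root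
  lattice.\<close>

lemma dominant_meet_exists:
  fixes l \<mu> \<nu> :: "'m::{finite,linorder} rvec"
  assumes l: "l \<in> dominant_weights" and \<mu>: "\<mu> \<in> dominant_weights" "dominance_le \<mu> l"
    and \<nu>: "\<nu> \<in> dominant_weights" "dominance_le \<nu> l"
  obtains \<kappa> where "\<kappa> \<in> dominant_weights" "dominance_le \<kappa> \<mu>" "dominance_le \<kappa> \<nu>"
    "\<And>p. p \<le> CARD('m) \<Longrightarrow> psum \<kappa> p = min (psum \<mu> p) (psum \<nu> p)"
proof -
  let ?N = "CARD('m)"
  note sp = dominant_weights_in_space
  define P where "P p = min (psum \<mu> p) (psum \<nu> p)" for p
  define \<kappa> :: "'m rvec" where "\<kappa> = vec_of (\<lambda>i. P i - P (i - 1))"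
  have crd: "crd \<kappa> i = P i - P (i - 1)" if "i \<in> {1..?N}" for i unfolding \<kappa>_def by (rule crd_vec_of[OF that])
  have ps: "psum \<kappa> p = P p" if "p \<le> ?N" for p
    using that
  proof (induction p)
    case 0
    show ?case by (simp add: P_def)
  next
    case (Suc p)
    then show ?case using crd[of "Suc p"] by simp
  qed
  have "P ?N = 0" unfolding P_def psum_card[OF sp[OF \<mu>(1)]] psum_card[OF sp[OF \<nu>(1)]] by simp
  then have \<kappa>s: "\<kappa> \<in> sum_zero_space" using ps[of ?N] by (simp add: psum_def sum_zero_space_iff)
  have d\<mu>: "psum l p - psum \<mu> p \<in> \<nat>" and d\<nu>: "psum l p - psum \<nu> p \<in> \<nat>" if "p \<le> ?N" for p
    using that \<mu>(2) \<nu>(2) unfolding dominance_le_iff[OF sp[OF \<mu>(1)] sp[OF l]] dominance_le_iff[OF sp[OF \<nu>(1)] sp[OF l]] by blast+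
  have dP: "psum l p - P p \<in> \<int>" if "p \<le> ?N" for p
    using d\<mu>[OF that] d\<nu>[OF that] Nats_subset_Ints unfolding P_def min_def by auto
  have diff: "psum \<mu> p - P p \<in> \<nat> \<and> psum \<nu> p - P p \<in> \<nat>" if "p \<le> ?N" for p
  proof -
    obtain m where m: "psum l p - psum \<mu> p = real m" using d\<mu>[OF \<open>p \<le> ?N\<close>] by (rule Nats_cases)
    obtain n where n: "psum l p - psum \<nu> p = real n" using d\<nu>[OF \<open>p \<le> ?N\<close>] by (rule Nats_cases)
    have "psum \<mu> p - P p = real (max m n - m) \<and> psum \<nu> p - P p = real (max m n - n)"
      using m n unfolding P_def by (auto simp: min_def max_def)
    then show ?thesis by (metis of_nat_in_Nats)
  qed
  have second: "x \<bullet> simple_root i = 2 * psum x i - psum x (i - 1) - psum x (Suc i)" if i: "i \<in> {1..<?N}" for i and x :: "'m rvec"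
  proof -
    obtain q where "i = Suc q" using i by (cases i) auto
    then show ?thesis by (simp add: inner_simple_root)
  qed
  have "\<kappa> \<bullet> simple_root i \<in> \<int> \<and> 0 \<le> \<kappa> \<bullet> simple_root i" if i: "i \<in> {1..<?N}" for i
  proof
    have le: "i \<le> ?N" "i - 1 \<le> ?N" "Suc i \<le> ?N" using i by auto
    have \<kappa>i: "\<kappa> \<bullet> simple_root i = 2 * P i - P (i - 1) - P (Suc i)"
      unfolding second[OF i] ps[OF le(1)] ps[OF le(2)] ps[OF le(3)] ..
    have li: "l \<bullet> simple_root i \<in> \<int>" using l i unfolding dominant_weights_iff by blast
    \<comment> \<open>The partial sums themselves need not be integers; integrality is inherited
      from \<open>l\<close>, since those of \<kappa> and \<open>l\<close> differ by
      integers.\<close>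
    have eq: "\<kappa> \<bullet> simple_root i = l \<bullet> simple_root i - 2 * (psum l i - P i) + (psum l (i - 1) - P (i - 1)) + (psum l (Suc i) - P (Suc i))"
      unfolding \<kappa>i second[OF i, of l] by simp
    show "\<kappa> \<bullet> simple_root i \<in> \<int>" unfolding eq
      by (rule Ints_add[OF Ints_add[OF Ints_diff[OF li Ints_mult[OF Ints_numeral dP[OF le(1)]]] dP[OF le(2)]] dP[OF le(3)]])
    have "0 \<le> 2 * psum \<mu> i - psum \<mu> (i - 1) - psum \<mu> (Suc i)" "0 \<le> 2 * psum \<nu> i - psum \<nu> (i - 1) - psum \<nu> (Suc i)"
      unfolding second[OF i, symmetric] using \<mu>(1) \<nu>(1) i unfolding dominant_weights_iff by blast+
    then show "0 \<le> \<kappa> \<bullet> simple_root i" unfolding \<kappa>i P_def by (simp only: min_def) (simp split: if_splits)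
  qed
  then have \<kappa>: "\<kappa> \<in> dominant_weights" unfolding dominant_weights_iff using \<kappa>s by blast
  have "dominance_le \<kappa> \<mu>" "dominance_le \<kappa> \<nu>"
    unfolding dominance_le_iff[OF \<kappa>s sp[OF \<mu>(1)]] dominance_le_iff[OF \<kappa>s sp[OF \<nu>(1)]] using diff ps by simp_all
  then show ?thesis using that \<kappa> ps unfolding P_def by blast
qed

section \<open>Lower intervals\<close>

lemma dominant_crd_diff_int:
  fixes l :: "'m::{finite,linorder} rvec"
  assumes "l \<in> dominant_weights" "1 \<le> i" "i \<le> CARD('m)"
  shows "crd l i - crd l 1 \<in> \<int>"
  using assms(2,3)
proof (induction i rule: dec_induct)
  case (step n)
  then have "n \<in> {1..<CARD('m)}" by auto
  then have "l \<bullet> simple_root n \<in> \<int>" using assms(1) unfolding dominant_weights_iff by blast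
  moreover have "crd l n - crd l 1 \<in> \<int>" using step by simp
  ultimately have "(crd l n - crd l 1) - l \<bullet> simple_root n \<in> \<int>" by (rule Ints_diff[rotated])
  then show ?case by (simp add: inner_simple_root)
qed simp

text \<open>As \<open>w0\<close> is an involution, it carries the base point of the alcove of
  \<open>a\<close> from the negative box back to the positive one. That makes the window weakly
  decreasing, and distinct entries make it strictly so.\<close>

lemma box_element_window:
  fixes a :: "'m::{finite,linorder} rvec \<Rightarrow> 'm rvec"
  assumes N: "2 \<le> CARD('m)" and a: "a \<in> box_elements"
  shows "w0 \<otimes>\<^bsub>space_group\<^esub> a \<in> carrier aff_weyl" "decreasing_window CARD('m) (window (w0 \<otimes>\<^bsub>space_group\<^esub> a))"
proof -
  let ?c = "w0 \<otimes>\<^bsub>space_group\<^esub> a"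
  have ac: "a \<in> carrier aff_weyl" and sub: "alcove a \<subseteq> neg_box" using a unfolding box_elements_def by auto
  show c: "?c \<in> carrier aff_weyl" by (rule mult_in_aff_weyl[OF w0_window(1)[OF N] ac])
  have "a base_point \<in> alcove a" unfolding alcove_def by (rule imageI[OF base_point_in_fund_alcove])
  then obtain y where y: "y \<in> pos_box" "a base_point = w0 y" using sub unfolding neg_box_def by blast
  have ys: "y \<in> sum_zero_space" using y(1) unfolding pos_box_def by blast
  have cy: "?c base_point = y"
    unfolding space_group_apply[OF aff_weyl_Bij[OF w0_window(1)[OF N]] aff_weyl_Bij[OF ac] base_point_in_space] y(2)
    by (rule w0_involutive[OF N ys])
  show "decreasing_window CARD('m) (window ?c)"
  proof (rule decreasing_windowI)
    fix i assume i: "i \<in> {1..<CARD('m)}"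
    then have ii: "i \<in> {1..CARD('m)}" "Suc i \<in> {1..CARD('m)}" by auto
    have "0 \<le> y \<bullet> simple_root i" using y(1) i unfolding pos_box_def by blast
    then have "crd y (Suc i) \<le> crd y i" by (simp add: inner_simple_root)
    then have "CARD('m) * crd y (Suc i) \<le> CARD('m) * crd y i" by (intro mult_left_mono) auto
    then have "window ?c (Suc i) \<le> window ?c i"
      using window_real[OF c ii(1)] window_real[OF c ii(2)] unfolding cy by linarith
    moreover have "window ?c i \<noteq> window ?c (Suc i)"
      using inj_onD[OF window_inj[OF is_window_window[OF c]] _ ii] by auto
    ultimately show "window ?c (Suc i) < window ?c i" by simp
  qed
qed

text \<open>The coordinates of \<open>l\<close> agree modulo integers. Adding \<open>N\<close> times
  them shifts all residues by one common amount and keeps the sum, so the result is again a window.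
  Its element has the translated alcove and is unique by \<open>alcove_inject\<close>.\<close>

lemma theta_window:
  fixes a :: "'m::{finite,linorder} rvec \<Rightarrow> 'm rvec"
  assumes N: "2 \<le> CARD('m)" and a: "a \<in> box_elements" and l: "l \<in> dominant_weights"
  shows "theta a l \<in> carrier aff_weyl"
    "\<And>i. i \<in> {1..CARD('m)} \<Longrightarrow>
      real_of_int (window (theta a l) i) = real_of_int (window (w0 \<otimes>\<^bsub>space_group\<^esub> a) i) + CARD('m) * crd l i"
proof -
  let ?N = "CARD('m)" and ?c = "w0 \<otimes>\<^bsub>space_group\<^esub> a"
  note c = box_element_window(1)[OF N a]
  have ls: "l \<in> sum_zero_space" by (rule dominant_weights_in_space[OF l])
  define e where "e i = \<lfloor>crd l i - crd l 1\<rfloor>" for i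
  have e: "crd l i = crd l 1 + e i" if "i \<in> {1..?N}" for i
  proof -
    have "crd l i - crd l 1 \<in> \<int>" using dominant_crd_diff_int[OF l] that by auto
    then show ?thesis unfolding e_def using of_int_floor[of "crd l i - crd l 1"] by simp
  qed
  \<comment> \<open>The coordinates of \<open>l\<close> add up to zero, so \<open>N\<close> times
    the first one is this integer.\<close>
  define q where "q = - (\<Sum>i=1..?N. e i)"
  have q: "?N * crd l 1 = q"
  proof -
    have "(\<Sum>i=1..?N. crd l i) = (\<Sum>i=1..?N. crd l 1 + e i)" by (rule sum.cong[OF refl], rule e)
    then show ?thesis using ls unfolding q_def by (simp add: sum_zero_space_iff sum.distrib)
  qed
  define Z where "Z i = (if i \<in> {1..?N} then window ?c i + q + int ?N * e i else 0)" for i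
  have Zr: "real_of_int (Z i) = real_of_int (window ?c i) + ?N * crd l i" if "i \<in> {1..?N}" for i
  proof -
    have "real ?N * crd l i = q + ?N * e i" unfolding e[OF that] using q by (simp add: distrib_left)
    then show ?thesis using that unfolding Z_def by simp
  qed
  have wc: "is_window ?N (window ?c)" by (rule is_window_window[OF c])
  have "is_window ?N Z"
    unfolding is_window_def
  proof (intro conjI ballI impI allI)
    fix i j assume ij: "i \<in> {1..?N}" "j \<in> {1..?N}" and eq: "Z i mod int ?N = Z j mod int ?N"
    have "(window ?c i + q) mod int ?N = (window ?c j + q) mod int ?N"
      using eq ij unfolding Z_def by simp
    then have "int ?N dvd window ?c i - window ?c j" by (simp add: mod_eq_dvd_iff)
    then have "window ?c i mod int ?N = window ?c j mod int ?N" by (simp add: mod_eq_dvd_iff)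
    then show "i = j" using wc ij unfolding is_window_def by blast
  next
    have "(\<Sum>i=1..?N. Z i) = (\<Sum>i=1..?N. window ?c i + q + int ?N * e i)"
      by (rule sum.cong) (auto simp: Z_def)
    also have "\<dots> = (\<Sum>i=1..?N. window ?c i) + int ?N * q + int ?N * (\<Sum>i=1..?N. e i)"
      by (simp add: sum.distrib sum_distrib_left)
    also have "\<dots> = (\<Sum>i=1..?N. window ?c i)" unfolding q_def by simp
    also have "\<dots> = (\<Sum>i=1..?N. int i)" using wc unfolding is_window_def by blast
    finally show "(\<Sum>i=1..?N. Z i) = (\<Sum>i=1..?N. int i)" .
  qed (auto simp: Z_def)
  from window_word_exists[OF N this] obtain w :: "'m rvec \<Rightarrow> 'm rvec" where
    w: "w \<in> carrier aff_weyl" "window w = Z" using word_in_aff_weyl[OF N] by blast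
  have wb: "crd (w base_point) i = crd (?c base_point) i + crd l i" if i: "i \<in> {1..?N}" for i
  proof -
    have "?N * crd (w base_point) i = ?N * (crd (?c base_point) i + crd l i)"
      using window_real[OF w(1) i] window_real[OF c i] Zr[OF i] unfolding w(2) by (simp add: distrib_left)
    then show ?thesis by simp
  qed
  \<comment> \<open>Differences of coordinates of \<open>l\<close> are integers, so translating by
    \<open>l\<close> shifts the floors of the point and of the reference point by the same
    amount.\<close>
  have mem: "y \<in> alcove w \<longleftrightarrow> y - l \<in> alcove ?c" for y
  proof -
    have "y \<in> sum_zero_space \<longleftrightarrow> y - l \<in> sum_zero_space"
      using ls unfolding sum_zero_space_def by (simp add: sum_subtractf)
    moreover have "\<lfloor>crd y i - crd y j\<rfloor> = \<lfloor>crd (w base_point) i - crd (w base_point) j\<rfloor> \<longleftrightarrow>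
        \<lfloor>crd (y - l) i - crd (y - l) j\<rfloor> = \<lfloor>crd (?c base_point) i - crd (?c base_point) j\<rfloor>"
      if ij: "i \<in> {1..?N}" "j \<in> {1..?N}" for i j
    proof -
      have lij: "crd l i - crd l j = of_int (e i - e j)" using e[OF ij(1)] e[OF ij(2)] by simp
      have "crd (w base_point) i - crd (w base_point) j =
          (crd (?c base_point) i - crd (?c base_point) j) + of_int (e i - e j)"
        unfolding wb[OF ij(1)] wb[OF ij(2)] lij[symmetric] by simp
      moreover have "crd y i - crd y j = (crd (y - l) i - crd (y - l) j) + of_int (e i - e j)"
        unfolding lij[symmetric] by simp
      ultimately show ?thesis by (simp only: floor_add_int[symmetric] add_right_cancel)
    qed
    ultimately show ?thesis unfolding alcove_eq[OF w(1)] alcove_eq[OF c] mem_Collect_eq by blast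
  qed
  have aw: "alcove w = (\<lambda>x. x + l) ` alcove ?c"
  proof (intro equalityI subsetI)
    fix y assume "y \<in> alcove w"
    then have "y - l \<in> alcove ?c" "y = (y - l) + l" using mem by simp_all
    then show "y \<in> (\<lambda>x. x + l) ` alcove ?c" by blast
  next
    fix y assume "y \<in> (\<lambda>x. x + l) ` alcove ?c"
    then obtain x where "x \<in> alcove ?c" "y = x + l" by blast
    then show "y \<in> alcove w" using mem[of y] by simp
  qed
  have t: "theta a l = w"
    unfolding theta_def aff_weyl_simps
  proof (rule the_equality)
    show "w \<in> carrier aff_weyl \<and> alcove w = (\<lambda>x. x + l) ` alcove ?c" using w(1) aw by blast
    fix v assume "v \<in> carrier aff_weyl \<and> alcove v = (\<lambda>x. x + l) ` alcove ?c"
    then show "v = w" using alcove_inject[of v w] w(1) aw by simp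
  qed
  show "theta a l \<in> carrier aff_weyl" unfolding t by (rule w(1))
  show "real_of_int (window (theta a l) i) = real_of_int (window ?c i) + ?N * crd l i" if "i \<in> {1..?N}" for i
    unfolding t w(2) by (rule Zr[OF that])
qed

lemma theta_decreasing:
  fixes a :: "'m::{finite,linorder} rvec \<Rightarrow> 'm rvec"
  assumes N: "2 \<le> CARD('m)" and a: "a \<in> box_elements" and l: "l \<in> dominant_weights"
  shows "decreasing_window CARD('m) (window (theta a l))"
proof (rule decreasing_windowI)
  fix i assume i: "i \<in> {1..<CARD('m)}"
  then have ii: "i \<in> {1..CARD('m)}" "Suc i \<in> {1..CARD('m)}" by auto
  have "crd l (Suc i) \<le> crd l i" using dominant_crd_antimono[OF l, of i "Suc i"] i by simp
  then have "CARD('m) * crd l (Suc i) \<le> CARD('m) * crd l i" by (intro mult_left_mono) auto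
  moreover have "window (w0 \<otimes>\<^bsub>space_group\<^esub> a) (Suc i) < window (w0 \<otimes>\<^bsub>space_group\<^esub> a) i"
    using box_element_window(2)[OF N a] ii unfolding decreasing_window_def by blast
  ultimately have "real_of_int (window (theta a l) (Suc i)) < real_of_int (window (theta a l) i)"
    unfolding theta_window(2)[OF N a l ii(1)] theta_window(2)[OF N a l ii(2)] by linarith
  then show "window (theta a l) (Suc i) < window (theta a l) i" by simp
qed

lemma theta_window_translate:
  fixes a :: "'m::{finite,linorder} rvec \<Rightarrow> 'm rvec"
  assumes N: "2 \<le> CARD('m)" and a: "a \<in> box_elements" and l: "l \<in> dominant_weights" and \<mu>: "\<mu> \<in> dominant_weights"
    and int: "\<And>p. p \<le> CARD('m) \<Longrightarrow> psum l p - psum \<mu> p \<in> \<int>"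
  obtains d :: "nat \<Rightarrow> int" where
    "\<And>i. i \<in> {1..CARD('m)} \<Longrightarrow> window (theta a l) i = window (theta a \<mu>) i + int CARD('m) * d i"
    "\<And>p. p \<le> CARD('m) \<Longrightarrow> real_of_int (\<Sum>i=1..p. d i) = psum l p - psum \<mu> p"
proof -
  define d where "d i = \<lfloor>crd l i - crd \<mu> i\<rfloor>" for i
  have d: "real_of_int (d i) = crd l i - crd \<mu> i" if i: "i \<in> {1..CARD('m)}" for i
  proof -
    obtain q where q: "i = Suc q" "q \<le> CARD('m)" using i by (cases i) auto
    have "crd l i - crd \<mu> i = (psum l i - psum \<mu> i) - (psum l q - psum \<mu> q)" unfolding q(1) by simp
    then have "crd l i - crd \<mu> i \<in> \<int>" using Ints_diff[OF int[of i] int[OF q(2)]] i by simp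
    then show ?thesis unfolding d_def by (rule of_int_floor)
  qed
  have "window (theta a l) i = window (theta a \<mu>) i + int CARD('m) * d i" if i: "i \<in> {1..CARD('m)}" for i
  proof -
    have "real_of_int (window (theta a l) i) = real_of_int (window (theta a \<mu>) i + int CARD('m) * d i)"
      using theta_window(2)[OF N a l i] theta_window(2)[OF N a \<mu> i] by (simp add: d[OF i] algebra_simps)
    then show ?thesis by (simp only: of_int_eq_iff)
  qed
  moreover have "real_of_int (\<Sum>i=1..p. d i) = psum l p - psum \<mu> p" if "p \<le> CARD('m)" for p
  proof -
    have "real_of_int (\<Sum>i=1..p. d i) = (\<Sum>i=1..p. crd l i - crd \<mu> i)"
      unfolding of_int_sum by (rule sum.cong[OF refl], rule d) (use that in auto)
    then show ?thesis unfolding psum_def by (simp add: sum_subtractf)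
  qed
  ultimately show ?thesis using that by blast
qed

lemma lower_interval_iff:
  fixes a x :: "'m::{finite,linorder} rvec \<Rightarrow> 'm rvec"
  assumes N: "2 \<le> CARD('m)" and a: "a \<in> box_elements" and l: "l \<in> dominant_weights"
  shows "x \<in> lower_interval a l \<longleftrightarrow> x \<in> carrier aff_weyl \<and>
    (\<forall>j. bead_count CARD('m) (window x) j \<le> bead_count CARD('m) (window (theta a l)) j)"
proof (cases "x \<in> carrier aff_weyl")
  case x: True
  note t = theta_window(1)[OF N a l]
  have "x \<in> lower_interval a l \<longleftrightarrow> (window_step CARD('m))\<^sup>*\<^sup>* (window x) (window (theta a l))"
    unfolding lower_interval_def using x bruhat_le_iff[OF N x t] by blast
  also have "\<dots> \<longleftrightarrow> (\<forall>j. bead_count CARD('m) (window x) j \<le> bead_count CARD('m) (window (theta a l)) j)"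
    using bead_count_steps window_steps_if_bead_count_le[OF N is_window_window[OF x] is_window_window[OF t]
        theta_decreasing[OF N a l]] by blast
  finally show ?thesis using x by blast
qed (simp add: lower_interval_def)

lemma lower_interval_mono:
  fixes a :: "'m::{finite,linorder} rvec \<Rightarrow> 'm rvec"
  assumes N: "2 \<le> CARD('m)" and a: "a \<in> box_elements" and l: "l \<in> dominant_weights" and \<mu>: "\<mu> \<in> dominant_weights"
    and le: "dominance_le \<mu> l"
  shows "lower_interval a \<mu> \<subseteq> lower_interval a l"
proof -
  have nat: "psum l p - psum \<mu> p \<in> \<nat>" if "p \<le> CARD('m)" for p
    using le that unfolding dominance_le_iff[OF dominant_weights_in_space[OF \<mu>] dominant_weights_in_space[OF l]] by blast
  have int: "psum l p - psum \<mu> p \<in> \<int>" if "p \<le> CARD('m)" for p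
    using nat[OF that] Nats_subset_Ints by blast
  obtain d :: "nat \<Rightarrow> int" where
    d: "\<And>i. i \<in> {1..CARD('m)} \<Longrightarrow> window (theta a l) i = window (theta a \<mu>) i + int CARD('m) * d i"
      "\<And>p. p \<le> CARD('m) \<Longrightarrow> real_of_int (\<Sum>i=1..p. d i) = psum l p - psum \<mu> p"
    using theta_window_translate[OF N a l \<mu> int] by blast
  have "0 \<le> (\<Sum>i=1..p. d i)" if p: "p \<le> CARD('m)" for p
  proof -
    have "0 \<le> psum l p - psum \<mu> p" using nat[OF p] by (rule Nats_cases) simp
    then have "0 \<le> real_of_int (\<Sum>i=1..p. d i)" unfolding d(2)[OF p] .
    then show ?thesis by (simp only: of_int_0_le_iff)
  qed
  then have "bead_count CARD('m) (window (theta a \<mu>)) j \<le> bead_count CARD('m) (window (theta a l)) j" for j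
    using bead_count_mono_translate[OF _ theta_decreasing[OF N a \<mu>] d(1)] N by simp
  then show ?thesis
    unfolding subset_iff lower_interval_iff[OF N a l] lower_interval_iff[OF N a \<mu>] by (meson order_trans)
qed

lemma lower_interval_meet:
  fixes a :: "'m::{finite,linorder} rvec \<Rightarrow> 'm rvec"
  assumes N: "2 \<le> CARD('m)" and a: "a \<in> box_elements" and l: "l \<in> dominant_weights"
    and \<mu>: "\<mu> \<in> dominant_weights" "dominance_le \<mu> l" and \<nu>: "\<nu> \<in> dominant_weights" "dominance_le \<nu> l"
  obtains \<kappa> where "\<kappa> \<in> dominant_weights" "dominance_le \<kappa> \<mu>" "dominance_le \<kappa> \<nu>"
    "lower_interval a \<mu> \<inter> lower_interval a \<nu> \<subseteq> lower_interval a \<kappa>"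
proof -
  obtain \<kappa> where \<kappa>: "\<kappa> \<in> dominant_weights" "dominance_le \<kappa> \<mu>" "dominance_le \<kappa> \<nu>"
    and ps: "\<And>p. p \<le> CARD('m) \<Longrightarrow> psum \<kappa> p = min (psum \<mu> p) (psum \<nu> p)"
    using dominant_meet_exists[OF l \<mu> \<nu>] by blast
  note sp = dominant_weights_in_space
  have int: "psum \<kappa> p - psum \<rho> p \<in> \<int>"
    if "\<rho> \<in> dominant_weights" "dominance_le \<kappa> \<rho>" "p \<le> CARD('m)" for p \<rho>
  proof -
    have "psum \<rho> p - psum \<kappa> p \<in> \<nat>" using that unfolding dominance_le_iff[OF sp[OF \<kappa>(1)] sp[OF that(1)]] by blast
    then have "- (psum \<rho> p - psum \<kappa> p) \<in> \<int>" using Nats_subset_Ints by (intro Ints_minus) blast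
    then show ?thesis by simp
  qed
  obtain d :: "nat \<Rightarrow> int" where
    d: "\<And>i. i \<in> {1..CARD('m)} \<Longrightarrow> window (theta a \<kappa>) i = window (theta a \<mu>) i + int CARD('m) * d i"
      "\<And>p. p \<le> CARD('m) \<Longrightarrow> real_of_int (\<Sum>i=1..p. d i) = psum \<kappa> p - psum \<mu> p"
    using theta_window_translate[OF N a \<kappa>(1) \<mu>(1) int[OF \<mu>(1) \<kappa>(2)]] by blast
  obtain d' :: "nat \<Rightarrow> int" where
    d': "\<And>i. i \<in> {1..CARD('m)} \<Longrightarrow> window (theta a \<kappa>) i = window (theta a \<nu>) i + int CARD('m) * d' i"
      "\<And>p. p \<le> CARD('m) \<Longrightarrow> real_of_int (\<Sum>i=1..p. d' i) = psum \<kappa> p - psum \<nu> p"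
    using theta_window_translate[OF N a \<kappa>(1) \<nu>(1) int[OF \<nu>(1) \<kappa>(3)]] by blast
  \<comment> \<open>At each \<open>p\<close> the minimum is attained by \<mu> or by \<nu>, so one of
    the two differences of partial sums vanishes.\<close>
  have meet: "(\<Sum>i=1..p. d i) = 0 \<or> (\<Sum>i=1..p. d' i) = 0" if p: "p \<le> CARD('m)" for p
  proof -
    have "real_of_int (\<Sum>i=1..p. d i) = 0 \<or> real_of_int (\<Sum>i=1..p. d' i) = 0"
      unfolding d(2)[OF p] d'(2)[OF p] ps[OF p] by (auto simp: min_def)
    then show ?thesis by (simp only: of_int_eq_0_iff)
  qed
  have "x \<in> lower_interval a \<kappa>" if "x \<in> lower_interval a \<mu>" "x \<in> lower_interval a \<nu>" for x
  proof -
    have x: "x \<in> carrier aff_weyl" "\<And>j. bead_count CARD('m) (window x) j \<le> bead_count CARD('m) (window (theta a \<mu>)) j"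
      "\<And>j. bead_count CARD('m) (window x) j \<le> bead_count CARD('m) (window (theta a \<nu>)) j"
      using that unfolding lower_interval_iff[OF N a \<mu>(1)] lower_interval_iff[OF N a \<nu>(1)] by blast+
    have "bead_count CARD('m) (window x) j \<le> bead_count CARD('m) (window (theta a \<kappa>)) j" for j
      by (rule bead_count_le_meet[OF _ theta_decreasing[OF N a \<mu>(1)] theta_decreasing[OF N a \<nu>(1)] x(2,3) d(1) d'(1) meet])
        (use N in simp)
    then show ?thesis unfolding lower_interval_iff[OF N a \<kappa>(1)] using x(1) by blast
  qed
  then show ?thesis using that[OF \<kappa>] by blast
qed

theorem theoremA:
  fixes l :: "'m::{finite,linorder} rvec"
    and a :: "'m rvec \<Rightarrow> 'm rvec"
  assumes "CARD('m) \<ge> 2"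
    and "l \<in> dominant_weights"
    and "a \<in> box_elements"
  shows "lower_interval a l = (\<Union>\<mu> \<in> {\<mu> \<in> dominant_weights. dominance_le \<mu> l}. paper_boat a \<mu>)
    \<and> disjoint_family_on (paper_boat a) {\<mu> \<in> dominant_weights. dominance_le \<mu> l}"
proof
  note N = assms(1) and l = assms(2) and a = assms(3) and sp = dominant_weights_in_space
  let ?D = "{\<mu> \<in> dominant_weights. dominance_le \<mu> l}"
  show "lower_interval a l = (\<Union>\<mu>\<in>?D. paper_boat a \<mu>)"
  proof (intro equalityI subsetI)
    fix x assume x: "x \<in> lower_interval a l"
    let ?P = "\<lambda>\<mu>. \<mu> \<in> ?D \<and> x \<in> lower_interval a \<mu>"
    have "dominance_le l l" unfolding dominance_le_iff[OF sp[OF l] sp[OF l]] by simp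
    then have "?P l" using l x by blast
    \<comment> \<open>The element belongs to the boat of a weight of least floored height whose
      interval contains it: a lower interval of a covered weight containing it would have smaller
      height.\<close>
    then obtain \<mu> where \<mu>: "?P \<mu>" and min: "\<And>\<nu>. ?P \<nu> \<Longrightarrow> nat \<lfloor>height \<mu>\<rfloor> \<le> nat \<lfloor>height \<nu>\<rfloor>"
      using ex_has_least_nat[of ?P l "\<lambda>\<mu>. nat \<lfloor>height \<mu>\<rfloor>"] by blast
    have "x \<notin> lower_interval a \<nu>" if c: "dominant_cover \<nu> \<mu>" for \<nu>
    proof
      assume xn: "x \<in> lower_interval a \<nu>"
      have \<nu>: "\<nu> \<in> dominant_weights" "dominance_le \<nu> \<mu>" "\<nu> \<noteq> \<mu>" using c unfolding dominant_cover_def by blast+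
      have "dominance_le \<nu> l" using dominance_le_trans[OF sp[OF \<nu>(1)] sp sp[OF l] \<nu>(2)] \<mu> by blast
      then have "nat \<lfloor>height \<mu>\<rfloor> \<le> nat \<lfloor>height \<nu>\<rfloor>" using min \<nu>(1) xn by blast
      moreover have "height \<nu> + 1 \<le> height \<mu>" using height_less[OF sp[OF \<nu>(1)] sp \<nu>(2,3)] \<mu> by blast
      ultimately show False using nat_floor_less[OF height_nonneg[OF \<nu>(1)]] by fastforce
    qed
    then have "x \<in> paper_boat a \<mu>" using \<mu> unfolding paper_boat_def by blast
    then show "x \<in> (\<Union>\<mu>\<in>?D. paper_boat a \<mu>)" using \<mu> by blast
  next
    fix x assume "x \<in> (\<Union>\<mu>\<in>?D. paper_boat a \<mu>)"
    then obtain \<mu> where "\<mu> \<in> dominant_weights" "dominance_le \<mu> l" "x \<in> lower_interval a \<mu>"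
      unfolding paper_boat_def by blast
    then show "x \<in> lower_interval a l" using lower_interval_mono[OF N a l] by blast
  qed
  \<comment> \<open>If \<kappa> were strictly below \<mu>, a weight covered by \<mu> and above
    \<kappa> would, by monotonicity, have an interval containing the element, which the boat
    excludes.\<close>
  have key: "\<mu> = \<kappa>" if \<mu>: "\<mu> \<in> dominant_weights" "x \<in> paper_boat a \<mu>"
    and \<kappa>: "\<kappa> \<in> dominant_weights" "dominance_le \<kappa> \<mu>" "x \<in> lower_interval a \<kappa>" for x \<mu> \<kappa>
  proof (rule ccontr)
    assume "\<mu> \<noteq> \<kappa>"
    then obtain \<nu> where \<nu>: "dominant_cover \<nu> \<mu>" "dominance_le \<kappa> \<nu>"
      using dominant_cover_exists[OF \<kappa>(1) \<mu>(1) \<kappa>(2)] by blast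
    have \<nu>d: "\<nu> \<in> dominant_weights" using \<nu>(1) unfolding dominant_cover_def by blast
    have "x \<in> lower_interval a \<nu>" using lower_interval_mono[OF N a \<nu>d \<kappa>(1) \<nu>(2)] \<kappa>(3) by blast
    then show False using \<mu>(2) \<nu>(1) \<nu>d unfolding paper_boat_def by blast
  qed
  show "disjoint_family_on (paper_boat a) ?D"
    unfolding disjoint_family_on_def
  proof (intro ballI impI)
    fix \<mu> \<nu> assume \<mu>: "\<mu> \<in> ?D" and \<nu>: "\<nu> \<in> ?D" and ne: "\<mu> \<noteq> \<nu>"
    obtain \<kappa> where \<kappa>: "\<kappa> \<in> dominant_weights" "dominance_le \<kappa> \<mu>" "dominance_le \<kappa> \<nu>"
      "lower_interval a \<mu> \<inter> lower_interval a \<nu> \<subseteq> lower_interval a \<kappa>"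
      using lower_interval_meet[OF N a l, of \<mu> \<nu>] \<mu> \<nu> by blast
    have False if x: "x \<in> paper_boat a \<mu>" "x \<in> paper_boat a \<nu>" for x
    proof -
      have "x \<in> lower_interval a \<kappa>" using x \<kappa>(4) unfolding paper_boat_def by blast
      then have "\<mu> = \<kappa>" "\<nu> = \<kappa>" using key[OF _ x(1) \<kappa>(1,2)] key[OF _ x(2) \<kappa>(1,3)] \<mu> \<nu> by blast+
      then show False using ne by simp
    qed
    then show "paper_boat a \<mu> \<inter> paper_boat a \<nu> = {}" by blast
  qed
qed

end
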